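(* The following inclusions of algebras do not satisfy the Gleason--Whitney property (relative to the second algebra, unless otherwise stated): (a) $C([0,1])\subset L^\infty([0,1])$; (b) $L^\infty([0,1])\subset B(L^2([0,1]))$; (c) $\mathrm{A}(\mathbb{D})\subset H^\infty(\mathbb{D})$ relative to $L^\infty(\mathbb{T})$; (d) $H^\infty(\mathbb{D})\subset B(H^2(\mathbb{D}))$; (e) $H^\infty(\mathbb{D})\subset L^\infty(\mathbb{D})$; (f) $H^\infty(\mathbb{B}_d)\subset L^\infty(\partial\mathbb{B}_d)$ if $d\ge2$; (g) $H^\infty(\mathbb{D}^d)\subset L^\infty(\mathbb{T}^d)$ if $d\ge2$.
   Context: For subspaces $\mathcal{X}\subset\mathcal{Y}$ of a von Neumann algebra $\mathcal{W}$, a bounded functional on $\mathcal{X}$ is absolutely continuous relative to $\mathcal{W}$ if it extends to a weak-$*$ continuous functional on $\mathcal{W}$. The inclusion $\mathcal{X}\subset\mathcal{Y}$ has the Gleason--Whitney property relative to $\mathcal{W}$ if whenever $\phi\in\mathcal{X}^*$ is absolutely continuous and $\psi\in\mathcal{Y}^*$ satisfies $\psi|_{\mathcal{X}}=\phi$ and $\|\psi\|=\|\phi\|$, then $\psi$ is absolutely continuous relative to $\mathcal{W}$. Notation: $\mathbb{D}$ is the open unit disc in $\mathbb{C}$, $\mathbb{T}$ the unit circle, $\mathbb{B}_d$ the open unit ball of $\mathbb{C}^d$, $\partial\mathbb{B}_d$ the unit sphere. $H^\infty(\Omega)$ is the algebra of bounded holomorphic functions on $\Omega$ with the supremum norm;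 $\mathrm{A}(\mathbb{D})$ is the disc algebra, i.e. the norm closure of the polynomials in $H^\infty(\mathbb{D})$. The measures are: Lebesgue measure on $[0,1]$, arclength on $\mathbb{T}$, area measure on $\mathbb{D}$ (equivalently on $\overline{\mathbb{D}}$), the rotation invariant probability measure on $\partial\mathbb{B}_d$, and the product of normalized arclength measures on $\mathbb{T}^d$. In (b), $L^\infty([0,1])$ acts on $L^2([0,1])$ by multiplication operators. In (c), (f), (g), $H^\infty$ is embedded isometrically in $L^\infty$ of the indicated (distinguished) boundary via radial boundary limits. In (d), $H^\infty(\mathbb{D})$ acts on the Hardy space $H^2(\mathbb{D})$ by multiplication operators. In (e), $H^\infty(\mathbb{D})$ is regarded as a subalgebra of $L^\infty(\mathbb{D})$ in the obvious way. *)

theory Defs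
  imports
    "HOL-Probability.Probability"
    "HOL-Complex_Analysis.Complex_Analysis"
    "HOL-Library.Function_Algebras"
begin

(* Conventions.  Functions are not identified modulo null sets: all spaces below are spaces of
   functions (or of operators on functions) with a seminorm.  A linear functional that is bounded
   for the seminorm vanishes on the elements of seminorm 0, so the bounded functionals and their
   norms are those of the associated normed space of equivalence classes. *)

class scaleC =
  fixes scaleC :: "complex \<Rightarrow> 'a \<Rightarrow> 'a"  (infixr "*\<^sub>C" 75)

class complex_vector = ab_group_add + scaleC +
  assumes scaleC_add_right: "a *\<^sub>C (x + y) = a *\<^sub>C x + a *\<^sub>C y"
    and scaleC_add_left: "(a + b) *\<^sub>C x = a *\<^sub>C x + b *\<^sub>C x"
    and scaleC_scaleC: "a *\<^sub>C b *\<^sub>C x = (a * b) *\<^sub>C x"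
    and scaleC_one: "1 *\<^sub>C x = x"

instantiation complex :: complex_vector
begin

definition scaleC_complex :: "complex \<Rightarrow> complex \<Rightarrow> complex" where
  "scaleC_complex c z = c * z"

instance
  by standard (simp_all add: scaleC_complex_def algebra_simps)

end

instantiation "fun" :: (type, complex_vector) complex_vector
begin

definition scaleC_fun :: "complex \<Rightarrow> ('a \<Rightarrow> 'b) \<Rightarrow> 'a \<Rightarrow> 'b" where
  "scaleC_fun c f = (\<lambda>x. c *\<^sub>C f x)"

instance
  by standard
    (simp_all add: scaleC_fun_def fun_eq_iff scaleC_add_right scaleC_add_left scaleC_scaleC scaleC_one)

end

definition clinear_on :: "'a::complex_vector set \<Rightarrow> ('a \<Rightarrow> 'b::complex_vector) \<Rightarrow> bool" where
  "clinear_on X f \<longleftrightarrow>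
     (\<forall>x\<in>X. \<forall>y\<in>X. f (x + y) = f x + f y) \<and> (\<forall>c. \<forall>x\<in>X. f (c *\<^sub>C x) = c *\<^sub>C f x)"

(* A von Neumann algebra W as far as its Banach space structure and its weak-star topology are
   concerned: its elements, its norm, and the functionals given by the elements of its predual. *)
record 'w dual_space =
  elements :: "'w set"
  dnorm :: "'w \<Rightarrow> real"
  predual :: "('w \<Rightarrow> complex) set"

definition weak_star_topology :: "'w dual_space \<Rightarrow> 'w topology" where
  "weak_star_topology W =
     topology_generated_by
       {{w \<in> elements W. p w \<in> U} | p U. p \<in> predual W \<and> open U}"

definition bounded_functionals ::
    "'w::complex_vector dual_space \<Rightarrow> 'w set \<Rightarrow> ('w \<Rightarrow> complex) set" where
  "bounded_functionals W X =
     {\<phi>. clinear_on X \<phi> \<and> (\<exists>C. \<forall>x\<in>X. cmod (\<phi> x) \<le> C * dnorm W x)}"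

definition functional_norm :: "'w dual_space \<Rightarrow> 'w set \<Rightarrow> ('w \<Rightarrow> complex) \<Rightarrow> real" where
  "functional_norm W X \<phi> = (SUP x \<in> {x \<in> X. dnorm W x \<le> 1}. cmod (\<phi> x))"

definition abs_cont_functional ::
    "'w::complex_vector dual_space \<Rightarrow> 'w set \<Rightarrow> ('w \<Rightarrow> complex) \<Rightarrow> bool" where
  "abs_cont_functional W X \<phi> \<longleftrightarrow>
     (\<exists>\<Phi>. clinear_on (elements W) \<Phi> \<and> continuous_map (weak_star_topology W) euclidean \<Phi> \<and>
          (\<forall>x\<in>X. \<Phi> x = \<phi> x))"

definition gleason_whitney ::
    "'w::complex_vector dual_space \<Rightarrow> 'w set \<Rightarrow> 'w set \<Rightarrow> bool" where
  "gleason_whitney W X Y \<longleftrightarrow>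
     (\<forall>\<phi> \<in> bounded_functionals W X. \<forall>\<psi> \<in> bounded_functionals W Y.
        abs_cont_functional W X \<phi> \<longrightarrow> (\<forall>x\<in>X. \<psi> x = \<phi> x) \<longrightarrow>
        functional_norm W Y \<psi> = functional_norm W X \<phi> \<longrightarrow>
        abs_cont_functional W Y \<psi>)"

definition Linf :: "'a measure \<Rightarrow> ('a \<Rightarrow> complex) dual_space" where
  "Linf M =
     \<lparr>elements = {f \<in> borel_measurable M. esssup M (\<lambda>x. ennreal (cmod (f x))) < \<infinity>},
      dnorm = (\<lambda>f. enn2real (esssup M (\<lambda>x. ennreal (cmod (f x))))),
      predual = {\<lambda>f. \<integral>x. f x * h x \<partial>M | h. integrable M h}\<rparr>"

(* A Hilbert space, given by representatives: ip is only positive semidefinite. *)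
record 'h ip_space =
  vectors :: "'h set"
  ip :: "'h \<Rightarrow> 'h \<Rightarrow> complex"

definition ip_norm :: "'h ip_space \<Rightarrow> 'h \<Rightarrow> real" where
  "ip_norm H x = sqrt (Re (ip H x x))"

(* Every bounded linear operator on the quotient of H by the vectors of norm 0 lifts to a linear
   operator on H itself (compose with a linear section of the quotient map), so there is no need
   to allow linearity up to vectors of norm 0 here.  The weak-star topology of B(H) is the ultraweak
   one, given by the trace class functionals T |-> sum_n <T x_n, y_n>. *)
definition bounded_operators :: "'h::complex_vector ip_space \<Rightarrow> ('h \<Rightarrow> 'h) dual_space" where
  "bounded_operators H =
     \<lparr>elements = {T. T ` vectors H \<subseteq> vectors H \<and> clinear_on (vectors H) T \<and>
                   (\<exists>C. \<forall>x\<in>vectors H. ip_norm H (T x) \<le> C * ip_norm H x)},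
      dnorm = (\<lambda>T. SUP x \<in> {x \<in> vectors H. ip_norm H x \<le> 1}. ip_norm H (T x)),
      predual = {\<lambda>T. \<Sum>n. ip H (T (x n)) (y n) | x y.
                   range x \<subseteq> vectors H \<and> summable (\<lambda>n. (ip_norm H (x n))\<^sup>2) \<and>
                   range y \<subseteq> vectors H \<and> summable (\<lambda>n. (ip_norm H (y n))\<^sup>2)}\<rparr>"

definition L2 :: "'a measure \<Rightarrow> ('a \<Rightarrow> complex) ip_space" where
  "L2 M =
     \<lparr>vectors = {f \<in> borel_measurable M. integrable M (\<lambda>x. (cmod (f x))\<^sup>2)},
      ip = (\<lambda>f g. \<integral>x. f x * cnj (g x) \<partial>M)\<rparr>"

definition taylor_coeff :: "(complex \<Rightarrow> complex) \<Rightarrow> nat \<Rightarrow> complex" where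
  "taylor_coeff f n = (deriv ^^ n) f 0 / fact n"

definition hardy2 :: "(complex \<Rightarrow> complex) ip_space" where
  "hardy2 =
     \<lparr>vectors = {f. f holomorphic_on ball 0 1 \<and> summable (\<lambda>n. (cmod (taylor_coeff f n))\<^sup>2)},
      ip = (\<lambda>f g. \<Sum>n. taylor_coeff f n * cnj (taylor_coeff g n))\<rparr>"

definition mult_op :: "('a \<Rightarrow> complex) \<Rightarrow> ('a \<Rightarrow> complex) \<Rightarrow> 'a \<Rightarrow> complex" where
  "mult_op f = (\<lambda>g x. f x * g x)"

definition Hinf_disc :: "(complex \<Rightarrow> complex) set" where
  "Hinf_disc = {f. f holomorphic_on ball 0 1 \<and> bounded (f ` ball 0 1)}"

definition disc_algebra :: "(complex \<Rightarrow> complex) set" where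
  "disc_algebra =
     {f \<in> Hinf_disc. \<forall>e>0. \<exists>p. \<forall>z\<in>ball 0 1. cmod (f z - poly p z) < e}"

definition Hinf :: "(complex ^ 'd) set \<Rightarrow> (complex ^ 'd \<Rightarrow> complex) set" where
  "Hinf \<Omega> =
     {f. (\<forall>z\<in>\<Omega>. \<exists>f'. (f has_derivative f') (at z) \<and> (\<forall>c v. f' (c *s v) = c * f' v)) \<and>
         bounded (f ` \<Omega>)}"

definition polydisc :: "(complex ^ 'd) set" where
  "polydisc = {z. \<forall>i. cmod (z $ i) < 1}"

(* The three boundary measures are Borel measures on the ambient space, concentrated on the circle,
   the sphere and the torus respectively. *)
definition arclength :: "complex measure" where
  "arclength = distr (lebesgue_on {0..2 * pi}) borel cis"

(* Here sgn z = z / norm z. *)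
definition sphere_measure :: "(complex ^ 'd) measure" where
  "sphere_measure = distr (uniform_measure lborel (ball 0 1)) borel sgn"

definition torus_measure :: "(complex ^ 'd) measure" where
  "torus_measure =
     distr (\<Pi>\<^sub>M i\<in>UNIV. scale_measure (ennreal (1 / (2 * pi))) arclength) borel vec_lambda"

(* The image of the function space F in L^infinity(M) under radial boundary limits. *)
definition boundary_functions ::
    "'a::real_normed_vector measure \<Rightarrow> ('a \<Rightarrow> complex) set \<Rightarrow> ('a \<Rightarrow> complex) set" where
  "boundary_functions M F =
     {g \<in> elements (Linf M). \<exists>f\<in>F. AE \<zeta> in M. ((\<lambda>r. f (r *\<^sub>R \<zeta>)) \<longlongrightarrow> g \<zeta>) (at_left 1)}"

end

theory Submission
  imports Defs
begin

text \<open>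
  All seven counterexamples have the same shape. Take functionals \<open>\<omega>\<^sub>n\<close> of norm one on the
  larger space \<open>Y\<close> with \<open>\<omega>\<^sub>n 1 = 1\<close> and let \<open>\<psi>\<close> be their limit along a free ultrafilter. If the
  numbers \<open>\<omega>\<^sub>n x\<close> converge to \<open>\<phi> x\<close> for every \<open>x\<close> in the smaller space \<open>X\<close>, where \<open>\<phi>\<close> comes from the
  predual, then \<open>\<psi>\<close> extends the absolutely continuous functional \<open>\<phi>\<close>, and both have norm one
  because both send \<open>1\<close> to \<open>1\<close>. If moreover some net \<open>T\<^sub>i \<rightarrow> T\<close> in \<open>Y\<close> converges in the weak-star
  topology while \<open>\<psi> T\<^sub>i = a\<close> for all \<open>i\<close> and \<open>\<psi> T = b \<noteq> a\<close>, then \<open>\<psi>\<close> is not the restriction of a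
  weak-star continuous functional, and the Gleason--Whitney property fails. This is
  \<open>not_gleason_whitney_if_limits_differ\<close>; what remains is to find \<open>\<omega>\<^sub>n\<close> that move away from the
  predual in a way that \<open>X\<close> cannot see.

  In an \<open>L\<^sup>\<infinity>\<close> space, \<open>\<omega>\<^sub>n\<close> is integration against a probability density \<open>h\<^sub>n\<close> supported in a set
  \<open>V\<^sub>n\<close>, where the sets \<open>V\<^sub>n\<close> decrease to a null set: the indicators of the \<open>V\<^sub>n\<close> then tend to zero
  weak-star, but \<open>\<psi>\<close> takes the value one on each of them (\<open>not_gleason_whitney_Linf\<close>). Continuous
  functions on the interval do not notice if the mass of each interval of length \<open>1/n\<close> is swept
  into a tiny part of it. Bounded holomorphic functions do not notice if the mass is swept
  into smaller and smaller sets invariant under the circle action \<open>z \<mapsto> e\<^bsup>it\<^esup>z\<close>, because the mean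
  of \<open>f\<close> over each of these sets is \<open>f 0\<close> (\<open>integral_rotation_invariant_set\<close>). In the disc, balls
  around the origin are such sets. On the sphere and the torus of \<open>\<complex>\<^sup>d\<close> with \<open>d \<ge> 2\<close> one
  coordinate can be compared with another, and the sets where \<open>z\<^sub>i\<close> and \<open>z\<^sub>j\<close> have almost the same
  argument are invariant and shrink to a null set (\<open>not_gleason_whitney_boundary_functions\<close>). On
  the circle itself every invariant set is null or has full measure, so that \<open>d \<ge> 2\<close> is
  essential here.

  For algebras of multiplication operators, \<open>\<omega>\<^sub>n T = \<langle>T e\<^sub>n, e\<^sub>n\<rangle>\<close> for an orthonormal sequence.
  By Bessel's inequality the limit \<open>\<psi>\<close> annihilates every finite rank operator, although the
  finite rank projections converge weak-star to the identity, and \<open>\<psi>\<close> is one there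
  (\<open>not_gleason_whitney_bounded_operators\<close>). With \<open>e\<^sub>n(x) = e\<^bsup>2\<pi>inx\<^esup>\<close>, respectively \<open>e\<^sub>n(z) = z\<^sup>n\<close>,
  the number \<open>\<langle>f e\<^sub>n, e\<^sub>n\<rangle>\<close> does not depend on \<open>n\<close>.

  For the disc algebra inside \<open>H\<^sup>\<infinity>\<close>, \<open>\<omega>\<^sub>n\<close> is the average over the \<open>n + 1\<close> points obtained by
  rotating a point of radius \<open>r\<^sub>n < 1\<close> by the roots of unity. On polynomials of degree at most \<open>n\<close>
  this is evaluation at the origin, hence so is the limit on the disc algebra. But there are
  singular inner functions \<open>S\<^sub>i = exp (- \<Sum>\<^bsub>n \<ge> i\<^esub> \<epsilon>\<^sub>n (1 + z\<^bsup>n+1\<^esup>) / (1 - z\<^bsup>n+1\<^esup>))\<close> which tend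
  to one almost everywhere on the circle and yet are tiny at all these points, provided \<open>r\<^sub>n\<close> is
  close enough to one: the \<open>n\<close>-th summand is huge there. So \<open>\<psi> S\<^sub>i = 0\<close> for every \<open>i\<close> and \<open>\<psi> 1 = 1\<close>.
\<close>

section \<open>Limits along ultrafilters\<close>

text \<open>
  Zorn's lemma, applied to the nontrivial filters below \<open>F\<close>: the infimum of a chain of them is
  again nontrivial.
\<close>

lemma ultrafilter_refining:
  fixes F :: "'a filter"
  assumes "F \<noteq> bot"
  shows "\<exists>U\<le>F. U \<noteq> bot \<and> (\<forall>V. V \<le> U \<longrightarrow> V \<noteq> bot \<longrightarrow> V = U)"
proof -
  define A where "A = {G. G \<le> F \<and> G \<noteq> bot}"
  have "\<exists>m\<in>A. \<forall>a\<in>A. a \<le> m \<longrightarrow> a = m"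
  proof (rule predicate_Zorn[where P = "\<lambda>a b. b \<le> a"])
    show "partial_order_on A (relation_of (\<lambda>a b. b \<le> a) A)"
      by (rule partial_order_on_relation_ofI) auto
  next
    fix C assume C: "C \<in> Chains (relation_of (\<lambda>a b. b \<le> a) A)"
    then have CA: "C \<subseteq> A" and total: "\<And>G H. G \<in> C \<Longrightarrow> H \<in> C \<Longrightarrow> G \<le> H \<or> H \<le> G"
      by (auto simp: Chains_def relation_of_def)
    show "\<exists>u\<in>A. \<forall>a\<in>C. u \<le> a"
    proof (cases "C = {}")
      case True
      then show ?thesis using assms by (auto simp: A_def)
    next
      case False
      have "\<not> eventually (\<lambda>_. False) (Inf C)"
      proof (subst eventually_Inf_base[OF False])
        show "\<exists>x\<in>C. x \<le> inf G H" if "G \<in> C" "H \<in> C" for G H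
          using total[OF that] that by auto
        show "\<not> (\<exists>G\<in>C. eventually (\<lambda>_. False) G)"
          using CA by (auto simp: A_def trivial_limit_def)
      qed
      moreover have "Inf C \<le> F"
        using False CA by (auto simp: A_def intro: Inf_lower2)
      ultimately have "Inf C \<in> A" by (auto simp: A_def trivial_limit_def)
      then show ?thesis by (meson Inf_lower)
    qed
  qed
  then obtain U where U: "U \<in> A" "\<And>V. V \<in> A \<Longrightarrow> V \<le> U \<Longrightarrow> V = U" by blast
  show ?thesis
    using U by (intro exI[of _ U]) (auto simp: A_def)
qed

text \<open>
  A bounded family has a cluster point \<open>l\<close> along \<open>U\<close>, so adding the preimages of the
  neighbourhoods of \<open>l\<close> to \<open>U\<close> gives a nontrivial filter, and by maximality they already belong to
  \<open>U\<close>.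
\<close>

lemma ultrafilter_bounded_convergent:
  fixes s :: "'i \<Rightarrow> 'a::heine_borel"
  assumes "U \<noteq> bot" and U: "\<And>V. V \<le> U \<Longrightarrow> V \<noteq> bot \<Longrightarrow> V = U" and b: "bounded (range s)"
  shows "\<exists>l. (s \<longlongrightarrow> l) U"
proof -
  have c: "compact (closure (range s))"
    using b by (simp add: compact_closure)
  have "filtermap s U \<le> principal (closure (range s))"
    unfolding le_principal eventually_filtermap
    by (intro always_eventually allI subsetD[OF closure_subset] rangeI)
  moreover have "filtermap s U \<noteq> bot" using assms(1) by (simp add: filtermap_bot_iff)
  ultimately obtain l where l: "inf (nhds l) (filtermap s U) \<noteq> bot"
    using c unfolding compact_filter le_principal by blast
  \<comment> \<open>The preimages of the neighbourhoods of the cluster point are compatible with the filter.\<close>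
  have ne: "inf U (filtercomap s (nhds l)) \<noteq> bot"
  proof
    assume "inf U (filtercomap s (nhds l)) = bot"
    then obtain Q R S where Q: "eventually Q U" "eventually S (nhds l)" "\<And>x. S (s x) \<Longrightarrow> R x" "\<And>x. Q x \<Longrightarrow> \<not> R x"
      unfolding trivial_limit_def eventually_inf eventually_filtercomap by blast
    have "eventually (\<lambda>y. \<exists>x. y = s x \<and> Q x) (filtermap s U)"
      unfolding eventually_filtermap by (rule eventually_mono[OF Q(1)]) auto
    then have "eventually (\<lambda>_. False) (inf (nhds l) (filtermap s U))"
      unfolding eventually_inf using Q by (intro exI[of _ S] exI[of _ "\<lambda>y. \<exists>x. y = s x \<and> Q x"]) auto
    with l show False by (simp add: trivial_limit_def)
  qed
  have "inf U (filtercomap s (nhds l)) = U"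
    by (rule U) (use ne in auto)
  then have "U \<le> filtercomap s (nhds l)" by (metis inf.cobounded2)
  then have "filterlim s (nhds l) U" by (simp add: filterlim_iff_le_filtercomap)
  then show ?thesis by blast
qed

section \<open>A criterion for the failure of the Gleason--Whitney property\<close>

lemma topspace_weak_star: "predual W \<noteq> {} \<Longrightarrow> topspace (weak_star_topology W) = elements W"
  unfolding weak_star_topology_def topology_generated_by_topspace
  by (intro equalityI Union_least subsetI UnionI[of "{w \<in> elements W. (SOME p. p \<in> predual W) w \<in> UNIV}"])
     (auto simp: some_in_eq intro!: exI[of _ UNIV])

lemma predual_weak_star_continuous:
  assumes "p \<in> predual W"
  shows "continuous_map (weak_star_topology W) euclidean p"
  unfolding continuous_map_def
proof safe
  fix U :: "complex set" assume "openin euclidean U"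
  then have "openin (weak_star_topology W) {w \<in> elements W. p w \<in> U}"
    unfolding weak_star_topology_def using assms by (intro topology_generated_by_Basis) auto
  moreover have "topspace (weak_star_topology W) = elements W"
    using assms by (intro topspace_weak_star) auto
  ultimately show "openin (weak_star_topology W) {x \<in> topspace (weak_star_topology W). p x \<in> U}" by simp
qed auto

text \<open>
  Convergence only has to be tested on the generating sets of the topology. With the filter \<open>G\<close>
  arbitrary, this covers nets as well as sequences.
\<close>

lemma limitin_weak_star:
  assumes "predual W \<noteq> {}" and T0: "T0 \<in> elements W" and T: "\<And>i. T i \<in> elements W"
    and lim: "\<And>p. p \<in> predual W \<Longrightarrow> ((\<lambda>i. p (T i)) \<longlongrightarrow> p T0) G"
  shows "limitin (weak_star_topology W) T T0 G"
proof -
  have "eventually (\<lambda>i. T i \<in> V) G"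
    if "generate_topology_on {{w \<in> elements W. p w \<in> U} | p U. p \<in> predual W \<and> open U} V" "T0 \<in> V" for V
    using that
  proof (induction rule: generate_topology_on.induct)
    case (Int a b)
    then show ?case by (auto simp: eventually_conj_iff)
  next
    case (UN K)
    then obtain k where "k \<in> K" "T0 \<in> k" by auto
    then have "eventually (\<lambda>i. T i \<in> k) G" using UN by auto
    then show ?case by (rule eventually_mono) (use \<open>k \<in> K\<close> in auto)
  next
    case (Basis s)
    then obtain p U where s: "s = {w \<in> elements W. p w \<in> U}" "p \<in> predual W" "open U" by auto
    then have "eventually (\<lambda>i. p (T i) \<in> U) G"
      using lim[OF s(2)] Basis by (auto intro: topological_tendstoD)
    then show ?case using s T by auto
  qed auto
  then show ?thesis
    unfolding limitin_def using assms(1) T0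
    by (auto simp: topspace_weak_star) (simp add: weak_star_topology_def openin_topology_generated_by_iff)
qed

text \<open>
  The functional that refutes the property is the limit \<open>\<psi>\<close> of the \<open>\<omega> n\<close> along a free ultrafilter,
  which exists on all of \<open>Y\<close> by boundedness and agrees with the ordinary limit wherever that
  exists. The element \<open>e\<close> norms both \<open>\<psi>\<close> and its restriction to \<open>X\<close>.
\<close>

lemma not_gleason_whitney_if_limits_differ:
  fixes W :: "'w::complex_vector dual_space"
    and \<omega> :: "nat \<Rightarrow> 'w \<Rightarrow> complex" and T :: "'i \<Rightarrow> 'w"
  assumes XY: "X \<subseteq> Y" and YW: "Y \<subseteq> elements W"
    and lin: "\<And>n. clinear_on Y (\<omega> n)"
    and bound: "\<And>n x. x \<in> Y \<Longrightarrow> cmod (\<omega> n x) \<le> dnorm W x"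
    and e: "e \<in> X" "dnorm W e \<le> 1" "\<And>n. \<omega> n e = 1"
    and \<phi>: "\<phi> \<in> predual W" "clinear_on (elements W) \<phi>" "\<And>x. x \<in> X \<Longrightarrow> (\<lambda>n. \<omega> n x) \<longlonglongrightarrow> \<phi> x"
    and G: "G \<noteq> bot" and T: "\<And>i. T i \<in> Y" and T0: "T0 \<in> Y"
    and weak_star: "\<And>p. p \<in> predual W \<Longrightarrow> ((\<lambda>i. p (T i)) \<longlongrightarrow> p T0) G"
    and a: "\<And>i. (\<lambda>n. \<omega> n (T i)) \<longlonglongrightarrow> a" and b: "(\<lambda>n. \<omega> n T0) \<longlonglongrightarrow> b" and "a \<noteq> b"
  shows "\<not> gleason_whitney W X Y"
proof
  assume gw: "gleason_whitney W X Y"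
  obtain U :: "nat filter" where U: "U \<le> sequentially" "U \<noteq> bot" "\<And>V. V \<le> U \<Longrightarrow> V \<noteq> bot \<Longrightarrow> V = U"
    using ultrafilter_refining[of sequentially] by auto
  define \<psi> where "\<psi> x = Lim U (\<lambda>n. \<omega> n x)" for x
  have \<psi>I: "\<psi> x = l" if "((\<lambda>n. \<omega> n x) \<longlongrightarrow> l) U" for x l
    unfolding \<psi>_def using that U(2) by (simp add: tendsto_Lim)
  have seq: "\<psi> x = l" if "(\<lambda>n. \<omega> n x) \<longlonglongrightarrow> l" for x l
    using that U(1) by (intro \<psi>I) (auto intro: tendsto_mono)
  have conv: "((\<lambda>n. \<omega> n x) \<longlongrightarrow> \<psi> x) U" if x: "x \<in> Y" for x
  proof -
    have "bounded (range (\<lambda>n. \<omega> n x))"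
      using bound[OF x] by (auto simp: bounded_iff)
    then obtain l where "((\<lambda>n. \<omega> n x) \<longlongrightarrow> l) U"
      using ultrafilter_bounded_convergent[OF U(2,3)] by blast
    then show ?thesis using \<psi>I by simp
  qed
  have bound_\<psi>: "cmod (\<psi> x) \<le> dnorm W x" if x: "x \<in> Y" for x
    using tendsto_upperbound[OF tendsto_norm[OF conv[OF x]] always_eventually U(2)] bound[OF x] by blast
  have lin_\<psi>: "clinear_on Y \<psi>"
    unfolding clinear_on_def
  proof (intro conjI ballI allI)
    fix x y assume "x \<in> Y" "y \<in> Y"
    then have "((\<lambda>n. \<omega> n (x + y)) \<longlongrightarrow> \<psi> x + \<psi> y) U"
      using lin tendsto_add[OF conv conv] by (auto simp: clinear_on_def)
    then show "\<psi> (x + y) = \<psi> x + \<psi> y" by (rule \<psi>I)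
  next
    fix c x assume "x \<in> Y"
    then have "((\<lambda>n. \<omega> n (c *\<^sub>C x)) \<longlongrightarrow> c *\<^sub>C \<psi> x) U"
      using lin tendsto_mult_left[OF conv] by (auto simp: clinear_on_def scaleC_complex_def)
    then show "\<psi> (c *\<^sub>C x) = c *\<^sub>C \<psi> x" by (rule \<psi>I)
  qed
  \<comment> \<open>Needed for both \<open>Z = X\<close> and \<open>Z = Y\<close>.\<close>
  have norm_one: "functional_norm W Z \<psi> = 1" if Z: "X \<subseteq> Z" "Z \<subseteq> Y" for Z
    unfolding functional_norm_def
  proof (rule cSup_eq_maximum)
    have "\<psi> e = 1" using e by (intro seq) auto
    then show "1 \<in> (\<lambda>x. cmod (\<psi> x)) ` {x \<in> Z. dnorm W x \<le> 1}"
      using Z e by (intro image_eqI[of _ _ e]) auto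
    show "y \<le> 1" if y: "y \<in> (\<lambda>x. cmod (\<psi> x)) ` {x \<in> Z. dnorm W x \<le> 1}" for y
    proof -
      obtain x where "x \<in> Y" "dnorm W x \<le> 1" "y = cmod (\<psi> x)" using y Z by auto
      then show ?thesis using bound_\<psi>[of x] by linarith
    qed
  qed
  have "\<psi> \<in> bounded_functionals W Z" if "Z \<subseteq> Y" for Z
    using that lin_\<psi> bound_\<psi> unfolding bounded_functionals_def clinear_on_def subset_iff
    by (auto intro!: exI[of _ 1])
  moreover have "abs_cont_functional W X \<psi>"
    unfolding abs_cont_functional_def
    using \<phi>(1,2) seq[OF \<phi>(3), symmetric]
    by (intro exI[of _ \<phi>]) (auto intro: predual_weak_star_continuous)
  ultimately have "abs_cont_functional W Y \<psi>"
    using gw XY norm_one[of X] norm_one[of Y] unfolding gleason_whitney_def by auto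
  then obtain \<Phi> where \<Phi>: "continuous_map (weak_star_topology W) euclidean \<Phi>" "\<And>x. x \<in> Y \<Longrightarrow> \<Phi> x = \<psi> x"
    unfolding abs_cont_functional_def by blast
  have "limitin (weak_star_topology W) T T0 G"
    using \<phi>(1) T T0 YW weak_star by (intro limitin_weak_star) auto
  then have "limitin euclidean (\<Phi> \<circ> T) (\<Phi> T0) G"
    by (rule continuous_map_limit[OF \<Phi>(1)])
  then have "((\<lambda>i. \<psi> (T i)) \<longlongrightarrow> \<psi> T0) G"
    using \<Phi>(2) T T0 by (simp add: comp_def)
  moreover have "\<psi> (T i) = a" for i using a by (rule seq)
  moreover have "\<psi> T0 = b" using b by (rule seq)
  ultimately have "a = b" using G by (simp add: tendsto_const_iff)
  with \<open>a \<noteq> b\<close> show False ..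
qed

section \<open>Densities escaping to null sets\<close>

lemma Linf_AE_le_dnorm:
  assumes "f \<in> elements (Linf M)"
  shows "AE x in M. cmod (f x) \<le> dnorm (Linf M) f"
proof -
  have fin: "esssup M (\<lambda>x. ennreal (cmod (f x))) < top" using assms by (simp add: Linf_def)
  have "AE x in M. ennreal (cmod (f x)) \<le> ennreal (dnorm (Linf M) f)"
    using esssup_AE[of "\<lambda>x. ennreal (cmod (f x))" M] fin by (simp add: Linf_def)
  then show ?thesis by (simp add: Linf_def)
qed

lemma Linf_memI:
  assumes "f \<in> borel_measurable M" and "AE x in M. cmod (f x) \<le> B" and "0 \<le> B"
  shows "f \<in> elements (Linf M)" and "dnorm (Linf M) f \<le> B"
proof -
  have "esssup M (\<lambda>x. ennreal (cmod (f x))) \<le> ennreal B"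
    using assms by (intro esssup_I) (auto elim: eventually_mono intro!: ennreal_leI)
  then show "f \<in> elements (Linf M)" "dnorm (Linf M) f \<le> B"
    using assms enn2real_mono[of "esssup M (\<lambda>x. ennreal (cmod (f x)))" "ennreal B"]
    by (auto simp: Linf_def intro: le_less_trans)
qed

lemma Linf_measurable: "f \<in> elements (Linf M) \<Longrightarrow> f \<in> borel_measurable M"
  by (simp add: Linf_def)

lemma dnorm_Linf_nonneg: "0 \<le> dnorm (Linf M) f"
  by (simp add: Linf_def)

lemma Linf_integrable_mult:
  assumes f: "f \<in> elements (Linf M)" and h: "integrable M h"
  shows "integrable M (\<lambda>x. f x * h x :: complex)"
proof (rule Bochner_Integration.integrable_bound)
  show "integrable M (\<lambda>x. dnorm (Linf M) f * cmod (h x))" using h by auto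
  show "(\<lambda>x. f x * h x) \<in> borel_measurable M" using Linf_measurable[OF f] h by auto
  show "AE x in M. cmod (f x * h x) \<le> norm (dnorm (Linf M) f * cmod (h x))"
    using Linf_AE_le_dnorm[OF f]
    by eventually_elim (auto simp: norm_mult abs_mult dnorm_Linf_nonneg intro!: mult_right_mono)
qed

lemma Linf_integral_mult_bound:
  assumes f: "f \<in> elements (Linf M)" and h: "integrable M h"
  shows "cmod (\<integral>x. f x * h x \<partial>M) \<le> dnorm (Linf M) f * (\<integral>x. cmod (h x) \<partial>M)"
proof -
  have "cmod (\<integral>x. f x * h x \<partial>M) \<le> (\<integral>x. cmod (f x * h x) \<partial>M)"
    by (rule integral_norm_bound)
  also have "\<dots> \<le> (\<integral>x. dnorm (Linf M) f * cmod (h x) \<partial>M)"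
  proof (rule integral_mono_AE)
    show "AE x in M. cmod (f x * h x) \<le> dnorm (Linf M) f * cmod (h x)"
      using Linf_AE_le_dnorm[OF f] by eventually_elim (auto simp: norm_mult intro!: mult_right_mono)
  qed (use Linf_integrable_mult[OF f h] h in auto)
  finally show ?thesis by simp
qed

lemma Linf_functional_clinear:
  assumes h: "integrable M h"
  shows "clinear_on (elements (Linf M)) (\<lambda>f. \<integral>x. f x * h x \<partial>M)"
  unfolding clinear_on_def
proof (intro conjI ballI allI)
  fix f g assume "f \<in> elements (Linf M)" "g \<in> elements (Linf M)"
  from this[THEN Linf_integrable_mult, OF h]
  show "(\<integral>x. (f + g) x * h x \<partial>M) = (\<integral>x. f x * h x \<partial>M) + (\<integral>x. g x * h x \<partial>M)"
    by (simp add: distrib_right)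
next
  fix c :: complex and f :: "'a \<Rightarrow> complex"
  show "(\<integral>x. (c *\<^sub>C f) x * h x \<partial>M) = c *\<^sub>C (\<integral>x. f x * h x \<partial>M)"
    by (simp add: scaleC_fun_def scaleC_complex_def mult.assoc)
qed

lemma Linf_predualI: "integrable M k \<Longrightarrow> (\<lambda>g. \<integral>x. g x * k x \<partial>M) \<in> predual (Linf M)"
  by (auto simp: Linf_def)

text \<open>
  The mass of the densities \<open>h n\<close> escapes into the sets \<open>V m\<close>, whose indicators tend to zero
  weak-star by dominated convergence, whereas the limit functional takes the value one on each
  of them.
\<close>

lemma not_gleason_whitney_Linf:
  fixes h :: "nat \<Rightarrow> 'a \<Rightarrow> real" and k :: "'a \<Rightarrow> complex"
  assumes X: "X \<subseteq> elements (Linf M)" and one: "(\<lambda>_. 1) \<in> X"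
    and h: "\<And>n x. 0 \<le> h n x" "\<And>n. integrable M (h n)" "\<And>n. (\<integral>x. h n x \<partial>M) = 1"
    and k: "integrable M k" "\<And>g. g \<in> X \<Longrightarrow> (\<lambda>n. \<integral>x. g x * h n x \<partial>M) \<longlonglongrightarrow> (\<integral>x. g x * k x \<partial>M)"
    and V: "\<And>m. V m \<in> sets M" "AE x in M. (\<lambda>m. indicator (V m) x) \<longlonglongrightarrow> (0 :: real)"
    and supp: "\<And>m n x. m \<le> n \<Longrightarrow> x \<in> space M \<Longrightarrow> x \<notin> V m \<Longrightarrow> h n x = 0"
  shows "\<not> gleason_whitney (Linf M) X (elements (Linf M))"
proof (rule not_gleason_whitney_if_limits_differ[where e = "\<lambda>_. 1" and G = sequentially and
      \<omega> = "\<lambda>n g. \<integral>x. g x * h n x \<partial>M" and T = "\<lambda>m x. indicator (V m) x" and ?T0.0 = "\<lambda>_. 0"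
      and a = 1 and b = 0 and \<phi> = "\<lambda>g. \<integral>x. g x * k x \<partial>M"])
  show "clinear_on (elements (Linf M)) (\<lambda>g. \<integral>x. g x * complex_of_real (h n x) \<partial>M)" for n
    using h by (intro Linf_functional_clinear) auto
  show "cmod (\<integral>x. g x * complex_of_real (h n x) \<partial>M) \<le> dnorm (Linf M) g"
    if "g \<in> elements (Linf M)" for g n
    using Linf_integral_mult_bound[OF that, of "\<lambda>x. complex_of_real (h n x)"] h by simp
  show "dnorm (Linf M) (\<lambda>_. 1) \<le> 1" by (intro Linf_memI(2)) auto
  show "(\<integral>x. 1 * complex_of_real (h n x) \<partial>M) = 1" for n
    using h(3)[of n] by simp
  show "(\<lambda>g. \<integral>x. g x * k x \<partial>M) \<in> predual (Linf M)" using k(1) by (rule Linf_predualI)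
  show "clinear_on (elements (Linf M)) (\<lambda>g. \<integral>x. g x * k x \<partial>M)"
    using k(1) by (rule Linf_functional_clinear)
  show "(\<lambda>x. indicator (V m) x) \<in> elements (Linf M)" for m
    using V(1)[of m] by (intro Linf_memI(1)[where B = 1]) (auto simp: indicator_def)
  show "(\<lambda>_. 0) \<in> elements (Linf M)" by (intro Linf_memI(1)[where B = 1]) auto
  show "(\<lambda>i. p (\<lambda>x. indicator (V i) x)) \<longlonglongrightarrow> p (\<lambda>_. 0)" if p: "p \<in> predual (Linf M)" for p
  proof -
    obtain q where q: "p = (\<lambda>f. \<integral>x. f x * q x \<partial>M)" "integrable M q" using p by (auto simp: Linf_def)
    have "(\<lambda>i. \<integral>x. indicator (V i) x * q x \<partial>M) \<longlonglongrightarrow> (\<integral>x. 0 * q x \<partial>M)"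
    proof (rule integral_dominated_convergence[where w = "\<lambda>x. cmod (q x)"])
      show "AE x in M. (\<lambda>i. indicator (V i) x * q x) \<longlonglongrightarrow> 0 * q x"
        using V(2)
      proof eventually_elim
        case (elim x)
        then have "(\<lambda>i. complex_of_real (indicator (V i) x) * q x) \<longlonglongrightarrow> complex_of_real 0 * q x"
          by (intro tendsto_intros)
        then show ?case by (simp add: of_real_indicator)
      qed
      show "(\<lambda>x. indicator (V i) x * q x) \<in> borel_measurable M" for i using V(1)[of i] q(2) by auto
    qed (use q(2) in \<open>auto simp: indicator_def\<close>)
    then show ?thesis by (simp add: q(1))
  qed
  show "(\<lambda>n. \<integral>x. indicator (V m) x * complex_of_real (h n x) \<partial>M) \<longlonglongrightarrow> 1" for m
  proof (rule tendsto_eventually, rule eventually_sequentiallyI[of m])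
    fix n assume "m \<le> n"
    then have "(\<integral>x. indicator (V m) x * complex_of_real (h n x) \<partial>M) = (\<integral>x. complex_of_real (h n x) \<partial>M)"
      using supp[of m n] by (intro Bochner_Integration.integral_cong) (auto simp: indicator_def)
    then show "(\<integral>x. indicator (V m) x * complex_of_real (h n x) \<partial>M) = 1" using h(3)[of n] by simp
  qed
qed (use X one k in auto)

text \<open>
  The previous criterion for normalised indicators. The hypothesis on the means says that the
  averages over all \<open>V n\<close> and over the whole space coincide on \<open>X\<close>, which makes the limit on \<open>X\<close>
  trivial.
\<close>

lemma not_gleason_whitney_shrinking_sets:
  assumes fin: "finite_measure M"
    and X: "X \<subseteq> elements (Linf M)" and one: "(\<lambda>_. 1) \<in> X"
    and V: "\<And>n. V n \<in> sets M" "decseq V" "\<And>n. measure M (V n) > 0" "AE x in M. \<exists>n. x \<notin> V n"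
    and mean: "\<And>g. g \<in> X \<Longrightarrow> \<exists>c::complex. (\<forall>n. (\<integral>x. indicator (V n) x * g x \<partial>M) = c * measure M (V n)) \<and>
        (\<integral>x. g x \<partial>M) = c * measure M (space M)"
  shows "\<not> gleason_whitney (Linf M) X (elements (Linf M))"
proof -
  interpret finite_measure M by fact
  have pos: "measure M (space M) > 0"
    using V(1,3)[of 0] bounded_measure[of "V 0"] by simp
  show ?thesis
  proof (rule not_gleason_whitney_Linf[where h = "\<lambda>n x. indicator (V n) x / measure M (V n)" and V = V
        and k = "\<lambda>_. 1 / of_real (measure M (space M))", OF X one])
    have int: "integrable M (indicator (V n) :: _ \<Rightarrow> real)" for n
      using V(1)[of n] by (intro integrable_real_indicator) (simp_all add: emeasure_eq_measure less_top[symmetric])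
    then show "integrable M (\<lambda>x. indicator (V n) x / measure M (V n))" for n by (rule integrable_divide)
    show "(\<integral>x. indicator (V n) x / measure M (V n) \<partial>M) = 1" for n
      using V(1)[of n] V(3)[of n] by (simp add: sets.Int_space_eq2)
    show "(\<lambda>n. \<integral>x. g x * of_real (indicator (V n) x / measure M (V n)) \<partial>M)
        \<longlonglongrightarrow> (\<integral>x. g x * (1 / of_real (measure M (space M))) \<partial>M)" if g: "g \<in> X" for g
    proof -
      obtain c :: complex where c: "\<And>n. (\<integral>x. indicator (V n) x * g x \<partial>M) = c * measure M (V n)"
        "(\<integral>x. g x \<partial>M) = c * measure M (space M)" using mean[OF g] by blast
      have "(\<integral>x. g x * of_real (indicator (V n) x / measure M (V n)) \<partial>M) = c" for n
      proof -
        have "(\<integral>x. g x * of_real (indicator (V n) x / measure M (V n)) \<partial>M)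
          = (\<integral>x. (indicator (V n) x * g x) / of_real (measure M (V n)) \<partial>M)"
          by (simp add: of_real_indicator mult.commute)
        also have "\<dots> = (\<integral>x. indicator (V n) x * g x \<partial>M) / of_real (measure M (V n))"
          by (rule integral_divide_zero)
        also have "\<dots> = c" using V(3)[of n] by (simp add: c(1))
        finally show ?thesis .
      qed
      moreover have "(\<integral>x. g x * (1 / of_real (measure M (space M))) \<partial>M) = c"
        using pos by (simp add: c(2))
      ultimately show ?thesis by simp
    qed
    show "AE x in M. (\<lambda>m. indicator (V m) x) \<longlonglongrightarrow> (0 :: real)"
      using V(4)
    proof eventually_elim
      case (elim x)
      then obtain m where "x \<notin> V m" by blast
      then have "x \<notin> V n" if "n \<ge> m" for n using V(2) that by (auto simp: decseq_def)
      then show ?case by (intro tendsto_eventually eventually_sequentiallyI[of m]) (simp add: indicator_def)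
    qed
    show "indicator (V n) x / measure M (V n) = 0" if "m \<le> n" "x \<notin> V m" for m n x
      using V(2) that by (auto simp: decseq_def indicator_def)
  qed (use V(1) in \<open>auto intro: finite_measure.integrable_const[OF fin]\<close>)
qed

section \<open>Continuous functions on the unit interval\<close>

lemma integral_indicator_approx:
  fixes g :: "'a \<Rightarrow> complex"
  assumes "finite_measure M" and g: "integrable M g" and A: "A \<in> sets M"
    and near: "\<And>x. x \<in> A \<Longrightarrow> cmod (g x - c) \<le> \<epsilon>"
  shows "cmod ((\<integral>x. g x * indicator A x \<partial>M) - c * measure M A) \<le> \<epsilon> * measure M A"
proof -
  interpret finite_measure M by fact
  have ind: "integrable M (indicator A :: _ \<Rightarrow> real)"
    using A by (auto simp: integrable_indicator_iff emeasure_eq_measure)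
  have indc: "integrable M (\<lambda>x. indicator A x :: complex)"
    by (rule Bochner_Integration.integrable_bound[OF ind]) (use A in \<open>auto simp: indicator_def\<close>)
  have "(\<integral>x. indicator A x \<partial>M) = (\<integral>x. complex_of_real (indicator A x) \<partial>M)"
    by (simp only: of_real_indicator)
  also have "\<dots> = complex_of_real (\<integral>x. indicator A x \<partial>M)" by (rule integral_complex_of_real)
  finally have int_ind: "(\<integral>x. indicator A x \<partial>M) = complex_of_real (measure M A)" using A by simp
  have gi: "integrable M (\<lambda>x. g x * indicator A x)"
    by (rule Bochner_Integration.integrable_bound[OF g]) (use g A in \<open>auto simp: indicator_def\<close>)
  have "(\<integral>x. g x * indicator A x \<partial>M) - c * measure M A = (\<integral>x. (g x - c) * indicator A x \<partial>M)"
    using gi indc by (simp add: left_diff_distrib int_ind)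
  also have "cmod \<dots> \<le> (\<integral>x. cmod ((g x - c) * indicator A x) \<partial>M)"
    by (rule integral_norm_bound)
  also have "\<dots> \<le> (\<integral>x. \<epsilon> * indicator A x \<partial>M)"
  proof (rule integral_mono)
    show "integrable M (\<lambda>x. cmod ((g x - c) * indicator A x))"
      using gi indc by (intro integrable_norm) (simp add: left_diff_distrib)
    show "integrable M (\<lambda>x. \<epsilon> * indicator A x)" by (intro integrable_mult_right ind)
    show "cmod ((g x - c) * indicator A x) \<le> \<epsilon> * indicator A x" for x
      using near by (simp add: indicator_def)
  qed
  also have "\<dots> = \<epsilon> * measure M A" using A by simp
  finally show ?thesis .
qed

text \<open>
  The only interval that contains \<open>x\<close> is the one with index \<open>\<lfloor>N x\<rfloor>\<close>.
\<close>

lemma sum_indicator_partition: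
  assumes "0 \<le> x" "x < 1" "N > 0"
  shows "(\<Sum>k<N. indicator {real k / N ..< real (Suc k) / N} x) = (1 :: complex)"
proof -
  have "indicator {real k / N ..< real (Suc k) / N} x = (if nat \<lfloor>N * x\<rfloor> = k then 1 else 0 :: complex)" for k
  proof -
    have "x \<in> {real k / N ..< real (Suc k) / N} \<longleftrightarrow> real k \<le> N * x \<and> N * x < real (Suc k)"
      using \<open>N > 0\<close> by (auto simp: field_simps)
    also have "\<dots> \<longleftrightarrow> \<lfloor>N * x\<rfloor> = int k" by (subst floor_eq_iff) (auto simp: add.commute)
    also have "\<dots> \<longleftrightarrow> nat \<lfloor>N * x\<rfloor> = k" using assms by auto
    finally show ?thesis by (auto simp: indicator_def)
  qed
  moreover have "nat \<lfloor>N * x\<rfloor> < N"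
    using assms by (simp add: nat_less_iff floor_less_iff)
  ultimately show ?thesis by simp
qed

lemma measure_lebesgue_on_unit_interval:
  assumes "0 \<le> a" "a \<le> b" "b \<le> 1"
  shows "{a..b} \<in> sets (lebesgue_on {0..1::real})" "{a..<b} \<in> sets (lebesgue_on {0..1::real})"
    "measure (lebesgue_on {0..1}) {a..b} = b - a" "measure (lebesgue_on {0..1}) {a..<b} = b - a"
proof -
  have "measure lebesgue {a..<b} = b - a"
    using assms by (simp add: measure_completion measure_def)
  then show "{a..b} \<in> sets (lebesgue_on {0..1::real})" "{a..<b} \<in> sets (lebesgue_on {0..1::real})"
    "measure (lebesgue_on {0..1}) {a..b} = b - a"
    using assms by (auto simp: sets_restrict_space_iff measure_restrict_space)
  show "measure (lebesgue_on {0..1}) {a..<b} = b - a"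
    using assms \<open>measure lebesgue {a..<b} = b - a\<close> by (subst measure_restrict_space) auto
qed

lemma inverse_power_two_mult_le:
  fixes r :: real
  assumes "r > 0"
  shows "1 / (2 ^ n * r) \<le> 1 / r"
proof -
  have "1 * r \<le> 2 ^ n * r" using assms by (intro mult_right_mono) simp_all
  then show ?thesis using assms by (intro divide_left_mono) simp_all
qed

lemma finite_measure_lebesgue_on_unit_interval: "finite_measure (lebesgue_on {0..1::real})"
  by (intro finite_measureI) (simp add: emeasure_restrict_space)

lemma continuous_on_imp_Linf:
  fixes f :: "real \<Rightarrow> complex"
  assumes f: "continuous_on {0..1} f"
  shows "f \<in> elements (Linf (lebesgue_on {0..1}))"
proof -
  obtain b where "b > 0" "\<forall>y\<in>f ` {0..1}. cmod y \<le> b"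
    using compact_imp_bounded[OF compact_continuous_image[OF f]] by (auto simp: bounded_pos)
  moreover have "f \<in> borel_measurable (lebesgue_on {0..1})"
    using f by (intro continuous_imp_measurable_on_sets_lebesgue) auto
  ultimately show ?thesis by (intro Linf_memI(1)[where B = b]) auto
qed

text \<open>
  The density puts the mass \<open>1 / (n + 1)\<close> of each interval \<open>[k / (n + 1), (k + 1) / (n + 1))\<close>
  uniformly on its left part of relative length \<open>2\<^bsup>-n\<^esup>\<close>. By uniform continuity \<open>g\<close> is almost
  constant on the whole interval, so its integral over the interval hardly changes.
\<close>

lemma integral_over_small_intervals_tendsto:
  fixes g :: "real \<Rightarrow> complex"
  assumes g: "continuous_on {0..1} g"
  shows "(\<lambda>n. \<integral>x. g x * of_real (\<Sum>k<Suc n. 2 ^ n * indicator {k / Suc n .. k / Suc n + 1 / (2 ^ n * real (Suc n))} x)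
            \<partial>lebesgue_on {0..1}) \<longlonglongrightarrow> (\<integral>x. g x \<partial>lebesgue_on {0..1})"
proof (rule LIMSEQ_I)
  let ?M = "lebesgue_on {0..1::real}"
  interpret finite_measure ?M by (rule finite_measure_lebesgue_on_unit_interval)
  have gint: "integrable ?M g"
    using Linf_integrable_mult[OF continuous_on_imp_Linf[OF g], of "\<lambda>_. 1"] by simp
  fix r :: real assume "0 < r"
  define \<epsilon> where "\<epsilon> = r / 3"
  have "uniformly_continuous_on {0..1} g" using g by (intro compact_uniformly_continuous) auto
  then obtain d where d: "d > 0" "\<And>x y. x \<in> {0..1} \<Longrightarrow> y \<in> {0..1} \<Longrightarrow> dist x y < d \<Longrightarrow> dist (g x) (g y) < \<epsilon>"
    unfolding uniformly_continuous_on_def using \<open>0 < r\<close> by (metis \<epsilon>_def zero_less_divide_iff zero_less_numeral)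
  obtain n0 where n0: "1 / real (Suc n0) < d" using \<open>d > 0\<close> nat_approx_posE by blast
  show "\<exists>n0. \<forall>n\<ge>n0. cmod ((\<integral>x. g x * of_real (\<Sum>k<Suc n. 2 ^ n * indicator {k / Suc n .. k / Suc n + 1 / (2 ^ n * real (Suc n))} x)
            \<partial>?M) - (\<integral>x. g x \<partial>?M)) < r"
  proof (intro exI[of _ n0] allI impI)
    fix n assume "n0 \<le> n"
    define N where "N = Suc n"
    have N: "N > 0" "1 / real N < d"
      using n0 \<open>n0 \<le> n\<close> by (auto simp: N_def elim!: order.strict_trans1[rotated] intro!: divide_left_mono)
    define A where "A k = {real k / N .. real k / N + 1 / (2 ^ n * real N)}" for k
    define I where "I k = {real k / N ..< real (Suc k) / N}" for k
    have two: "1 / (2 ^ n * real N) \<le> 1 / real N" using N by (intro inverse_power_two_mult_le) simp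
    have le1: "real (Suc k) / N \<le> 1" if "k < N" for k using that N by (simp add: field_simps)
    have Suc_k: "real (Suc k) / N = real k / N + 1 / N" for k by (simp add: add_divide_distrib)
    have A: "A k \<in> sets ?M" "measure ?M (A k) = 1 / (2 ^ n * real N)"
      and I: "I k \<in> sets ?M" "measure ?M (I k) = 1 / N" if "k < N" for k
      using measure_lebesgue_on_unit_interval[of "k / N" "k / N + 1 / (2 ^ n * real N)"]
        measure_lebesgue_on_unit_interval[of "k / N" "Suc k / N"] N two le1[OF that] Suc_k[of k]
      by (auto simp: A_def I_def)
    have near: "cmod (g x - g (k / N)) \<le> \<epsilon>" if "k < N" "x \<in> A k \<union> I k" for k x
    proof -
      have "k / N \<le> x" "x \<le> real k / N + 1 / N" using that two Suc_k[of k] by (auto simp: A_def I_def)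
      moreover have "0 \<le> k / N" "real k / N + 1 / N \<le> 1" "0 < 1 / real N"
        using le1[OF that(1)] N unfolding Suc_k by simp_all
      ultimately have "x \<in> {0..1}" "k / N \<in> {0..1}" "dist x (k / N) < d"
        using N(2) unfolding atLeastAtMost_iff dist_real_def by linarith+
      then show ?thesis using d(2)[of x "k / N"] by (simp add: dist_norm)
    qed
    have gA: "integrable ?M (\<lambda>x. g x * indicator S x)" if "S \<in> sets ?M" for S
      by (rule Bochner_Integration.integrable_bound[OF gint]) (use gint that in \<open>auto simp: indicator_def\<close>)
    have 1: "(\<integral>x. g x * of_real (\<Sum>k<Suc n. 2 ^ n * indicator {k / Suc n .. k / Suc n + 1 / (2 ^ n * real (Suc n))} x) \<partial>?M)
      = (\<Sum>k<N. 2 ^ n * (\<integral>x. g x * indicator (A k) x \<partial>?M))" (is "?L = _")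
    proof -
      have "?L = (\<integral>x. (\<Sum>k<N. 2 ^ n * (g x * indicator (A k) x)) \<partial>?M)"
      proof (intro Bochner_Integration.integral_cong refl)
        fix x
        show "g x * of_real (\<Sum>k<Suc n. 2 ^ n * indicator {k / Suc n .. k / Suc n + 1 / (2 ^ n * real (Suc n))} x)
          = (\<Sum>k<N. 2 ^ n * (g x * indicator (A k) x))"
          unfolding A_def N_def of_real_sum sum_distrib_left
          by (intro sum.cong refl)
             (simp only: of_real_mult of_real_power of_real_numeral of_real_indicator mult_ac)
      qed
      also have "\<dots> = (\<Sum>k<N. 2 ^ n * (\<integral>x. g x * indicator (A k) x \<partial>?M))"
        using gA A by (subst Bochner_Integration.integral_sum) (auto intro!: integrable_mult_right)
      finally show ?thesis .
    qed
    have 2: "(\<integral>x. g x \<partial>?M) = (\<Sum>k<N. \<integral>x. g x * indicator (I k) x \<partial>?M)"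
    proof -
      have "AE x in ?M. x \<noteq> 1"
        by (rule AE_not_in[of "{1}", simplified]) (simp add: null_sets_restrict_space)
      then have "AE x in ?M. g x = (\<Sum>k<N. g x * indicator (I k) x)"
        using AE_space
        by eventually_elim (use sum_indicator_partition[OF _ _ N(1)] in \<open>auto simp: I_def simp flip: sum_distrib_left\<close>)
      then have "(\<integral>x. g x \<partial>?M) = (\<integral>x. (\<Sum>k<N. g x * indicator (I k) x) \<partial>?M)"
        using gint gA[OF I(1)] by (intro integral_cong_AE borel_measurable_sum) auto
      also have "\<dots> = (\<Sum>k<N. \<integral>x. g x * indicator (I k) x \<partial>?M)"
        by (rule Bochner_Integration.integral_sum) (use gA[OF I(1)] in auto)
      finally show ?thesis .
    qed
    have each: "cmod (2 ^ n * (\<integral>x. g x * indicator (A k) x \<partial>?M) - (\<integral>x. g x * indicator (I k) x \<partial>?M)) \<le> 2 * \<epsilon> / N"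
      (is "cmod (2 ^ n * ?a - ?b) \<le> _") if k: "k < N" for k
    proof -
      have "cmod (?a - g (k / N) * (1 / (2 ^ n * real N))) \<le> \<epsilon> * (1 / (2 ^ n * real N))"
        using integral_indicator_approx[OF finite_measure_axioms gint A(1)[OF k], of "g (k / N)" \<epsilon>] near[OF k] A(2)[OF k]
        by auto
      then have "2 ^ n * cmod (?a - g (k / N) * (1 / (2 ^ n * real N))) \<le> 2 ^ n * (\<epsilon> * (1 / (2 ^ n * real N)))"
        by (rule mult_left_mono) auto
      moreover have "2 ^ n * cmod (?a - g (k / N) * (1 / (2 ^ n * real N))) = cmod (2 ^ n * ?a - g (k / N) / N)"
      proof -
        have "2 ^ n * ?a - g (k / N) / N = 2 ^ n * (?a - g (k / N) * (1 / (2 ^ n * real N)))"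
          by (simp add: right_diff_distrib)
        then show ?thesis by (simp only: norm_mult norm_power norm_numeral)
      qed
      ultimately have "cmod (2 ^ n * ?a - g (k / N) / N) \<le> \<epsilon> / N" by simp
      moreover have "cmod (?b - g (k / N) / N) \<le> \<epsilon> / N"
        using integral_indicator_approx[OF finite_measure_axioms gint I(1)[OF k], of "g (k / N)" \<epsilon>] near[OF k] I(2)[OF k]
        by auto
      ultimately show ?thesis
        using norm_triangle_ineq4[of "2 ^ n * ?a - g (k / N) / N" "?b - g (k / N) / N"] by simp
    qed
    have "cmod (\<Sum>k<N. 2 ^ n * (\<integral>x. g x * indicator (A k) x \<partial>?M) - (\<integral>x. g x * indicator (I k) x \<partial>?M))
       \<le> (\<Sum>k<N. 2 * \<epsilon> / N)"
      using each by (intro sum_norm_le) auto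
    also have "\<dots> < r" using N \<open>0 < r\<close> by (simp add: \<epsilon>_def)
    finally show "cmod ((\<integral>x. g x * of_real (\<Sum>k<Suc n. 2 ^ n * indicator {k / Suc n .. k / Suc n + 1 / (2 ^ n * real (Suc n))} x)
            \<partial>?M) - (\<integral>x. g x \<partial>?M)) < r"
      unfolding 1 2 by (simp add: sum_subtractf)
  qed
qed

text \<open>
  The supports of the densities at stage \<open>n\<close> have total length \<open>2\<^bsup>-n\<^esup>\<close>, so by the Borel--Cantelli
  lemma almost every point lies in only finitely many of them. This is why the unions over
  \<open>n \<ge> m\<close> shrink to a null set.
\<close>

lemma not_gleason_whitney_continuous:
  "\<not> gleason_whitney (Linf (lebesgue_on {0..1::real})) {f. continuous_on {0..1} f}
      (elements (Linf (lebesgue_on {0..1})))"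
proof -
  let ?M = "lebesgue_on {0..1::real}"
  interpret finite_measure ?M by (rule finite_measure_lebesgue_on_unit_interval)
  define J where "J n k = {real k / Suc n .. real k / Suc n + 1 / (2 ^ n * real (Suc n))}" for n k
  define h where "h n x = (\<Sum>k<Suc n. 2 ^ n * indicator (J n k) x :: real)" for n x
  define B where "B n = (\<Union>k<Suc n. J n k)" for n
  have J: "J n k \<in> sets ?M" "measure ?M (J n k) = 1 / (2 ^ n * real (Suc n))" if "k < Suc n" for n k
  proof -
    have "real k / Suc n + 1 / (2 ^ n * real (Suc n)) \<le> real k / Suc n + 1 / Suc n"
      by (intro add_left_mono inverse_power_two_mult_le) simp
    also have "\<dots> = real (Suc k) / Suc n" by (simp add: add_divide_distrib)
    also have "\<dots> \<le> 1" using that by simp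
    finally show "J n k \<in> sets ?M" "measure ?M (J n k) = 1 / (2 ^ n * real (Suc n))"
      using measure_lebesgue_on_unit_interval[of "real k / Suc n" "real k / Suc n + 1 / (2 ^ n * real (Suc n))"]
      by (auto simp: J_def)
  qed
  have B: "B n \<in> sets ?M" "measure ?M (B n) \<le> (1/2) ^ n" for n
  proof -
    show "B n \<in> sets ?M" unfolding B_def using J by (intro sets.finite_UN) auto
    have "measure ?M (B n) \<le> (\<Sum>k<Suc n. measure ?M (J n k))"
      unfolding B_def using J by (intro finite_measure_subadditive_finite) auto
    also have "\<dots> = (\<Sum>k<Suc n. 1 / (2 ^ n * real (Suc n)))" using J by (intro sum.cong) auto
    also have "\<dots> = (1/2) ^ n" by (simp add: power_one_over del: of_nat_Suc)
    finally show "measure ?M (B n) \<le> (1/2) ^ n" .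
  qed
  have "summable (\<lambda>n. measure ?M (B n))"
    by (rule summable_comparison_test'[of "\<lambda>n. (1/2) ^ n" 0]) (use B in \<open>auto intro!: summable_geometric\<close>)
  then have AE: "AE x in ?M. eventually (\<lambda>n. x \<in> space ?M - B n) sequentially"
    using B by (intro borel_cantelli_AE1) (auto simp: emeasure_eq_measure)
  show ?thesis
  proof (rule not_gleason_whitney_Linf[where h = h and k = "\<lambda>_. 1" and V = "\<lambda>m. \<Union>n\<in>{m..}. B n"])
    show "{f. continuous_on {0..1} f} \<subseteq> elements (Linf ?M)"
      using continuous_on_imp_Linf by auto
    show "integrable ?M (h n)" "(\<integral>x. h n x \<partial>?M) = 1" for n
    proof -
      have ind: "integrable ?M (\<lambda>x. 2 ^ n * indicator (J n k) x :: real)"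
        "(\<integral>x. 2 ^ n * indicator (J n k) x \<partial>?M) = (1 / Suc n :: real)" if "k < Suc n" for k
      proof -
        have "integrable ?M (indicator (J n k) :: _ \<Rightarrow> real)"
          using J(1)[OF that] by (intro integrable_real_indicator) (simp_all add: emeasure_eq_measure less_top[symmetric])
        then show "integrable ?M (\<lambda>x. 2 ^ n * indicator (J n k) x :: real)" by (intro integrable_mult_right)
        have "J n k \<inter> space ?M = J n k" using J(1)[OF that] by (rule sets.Int_space_eq2)
        then show "(\<integral>x. 2 ^ n * indicator (J n k) x \<partial>?M) = (1 / Suc n :: real)"
          using J(2)[OF that] by simp
      qed
      show "integrable ?M (h n)" unfolding h_def using ind(1) by (intro Bochner_Integration.integrable_sum) simp
      have "(\<integral>x. h n x \<partial>?M) = (\<Sum>k<Suc n. \<integral>x. 2 ^ n * indicator (J n k) x \<partial>?M)"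
        unfolding h_def using ind(1) by (intro Bochner_Integration.integral_sum) simp
      also have "\<dots> = (\<Sum>k<Suc n. 1 / Suc n)" using ind(2) by (intro sum.cong) simp_all
      finally show "(\<integral>x. h n x \<partial>?M) = 1" by simp
    qed
    show "(\<lambda>n. \<integral>x. g x * complex_of_real (h n x) \<partial>?M) \<longlonglongrightarrow> (\<integral>x. g x * 1 \<partial>?M)"
      if "g \<in> {f. continuous_on {0..1} f}" for g
      using integral_over_small_intervals_tendsto[of g] that by (simp add: h_def J_def del: sum.lessThan_Suc)
    show "(\<Union>n\<in>{m..}. B n) \<in> sets ?M" for m using B by auto
    show "AE x in ?M. (\<lambda>m. indicator (\<Union>n\<in>{m..}. B n) x) \<longlonglongrightarrow> (0::real)"
      using AE
    proof eventually_elim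
      case (elim x)
      then obtain m where "\<And>n. n \<ge> m \<Longrightarrow> x \<notin> B n" by (auto simp: eventually_sequentially)
      then show ?case
        by (intro tendsto_eventually eventually_sequentiallyI[of m]) (auto simp: indicator_def)
    qed
    show "h n x = 0" if "m \<le> n" "x \<notin> (\<Union>n\<in>{m..}. B n)" for m n x
      using that unfolding h_def B_def by (intro sum.neutral) (auto simp: indicator_def)
  qed (auto simp: h_def intro!: sum_nonneg)
qed

section \<open>Vector states along an orthonormal sequence\<close>

lemma scaleC_zero_left: "0 *\<^sub>C x = (0 :: 'a::complex_vector)"
  using scaleC_add_left[of 0 0 x] by simp

lemma scaleC_minus_one: "(- 1) *\<^sub>C x = - (x :: 'a::complex_vector)"
  using scaleC_add_left[of 1 "- 1" x] by (simp add: scaleC_zero_left scaleC_one eq_neg_iff_add_eq_0 add.commute)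

lemma scaleC_sum_right: "c *\<^sub>C sum f A = (\<Sum>i\<in>A. c *\<^sub>C f i)" if "finite A" for f :: "'i \<Rightarrow> 'a::complex_vector"
  using that scaleC_add_right[of c 0 "0 :: 'a"] by (induction A) (auto simp: scaleC_add_right)

lemma mult_cnj_norm:
  "z * cnj z = (complex_of_real (cmod z))\<^sup>2" "cnj z * z = (complex_of_real (cmod z))\<^sup>2"
  using complex_norm_square[of z] by (simp_all add: mult.commute)

text \<open>
  The laws of a possibly degenerate inner product on a set of representatives. They hold for
  square integrable functions and for the Hardy space, and are all that the argument about
  vector states needs.
\<close>

locale semi_inner_product =
  fixes H :: "'h::complex_vector ip_space"
  assumes vectors_zero: "0 \<in> vectors H"
    and vectors_add: "x \<in> vectors H \<Longrightarrow> y \<in> vectors H \<Longrightarrow> x + y \<in> vectors H"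
    and vectors_scale: "x \<in> vectors H \<Longrightarrow> c *\<^sub>C x \<in> vectors H"
    and ip_add_left: "x \<in> vectors H \<Longrightarrow> y \<in> vectors H \<Longrightarrow> z \<in> vectors H \<Longrightarrow> ip H (x + y) z = ip H x z + ip H y z"
    and ip_scale_left: "x \<in> vectors H \<Longrightarrow> z \<in> vectors H \<Longrightarrow> ip H (c *\<^sub>C x) z = c * ip H x z"
    and ip_cnj: "x \<in> vectors H \<Longrightarrow> z \<in> vectors H \<Longrightarrow> cnj (ip H x z) = ip H z x"
    and ip_nonneg: "x \<in> vectors H \<Longrightarrow> 0 \<le> Re (ip H x x)"
begin

lemma vectors_diff: "x \<in> vectors H \<Longrightarrow> y \<in> vectors H \<Longrightarrow> x - y \<in> vectors H"
  using vectors_add[of x "(- 1) *\<^sub>C y"] vectors_scale[of y "- 1"] by (simp add: scaleC_minus_one)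

lemma vectors_sum: "(\<And>i. i \<in> I \<Longrightarrow> f i \<in> vectors H) \<Longrightarrow> sum f I \<in> vectors H"
  by (induction I rule: infinite_finite_induct) (auto simp: vectors_zero vectors_add)

lemma ip_zero_left: "z \<in> vectors H \<Longrightarrow> ip H 0 z = 0"
  using ip_scale_left[of z z 0] by (simp add: scaleC_zero_left)

lemma ip_zero_right: "z \<in> vectors H \<Longrightarrow> ip H z 0 = 0"
  using ip_cnj[of 0 z] ip_zero_left[of z] vectors_zero by simp

lemma ip_diff_left:
  "x \<in> vectors H \<Longrightarrow> y \<in> vectors H \<Longrightarrow> z \<in> vectors H \<Longrightarrow> ip H (x - y) z = ip H x z - ip H y z"
  using ip_add_left[of "x - y" y z] vectors_diff by simp

lemma ip_diff_right:
  "x \<in> vectors H \<Longrightarrow> y \<in> vectors H \<Longrightarrow> z \<in> vectors H \<Longrightarrow> ip H z (x - y) = ip H z x - ip H z y"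
  using ip_diff_left[of x y z] ip_cnj vectors_diff by (metis complex_cnj_diff)

lemma ip_scale_right: "x \<in> vectors H \<Longrightarrow> z \<in> vectors H \<Longrightarrow> ip H z (c *\<^sub>C x) = cnj c * ip H z x"
  using ip_scale_left[of x z c] ip_cnj vectors_scale by (metis complex_cnj_mult)

lemma ip_sum_left:
  "(\<And>i. i \<in> I \<Longrightarrow> f i \<in> vectors H) \<Longrightarrow> z \<in> vectors H \<Longrightarrow> ip H (sum f I) z = (\<Sum>i\<in>I. ip H (f i) z)"
  by (induction I rule: infinite_finite_induct) (auto simp: ip_zero_left ip_add_left vectors_sum)

lemma ip_self: "x \<in> vectors H \<Longrightarrow> ip H x x = of_real ((ip_norm H x)\<^sup>2)"
  using ip_cnj[of x x] ip_nonneg[of x]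
  by (auto simp: ip_norm_def complex_eq_iff)

lemma ip_norm_nonneg: "x \<in> vectors H \<Longrightarrow> 0 \<le> ip_norm H x"
  using ip_nonneg[of x] by (simp add: ip_norm_def)

lemma ip_norm_diff_scale:
  assumes "x \<in> vectors H" "y \<in> vectors H"
  shows "(ip_norm H (x - c *\<^sub>C y))\<^sup>2 = (ip_norm H x)\<^sup>2 - 2 * Re (cnj c * ip H x y) + (cmod c)\<^sup>2 * (ip_norm H y)\<^sup>2"
proof -
  have "ip H (x - c *\<^sub>C y) (x - c *\<^sub>C y)
      = ip H x x - cnj c * ip H x y - (c * ip H y x - c * cnj c * ip H y y)"
    using assms by (simp add: ip_diff_left ip_diff_right ip_scale_left ip_scale_right vectors_diff vectors_scale algebra_simps)
  also have "ip H y x = cnj (ip H x y)" using ip_cnj[OF assms] by simp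
  finally have "complex_of_real ((ip_norm H (x - c *\<^sub>C y))\<^sup>2)
      = of_real ((ip_norm H x)\<^sup>2) - (cnj c * ip H x y + cnj (cnj c * ip H x y)) + of_real ((cmod c)\<^sup>2 * (ip_norm H y)\<^sup>2)"
    using assms by (simp add: ip_self vectors_diff vectors_scale algebra_simps mult_cnj_norm)
  also have "\<dots> = of_real ((ip_norm H x)\<^sup>2 - 2 * Re (cnj c * ip H x y) + (cmod c)\<^sup>2 * (ip_norm H y)\<^sup>2)"
    by (subst complex_add_cnj) simp
  finally show ?thesis by (simp only: of_real_eq_iff)
qed

text \<open>
  The form may be degenerate, so the usual minimisation over \<open>t\<close> of the norm of \<open>x - t \<langle>x, y\<rangle> y\<close>
  needs the case that \<open>y\<close> has norm zero separately: there a large \<open>t\<close> forces the product to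
  vanish.
\<close>

lemma Cauchy_Schwarz:
  assumes x: "x \<in> vectors H" and y: "y \<in> vectors H"
  shows "cmod (ip H x y) \<le> ip_norm H x * ip_norm H y"
proof -
  define b where "b = (cmod (ip H x y))\<^sup>2"
  have key: "2 * t * b \<le> (ip_norm H x)\<^sup>2 + t\<^sup>2 * b * (ip_norm H y)\<^sup>2" for t :: real
  proof -
    have tb: "cnj (of_real t * ip H x y) * ip H x y = of_real (t * b)"
      by (simp add: b_def mult_cnj_norm mult.assoc)
    have "(ip_norm H (x - (of_real t * ip H x y) *\<^sub>C y))\<^sup>2 = (ip_norm H x)\<^sup>2 - 2 * (t * b) + t\<^sup>2 * b * (ip_norm H y)\<^sup>2"
      unfolding ip_norm_diff_scale[OF x y] tb by (simp add: b_def norm_mult power_mult_distrib)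
    then show ?thesis
      using zero_le_power2[of "ip_norm H (x - (of_real t * ip H x y) *\<^sub>C y)"] by linarith
  qed
  have "b \<le> (ip_norm H x * ip_norm H y)\<^sup>2"
  proof (cases "ip_norm H y = 0")
    case True
    have "b \<le> 0"
    proof (rule ccontr)
      assume "\<not> b \<le> 0"
      then show False using key[of "((ip_norm H x)\<^sup>2 + 1) / (2 * b)"] True by simp
    qed
    then show ?thesis using True by simp
  next
    case False
    define q where "q = (ip_norm H y)\<^sup>2"
    have "q > 0" using False by (simp add: q_def)
    have "2 * (1 / q) * b \<le> (ip_norm H x)\<^sup>2 + (1 / q)\<^sup>2 * b * q" using key[of "1 / q"] by (simp add: q_def)
    moreover have "(1 / q)\<^sup>2 * b * q = b / q" using \<open>q > 0\<close> by (simp add: power2_eq_square)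
    ultimately have "b / q \<le> (ip_norm H x)\<^sup>2" by simp
    then have "b \<le> (ip_norm H x)\<^sup>2 * q" using \<open>q > 0\<close> by (simp add: pos_divide_le_eq)
    then show ?thesis by (simp add: power_mult_distrib q_def)
  qed
  then show ?thesis
    unfolding b_def by (rule power2_le_imp_le[OF _ mult_nonneg_nonneg[OF ip_norm_nonneg[OF x] ip_norm_nonneg[OF y]]])
qed

definition orthonormal_on :: "'i set \<Rightarrow> ('i \<Rightarrow> 'h) \<Rightarrow> bool" where
  "orthonormal_on I e \<longleftrightarrow> e ` I \<subseteq> vectors H \<and> (\<forall>i\<in>I. \<forall>j\<in>I. ip H (e i) (e j) = (if i = j then 1 else 0))"

definition span_proj :: "('i \<Rightarrow> 'h) \<Rightarrow> 'i set \<Rightarrow> 'h \<Rightarrow> 'h" where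
  "span_proj e I x = (\<Sum>i\<in>I. ip H x (e i) *\<^sub>C e i)"

lemma span_proj_vector:
  "orthonormal_on I e \<Longrightarrow> x \<in> vectors H \<Longrightarrow> span_proj e I x \<in> vectors H"
  unfolding span_proj_def orthonormal_on_def by (intro vectors_sum vectors_scale) auto

lemma ip_span_proj:
  assumes "orthonormal_on I e" "x \<in> vectors H" "z \<in> vectors H"
  shows "ip H (span_proj e I x) z = (\<Sum>i\<in>I. ip H x (e i) * ip H (e i) z)"
proof -
  have e: "e i \<in> vectors H" if "i \<in> I" for i using assms(1) that by (auto simp: orthonormal_on_def)
  have "ip H (span_proj e I x) z = (\<Sum>i\<in>I. ip H (ip H x (e i) *\<^sub>C e i) z)"
    unfolding span_proj_def using e assms by (intro ip_sum_left vectors_scale) auto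
  also have "\<dots> = (\<Sum>i\<in>I. ip H x (e i) * ip H (e i) z)"
    using e assms by (intro sum.cong ip_scale_left) auto
  finally show ?thesis .
qed

lemma ip_span_proj_basis:
  assumes "finite I" "orthonormal_on I e" "x \<in> vectors H" "j \<in> I"
  shows "ip H (span_proj e I x) (e j) = ip H x (e j)"
proof -
  have "ip H (span_proj e I x) (e j) = (\<Sum>i\<in>I. ip H x (e i) * ip H (e i) (e j))"
    using assms by (intro ip_span_proj) (auto simp: orthonormal_on_def)
  also have "\<dots> = (\<Sum>i\<in>I. if i = j then ip H x (e i) else 0)"
    using assms by (intro sum.cong) (auto simp: orthonormal_on_def)
  finally show ?thesis using assms by simp
qed

lemma ip_span_proj_self:
  assumes "orthonormal_on I e" "x \<in> vectors H"
  shows "ip H (span_proj e I x) x = of_real (\<Sum>i\<in>I. (cmod (ip H x (e i)))\<^sup>2)"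
proof -
  have "ip H (e i) x = cnj (ip H x (e i))" if "i \<in> I" for i
    using that assms by (intro ip_cnj[symmetric]) (auto simp: orthonormal_on_def)
  then show ?thesis
    using assms by (simp add: ip_span_proj mult_cnj_norm cong: sum.cong)
qed

text \<open>
  Pythagoras and Bessel: \<open>\<langle>P x, P x\<rangle>\<close> and \<open>\<langle>x, P x\<rangle>\<close> are both the sum of the squared coefficients,
  so expanding the norm of \<open>x - P x\<close> gives the inequality.
\<close>

lemma ip_norm_span_proj:
  assumes "finite I" "orthonormal_on I e" "x \<in> vectors H"
  shows "(ip_norm H (span_proj e I x))\<^sup>2 = (\<Sum>i\<in>I. (cmod (ip H x (e i)))\<^sup>2)"
    and "(\<Sum>i\<in>I. (cmod (ip H x (e i)))\<^sup>2) \<le> (ip_norm H x)\<^sup>2"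
proof -
  let ?P = "span_proj e I x"
  have P: "?P \<in> vectors H" using assms by (simp add: span_proj_vector)
  have "ip H ?P ?P = (\<Sum>i\<in>I. ip H x (e i) * ip H (e i) ?P)"
    using assms P by (intro ip_span_proj) auto
  also have "\<dots> = (\<Sum>i\<in>I. ip H x (e i) * cnj (ip H x (e i)))"
  proof (intro sum.cong refl arg_cong2[where f = "(*)"])
    fix i assume "i \<in> I"
    then show "ip H (e i) ?P = cnj (ip H x (e i))"
      using ip_cnj[OF P, of "e i"] ip_span_proj_basis[OF assms, of i] assms(2)
      by (auto simp: orthonormal_on_def)
  qed
  also have "\<dots> = of_real (\<Sum>i\<in>I. (cmod (ip H x (e i)))\<^sup>2)"
    by (simp add: mult_cnj_norm)
  finally have "ip H ?P ?P = of_real (\<Sum>i\<in>I. (cmod (ip H x (e i)))\<^sup>2)" by simp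
  then show eq: "(ip_norm H ?P)\<^sup>2 = (\<Sum>i\<in>I. (cmod (ip H x (e i)))\<^sup>2)"
    unfolding ip_self[OF P] by (simp only: of_real_eq_iff)
  have "ip H x ?P = of_real (\<Sum>i\<in>I. (cmod (ip H x (e i)))\<^sup>2)"
    unfolding ip_cnj[OF P assms(3), symmetric] ip_span_proj_self[OF assms(2,3)]
    by (rule complex_cnj_complex_of_real)
  then have "(ip_norm H (x - 1 *\<^sub>C ?P))\<^sup>2 = (ip_norm H x)\<^sup>2 - (\<Sum>i\<in>I. (cmod (ip H x (e i)))\<^sup>2)"
    unfolding ip_norm_diff_scale[OF assms(3) P] eq by (simp del: of_real_sum)
  then show "(\<Sum>i\<in>I. (cmod (ip H x (e i)))\<^sup>2) \<le> (ip_norm H x)\<^sup>2"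
    using zero_le_power2[of "ip_norm H (x - 1 *\<^sub>C ?P)"] by linarith
qed

lemma span_proj_contraction:
  assumes "finite I" "orthonormal_on I e" "x \<in> vectors H"
  shows "ip_norm H (span_proj e I x) \<le> ip_norm H x"
proof (rule power2_le_imp_le)
  show "(ip_norm H (span_proj e I x))\<^sup>2 \<le> (ip_norm H x)\<^sup>2"
    unfolding ip_norm_span_proj(1)[OF assms] by (rule ip_norm_span_proj(2)[OF assms])
qed (rule ip_norm_nonneg[OF assms(3)])

text \<open>
  By Bessel's inequality the coefficients of \<open>x\<close> are square summable.
\<close>

lemma orthonormal_sequence_weakly_null:
  assumes e: "orthonormal_on UNIV (e :: nat \<Rightarrow> 'h)" and x: "x \<in> vectors H"
  shows "(\<lambda>n. ip H x (e n)) \<longlonglongrightarrow> 0"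
proof -
  have "(\<Sum>i<n. (cmod (ip H x (e i)))\<^sup>2) \<le> (ip_norm H x)\<^sup>2" for n
    using e x by (intro ip_norm_span_proj(2)) (auto simp: orthonormal_on_def)
  then have "summable (\<lambda>i. (cmod (ip H x (e i)))\<^sup>2)"
    by (intro summableI_nonneg_bounded) auto
  then have "(\<lambda>i. (cmod (ip H x (e i)))\<^sup>2) \<longlonglongrightarrow> 0" by (rule summable_LIMSEQ_zero)
  then have "(\<lambda>i. sqrt ((cmod (ip H x (e i)))\<^sup>2)) \<longlonglongrightarrow> sqrt 0" by (rule tendsto_real_sqrt)
  then show ?thesis by (simp add: tendsto_norm_zero_iff)
qed

text \<open>
  Only a projection that reproduces the given vectors up to norm zero is needed. A new vector
  \<open>v\<close> is handled by normalising \<open>w = v - P v\<close>, unless \<open>w\<close> already has norm zero; the vectors treated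
  before are not disturbed, because they are orthogonal to \<open>w\<close>.
\<close>

lemma Gram_Schmidt:
  assumes "finite F" "F \<subseteq> vectors H"
  shows "\<exists>E. finite E \<and> orthonormal_on E (\<lambda>u. u) \<and> (\<forall>x\<in>F. ip_norm H (x - span_proj (\<lambda>u. u) E x) = 0)"
  using assms
proof (induction F)
  case empty
  then show ?case by (intro exI[of _ "{}"]) (auto simp: orthonormal_on_def)
next
  case (insert v F)
  then obtain E where E: "finite E" "orthonormal_on E (\<lambda>u. u)"
    and F: "\<And>x. x \<in> F \<Longrightarrow> ip_norm H (x - span_proj (\<lambda>u. u) E x) = 0" by auto
  let ?P = "span_proj (\<lambda>u. u) E"
  have v: "v \<in> vectors H" and FV: "\<And>x. x \<in> F \<Longrightarrow> x \<in> vectors H" using insert.prems by auto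
  define w where "w = v - ?P v"
  have w: "w \<in> vectors H" unfolding w_def using v E by (intro vectors_diff span_proj_vector)
  show ?case
  proof (cases "ip_norm H w = 0")
    case True
    then show ?thesis using E F by (intro exI[of _ E]) (auto simp: w_def)
  next
    case False
    then have pos: "ip_norm H w > 0" using ip_norm_nonneg[OF w] by simp
    define u where "u = complex_of_real (1 / ip_norm H w) *\<^sub>C w"
    have u: "u \<in> vectors H" unfolding u_def using w by (rule vectors_scale)
    have EV: "z \<in> vectors H" if "z \<in> E" for z using E(2) that by (auto simp: orthonormal_on_def)
    have wE: "ip H w z = 0" if "z \<in> E" for z
      unfolding w_def using v E that EV[OF that] ip_span_proj_basis[OF E v that]
      by (simp add: ip_diff_left span_proj_vector)
    have uE: "ip H u z = 0" "ip H z u = 0" if "z \<in> E" for z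
    proof -
      show "ip H u z = 0" unfolding u_def using wE[OF that] w EV[OF that] by (simp add: ip_scale_left)
      then show "ip H z u = 0" using ip_cnj[OF u EV[OF that]] by simp
    qed
    have "ip H u u = of_real (1 / ip_norm H w) * (cnj (of_real (1 / ip_norm H w)) * ip H w w)"
      unfolding u_def using w by (simp only: ip_scale_left ip_scale_right vectors_scale mult_ac)
    then have uu: "ip H u u = 1"
      using w pos by (simp add: ip_self power2_eq_square)
    have "u \<notin> E" using uE uu by fastforce
    have orth: "orthonormal_on (insert u E) (\<lambda>u. u)"
      using E(2) u uE uu \<open>u \<notin> E\<close> unfolding orthonormal_on_def by auto
    have split: "span_proj (\<lambda>u. u) (insert u E) x = ip H x u *\<^sub>C u + ?P x" for x
      using E(1) \<open>u \<notin> E\<close> by (simp add: span_proj_def)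
    have Pu: "ip H (?P x) u = 0" if "x \<in> vectors H" for x
      using uE that E u by (subst ip_span_proj) auto
    have "ip_norm H (x - span_proj (\<lambda>u. u) (insert u E) x) = 0" if x: "x \<in> F" for x
    proof -
      have "ip H (x - ?P x) u = 0"
        using Cauchy_Schwarz[of "x - ?P x" u] F[OF x] FV[OF x] u E
        by (simp add: vectors_diff span_proj_vector)
      then have "ip H x u = 0"
        using Pu[OF FV[OF x]] FV[OF x] u E by (simp add: ip_diff_left span_proj_vector)
      then show ?thesis using F[OF x] by (simp add: split scaleC_zero_left)
    qed
    moreover have "ip_norm H (v - span_proj (\<lambda>u. u) (insert u E) v) = 0"
    proof -
      have "ip H v u = ip H w u"
        unfolding w_def using Pu[OF v] v u E by (simp add: ip_diff_left span_proj_vector)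
      also have "\<dots> = of_real (ip_norm H w)"
        unfolding u_def using w pos by (simp add: ip_scale_right ip_self power2_eq_square)
      finally have "ip H v u *\<^sub>C u = w"
        unfolding u_def using pos by (simp add: scaleC_scaleC scaleC_one flip: of_real_mult)
      then have "v - span_proj (\<lambda>u. u) (insert u E) v = 0" by (simp add: split w_def)
      then show ?thesis using ip_zero_left[OF vectors_zero] by (simp add: ip_norm_def)
    qed
    ultimately have "\<forall>x\<in>insert v F. ip_norm H (x - span_proj (\<lambda>u. u) (insert u E) x) = 0" by simp
    then show ?thesis
      by (intro exI[of _ "insert u E"] conjI orth) (simp add: E(1))
  qed
qed

lemma bounded_operator_le_dnorm:
  assumes T: "T \<in> elements (bounded_operators H)" and x: "x \<in> vectors H" "ip_norm H x \<le> 1"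
  shows "ip_norm H (T x) \<le> dnorm (bounded_operators H) T"
proof -
  have "\<exists>C. \<forall>x\<in>vectors H. ip_norm H (T x) \<le> C * ip_norm H x"
    using T by (simp add: bounded_operators_def)
  then obtain C where C: "\<And>x. x \<in> vectors H \<Longrightarrow> ip_norm H (T x) \<le> C * ip_norm H x"
    by blast
  have "bdd_above ((\<lambda>x. ip_norm H (T x)) ` {x \<in> vectors H. ip_norm H x \<le> 1})"
  proof (rule bdd_aboveI2)
    fix x assume x: "x \<in> {x \<in> vectors H. ip_norm H x \<le> 1}"
    then have "ip_norm H (T x) \<le> C * ip_norm H x" using C by simp
    also have "\<dots> \<le> \<bar>C\<bar> * 1" using x ip_norm_nonneg[of x] by (intro mult_mono) simp_all
    finally show "ip_norm H (T x) \<le> \<bar>C\<bar>" by simp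
  qed
  then have "ip_norm H (T x) \<le> (SUP x \<in> {x \<in> vectors H. ip_norm H x \<le> 1}. ip_norm H (T x))"
    using x by (intro cSUP_upper) simp_all
  then show ?thesis by (simp add: bounded_operators_def)
qed

lemma span_proj_bounded_operator:
  assumes "finite E" "orthonormal_on E e"
  shows "span_proj e E \<in> elements (bounded_operators H)"
proof -
  have e: "e i \<in> vectors H" if "i \<in> E" for i using assms(2) that by (auto simp: orthonormal_on_def)
  have "clinear_on (vectors H) (span_proj e E)"
    unfolding clinear_on_def
  proof (intro conjI ballI allI)
    fix x y assume "x \<in> vectors H" "y \<in> vectors H"
    then show "span_proj e E (x + y) = span_proj e E x + span_proj e E y"
      using e by (simp add: span_proj_def ip_add_left scaleC_add_left sum.distrib cong: sum.cong)
  next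
    fix c x assume "x \<in> vectors H"
    then show "span_proj e E (c *\<^sub>C x) = c *\<^sub>C span_proj e E x"
      using e assms(1) by (simp add: span_proj_def ip_scale_left scaleC_scaleC scaleC_sum_right cong: sum.cong)
  qed
  moreover have "\<forall>x\<in>vectors H. ip_norm H (span_proj e E x) \<le> 1 * ip_norm H x"
    using span_proj_contraction[OF assms] by simp
  moreover have "span_proj e E ` vectors H \<subseteq> vectors H"
    using span_proj_vector[OF assms(2)] by (rule image_subsetI)
  ultimately show ?thesis
    unfolding bounded_operators_def dual_space.simps by blast
qed

text \<open>
  Finite rank projections, indexed by the finite sets of vectors that they reproduce, converge
  to the identity against every trace class functional, because such a functional is
  determined up to a small error by finitely many of its vectors. The limit of the vector
  states vanishes on finite rank operators, as orthonormal sequences are weakly null.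
\<close>

theorem not_gleason_whitney_bounded_operators:
  fixes e :: "nat \<Rightarrow> 'h"
  assumes X: "X \<subseteq> elements (bounded_operators H)" and id: "(\<lambda>x. x) \<in> X"
    and e: "orthonormal_on UNIV e" and v: "v \<in> vectors H"
    and lim: "\<And>T. T \<in> X \<Longrightarrow> (\<lambda>n. ip H (T (e n)) (e n)) \<longlonglongrightarrow> ip H (T v) v"
  shows "\<not> gleason_whitney (bounded_operators H) X (elements (bounded_operators H))"
proof -
  let ?B = "bounded_operators H"
  have eV: "e n \<in> vectors H" and ee: "ip H (e n) (e n) = 1" and en: "ip_norm H (e n) = 1" for n
    using e by (auto simp: orthonormal_on_def ip_norm_def)
  have TV: "T x \<in> vectors H" if "T \<in> elements ?B" "x \<in> vectors H" for T x
    using that by (simp add: bounded_operators_def image_subset_iff)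
  define E where "E F = (if finite F \<and> F \<subseteq> vectors H then
      (SOME E. finite E \<and> orthonormal_on E (\<lambda>u. u) \<and> (\<forall>x\<in>F. ip_norm H (x - span_proj (\<lambda>u. u) E x) = 0)) else {})" for F
  have E: "finite (E F)" "orthonormal_on (E F) (\<lambda>u. u)" for F
  proof -
    have "finite (E F) \<and> orthonormal_on (E F) (\<lambda>u. u)"
    proof (cases "finite F \<and> F \<subseteq> vectors H")
      case True
      then show ?thesis using someI_ex[OF Gram_Schmidt[of F]] by (simp add: E_def)
    next
      case False
      then have "E F = {}" unfolding E_def by (rule if_not_P)
      then show ?thesis by (simp add: orthonormal_on_def)
    qed
    then show "finite (E F)" "orthonormal_on (E F) (\<lambda>u. u)" by auto
  qed
  have E_exact: "ip_norm H (x - span_proj (\<lambda>u. u) (E F) x) = 0" if "finite F" "F \<subseteq> vectors H" "x \<in> F" for F x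
    using someI_ex[OF Gram_Schmidt[OF that(1,2)]] that by (simp add: E_def)
  let ?P = "\<lambda>F. span_proj (\<lambda>u. u) (E F)"
  \<comment> \<open>The vector state of \<open>v\<close>, written as a trace class functional with a single nonzero pair of vectors.\<close>
  define \<phi> where "\<phi> T = (\<Sum>n. ip H (T (if n = 0 then v else 0)) (if n = 0 then v else 0))"
    for T :: "'h \<Rightarrow> 'h"
  have \<phi>_eq: "\<phi> T = ip H (T v) v" if "T 0 \<in> vectors H" for T
  proof -
    have "\<phi> T = (\<Sum>n\<in>{0::nat}. ip H (T (if n = 0 then v else 0)) (if n = 0 then v else 0))"
      unfolding \<phi>_def using that by (intro suminf_finite) (auto simp: ip_zero_right)
    then show ?thesis by simp
  qed
  show ?thesis
  proof (rule not_gleason_whitney_if_limits_differ[where e = "\<lambda>x. x" and ?T0.0 = "\<lambda>x. x" and T = ?P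
        and G = "finite_subsets_at_top (vectors H)" and \<omega> = "\<lambda>n T. ip H (T (e n)) (e n)" and \<phi> = \<phi>
        and a = 0 and b = 1])
    show "clinear_on (elements ?B) (\<lambda>T. ip H (T (e n)) (e n))" for n
      using TV eV by (auto simp: clinear_on_def ip_add_left scaleC_fun_def ip_scale_left scaleC_complex_def)
    show "cmod (ip H (T (e n)) (e n)) \<le> dnorm ?B T" if "T \<in> elements ?B" for T n
      using Cauchy_Schwarz[OF TV[OF that eV[of n]] eV[of n]] bounded_operator_le_dnorm[OF that eV[of n]] en[of n]
      by simp
    show "dnorm ?B (\<lambda>x. x) \<le> 1"
      using eV en unfolding bounded_operators_def by (auto intro!: cSUP_least) (metis order_refl)
    show "\<phi> \<in> predual ?B"
    proof -
      have "summable (\<lambda>n. (ip_norm H (if n = 0 then v else 0))\<^sup>2)" for n :: nat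
        by (rule summable_finite[of "{0}"]) (auto simp: ip_norm_def ip_zero_left vectors_zero)
      then show ?thesis
        using v vectors_zero unfolding bounded_operators_def \<phi>_def
        by (auto intro!: exI[of _ "\<lambda>n. if n = 0 then v else 0"])
    qed
    show "clinear_on (elements ?B) \<phi>"
      using TV v vectors_zero
      by (auto simp: clinear_on_def \<phi>_eq ip_add_left scaleC_fun_def ip_scale_left scaleC_complex_def vectors_add vectors_scale)
    show "(\<lambda>n. ip H (T (e n)) (e n)) \<longlonglongrightarrow> \<phi> T" if "T \<in> X" for T
      using lim[OF that] TV vectors_zero X that by (subst \<phi>_eq) auto
    show "?P F \<in> elements ?B" for F using E by (rule span_proj_bounded_operator)
    show "(\<lambda>n. ip H (?P F (e n)) (e n)) \<longlonglongrightarrow> 0" for F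
    proof -
      have u: "u \<in> vectors H" if "u \<in> E F" for u using E(2) that by (auto simp: orthonormal_on_def)
      have "(\<lambda>n. \<Sum>u\<in>E F. cnj (ip H u (e n)) * ip H u (e n)) \<longlonglongrightarrow> (\<Sum>u\<in>E F. cnj 0 * 0)"
        by (intro tendsto_intros orthonormal_sequence_weakly_null e u)
      moreover have "ip H (?P F (e n)) (e n) = (\<Sum>u\<in>E F. cnj (ip H u (e n)) * ip H u (e n))" for n
        using E(2) eV u by (simp add: ip_span_proj ip_cnj cong: sum.cong)
      ultimately show ?thesis by simp
    qed
    show "((\<lambda>F. p (?P F)) \<longlongrightarrow> p (\<lambda>x. x)) (finite_subsets_at_top (vectors H))" if p_mem: "p \<in> predual ?B" for p
    proof -
      obtain x y where p: "p = (\<lambda>T. \<Sum>n. ip H (T (x n)) (y n))"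
        and range: "range x \<subseteq> vectors H" "range y \<subseteq> vectors H"
        and sq: "summable (\<lambda>n. (ip_norm H (x n))\<^sup>2)" "summable (\<lambda>n. (ip_norm H (y n))\<^sup>2)"
        using p_mem unfolding bounded_operators_def dual_space.simps by blast
      have x: "x n \<in> vectors H" and y: "y n \<in> vectors H" for n using range by auto
      define s where "s n = ip_norm H (x n) * ip_norm H (y n)" for n
      have s0: "0 \<le> s n" for n using x y by (simp add: s_def ip_norm_nonneg)
      have s: "summable s"
      proof (rule summable_comparison_test')
        show "summable (\<lambda>n. (ip_norm H (x n))\<^sup>2 + (ip_norm H (y n))\<^sup>2)" by (intro summable_add sq)
        show "norm (s n) \<le> (ip_norm H (x n))\<^sup>2 + (ip_norm H (y n))\<^sup>2" for n
          using s0[of n] sum_squares_bound[of "ip_norm H (x n)" "ip_norm H (y n)"] by (simp add: s_def)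
      qed
      have le: "cmod (ip H (z - ?P F z) (y n)) \<le> 2 * (ip_norm H z * ip_norm H (y n))"
        if z: "z \<in> vectors H" for F z n
      proof -
        have P: "?P F z \<in> vectors H" using E z by (simp add: span_proj_vector)
        have "cmod (ip H (z - ?P F z) (y n)) \<le> cmod (ip H z (y n)) + cmod (ip H (?P F z) (y n))"
          using z P y by (simp add: ip_diff_left norm_triangle_ineq4)
        also have "\<dots> \<le> ip_norm H z * ip_norm H (y n) + ip_norm H (?P F z) * ip_norm H (y n)"
          using z P y by (intro add_mono Cauchy_Schwarz)
        also have "\<dots> \<le> ip_norm H z * ip_norm H (y n) + ip_norm H z * ip_norm H (y n)"
          using E z y by (intro add_mono mult_right_mono span_proj_contraction ip_norm_nonneg) auto
        finally show ?thesis by simp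
      qed
      have summable_ip: "summable (\<lambda>n. ip H (x n) (y n))"
        by (rule summable_comparison_test'[OF s]) (use Cauchy_Schwarz x y in \<open>auto simp: s_def\<close>)
      show ?thesis
        unfolding tendsto_iff
      proof safe
        fix r :: real assume "r > 0"
        then obtain K where K: "norm (\<Sum>n. s (n + K)) < r / 2"
          using suminf_exist_split[of "r / 2" s] s by auto
        \<comment> \<open>The projection reproduces the first \<open>K\<close> vectors, and the other terms are bounded by the tail of \<open>2 s\<close>.\<close>
        have "dist (p (?P F)) (p (\<lambda>x. x)) < r" if F: "finite F" "x ` {..<K} \<subseteq> F" "F \<subseteq> vectors H" for F
        proof -
          define d where "d n = ip H (x n - ?P F (x n)) (y n)" for n
          have d_small: "d n = 0" if "n < K" for n
            using Cauchy_Schwarz[of "x n - ?P F (x n)" "y n"] E_exact[OF F(1,3), of "x n"] F(2) that x y E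
            by (auto simp: d_def vectors_diff span_proj_vector)
          have d_le: "cmod (d n) \<le> 2 * s n" for n using le[OF x(1)] by (simp add: d_def s_def)
          have sd: "summable (\<lambda>n. cmod (d n))"
            by (rule summable_comparison_test'[of "\<lambda>n. 2 * s n"]) (use d_le s in \<open>auto intro: summable_mult\<close>)
          have "ip H (?P F (x n)) (y n) = ip H (x n) (y n) - d n" for n
            using x y E by (simp add: d_def ip_diff_left span_proj_vector)
          then have "p (\<lambda>x. x) - p (?P F) = suminf d"
            unfolding p using summable_ip summable_norm_cancel[OF sd] by (simp flip: suminf_diff)
          also have "suminf d = (\<Sum>n. d (n + K))"
            using suminf_split_initial_segment[OF summable_norm_cancel[OF sd], of K] d_small by simp
          also have "cmod \<dots> \<le> (\<Sum>n. cmod (d (n + K)))"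
            by (intro summable_norm summable_ignore_initial_segment[OF sd])
          also have "\<dots> \<le> (\<Sum>n. 2 * s (n + K))"
            using d_le by (intro suminf_le summable_mult summable_ignore_initial_segment[OF sd] summable_ignore_initial_segment[OF s])
          also have "\<dots> = 2 * (\<Sum>n. s (n + K))"
            by (intro suminf_mult summable_ignore_initial_segment s)
          also have "\<dots> < r" using K by simp
          finally show ?thesis by (simp add: dist_norm norm_minus_commute)
        qed
        then show "eventually (\<lambda>F. dist (p (?P F)) (p (\<lambda>x. x)) < r) (finite_subsets_at_top (vectors H))"
          unfolding eventually_finite_subsets_at_top using x
          by (intro exI[of _ "x ` {..<K}"]) auto
      qed
    qed
  qed (use X id ee in auto)
qed

end

section \<open>Multiplication operators on L2\<close>

lemma vectors_L2: "vectors (L2 M) = {f \<in> borel_measurable M. integrable M (\<lambda>x. (cmod (f x))\<^sup>2)}"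
  by (simp add: L2_def)

lemma ip_L2: "ip (L2 M) f g = (\<integral>x. f x * cnj (g x) \<partial>M)"
  by (simp add: L2_def)

lemma cnj_borel_measurable: "f \<in> borel_measurable M \<Longrightarrow> (\<lambda>x. cnj (f x)) \<in> borel_measurable M"
  by (rule measurable_compose[OF _ borel_measurable_continuous_onI]) (auto intro: continuous_intros)

lemma L2_integrable_mult:
  assumes "f \<in> vectors (L2 M)" "g \<in> vectors (L2 M)"
  shows "integrable M (\<lambda>x. f x * cnj (g x))"
proof (rule Bochner_Integration.integrable_bound)
  show "integrable M (\<lambda>x. (cmod (f x))\<^sup>2 + (cmod (g x))\<^sup>2)"
    using assms by (simp add: vectors_L2)
  show "(\<lambda>x. f x * cnj (g x)) \<in> borel_measurable M"
    using assms by (intro borel_measurable_times cnj_borel_measurable) (simp_all add: vectors_L2)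
  have "cmod (f x * cnj (g x)) \<le> norm ((cmod (f x))\<^sup>2 + (cmod (g x))\<^sup>2)" for x
  proof -
    have "cmod (f x) * cmod (g x) \<le> (cmod (f x))\<^sup>2 + (cmod (g x))\<^sup>2"
      using sum_squares_bound[of "cmod (f x)" "cmod (g x)"] mult_nonneg_nonneg[of "cmod (f x)" "cmod (g x)"]
        norm_ge_zero[of "f x"] norm_ge_zero[of "g x"] by linarith
    then show ?thesis by (simp add: norm_mult)
  qed
  then show "AE x in M. cmod (f x * cnj (g x)) \<le> norm ((cmod (f x))\<^sup>2 + (cmod (g x))\<^sup>2)" by simp
qed

lemma ip_norm_L2: "(ip_norm (L2 M) f) = sqrt (\<integral>x. (cmod (f x))\<^sup>2 \<partial>M)"
proof -
  have "(\<integral>x. f x * cnj (f x) \<partial>M) = complex_of_real (\<integral>x. (cmod (f x))\<^sup>2 \<partial>M)"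
    unfolding integral_complex_of_real[symmetric] by (simp add: mult_cnj_norm)
  then show ?thesis by (simp add: ip_norm_def ip_L2)
qed

lemma semi_inner_product_L2: "semi_inner_product (L2 M)"
proof
  fix x y z :: "'a \<Rightarrow> complex" and c :: complex
  show "0 \<in> vectors (L2 M)" by (simp add: vectors_L2 zero_fun_def)
  show "x + y \<in> vectors (L2 M)" if x: "x \<in> vectors (L2 M)" and y: "y \<in> vectors (L2 M)"
  proof -
    have "integrable M (\<lambda>t. (cmod (x t + y t))\<^sup>2)"
    proof (rule Bochner_Integration.integrable_bound)
      show "integrable M (\<lambda>t. 2 * (cmod (x t))\<^sup>2 + 2 * (cmod (y t))\<^sup>2)"
        using x y by (simp add: vectors_L2)
      show "(\<lambda>t. (cmod (x t + y t))\<^sup>2) \<in> borel_measurable M"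
      proof -
        have [measurable]: "x \<in> borel_measurable M" "y \<in> borel_measurable M" using x y by (simp_all add: vectors_L2)
        show ?thesis by measurable
      qed
      have "(cmod (x t + y t))\<^sup>2 \<le> 2 * (cmod (x t))\<^sup>2 + 2 * (cmod (y t))\<^sup>2" for t
      proof -
        have "(cmod (x t + y t))\<^sup>2 \<le> (cmod (x t) + cmod (y t))\<^sup>2"
          by (intro power_mono norm_triangle_ineq) auto
        then show ?thesis
          using sum_squares_bound[of "cmod (x t)" "cmod (y t)"] by (simp add: power2_sum)
      qed
      then show "AE t in M. norm ((cmod (x t + y t))\<^sup>2) \<le> norm (2 * (cmod (x t))\<^sup>2 + 2 * (cmod (y t))\<^sup>2)" by simp
    qed
    moreover have "x \<in> borel_measurable M" "y \<in> borel_measurable M" using x y by (simp_all add: vectors_L2)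
    then have "(\<lambda>t. x t + y t) \<in> borel_measurable M" by (rule borel_measurable_add)
    ultimately show ?thesis by (simp add: vectors_L2 plus_fun_def)
  qed
  show "c *\<^sub>C x \<in> vectors (L2 M)" if "x \<in> vectors (L2 M)"
    using that
    by (auto simp: vectors_L2 scaleC_fun_def scaleC_complex_def norm_mult power_mult_distrib intro!: borel_measurable_times)
  show "ip (L2 M) (x + y) z = ip (L2 M) x z + ip (L2 M) y z"
    if "x \<in> vectors (L2 M)" "y \<in> vectors (L2 M)" "z \<in> vectors (L2 M)"
    using L2_integrable_mult[OF that(1,3)] L2_integrable_mult[OF that(2,3)]
    by (simp add: ip_L2 distrib_right)
  show "ip (L2 M) (c *\<^sub>C x) z = c * ip (L2 M) x z"
    by (simp add: ip_L2 scaleC_fun_def scaleC_complex_def mult.assoc)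
  show "cnj (ip (L2 M) x z) = ip (L2 M) z x"
    unfolding ip_L2 Bochner_Integration.integral_cnj[symmetric] by (simp add: mult.commute)
  show "0 \<le> Re (ip (L2 M) x x)"
  proof -
    have "ip (L2 M) x x = complex_of_real (\<integral>t. (cmod (x t))\<^sup>2 \<partial>M)"
      unfolding integral_complex_of_real[symmetric] by (simp add: mult_cnj_norm ip_L2)
    then show ?thesis by simp
  qed
qed

lemma mult_op_one: "mult_op (\<lambda>_. 1) = (\<lambda>x. x)"
  by (simp add: mult_op_def)

lemma mult_op_clinear: "clinear_on V (mult_op f)"
  by (simp add: clinear_on_def mult_op_def scaleC_fun_def scaleC_complex_def fun_eq_iff algebra_simps)

lemma mult_op_Linf_bounded_operator:
  assumes f: "f \<in> elements (Linf M)"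
  shows "mult_op f \<in> elements (bounded_operators (L2 M))"
proof -
  define B where "B = dnorm (Linf M) f"
  have B: "0 \<le> B" by (simp add: B_def dnorm_Linf_nonneg)
  have le: "AE x in M. (cmod (f x * g x))\<^sup>2 \<le> B\<^sup>2 * (cmod (g x))\<^sup>2" for g
    using Linf_AE_le_dnorm[OF f]
  proof eventually_elim
    case (elim x)
    then show ?case by (auto simp: norm_mult power_mult_distrib B_def intro!: mult_right_mono power_mono)
  qed
  have int: "integrable M (\<lambda>x. (cmod (f x * g x))\<^sup>2)" if g: "g \<in> vectors (L2 M)" for g
  proof (rule Bochner_Integration.integrable_bound)
    show "integrable M (\<lambda>x. B\<^sup>2 * (cmod (g x))\<^sup>2)" using g by (simp add: vectors_L2)
    show "(\<lambda>x. (cmod (f x * g x))\<^sup>2) \<in> borel_measurable M"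
    proof -
      have [measurable]: "g \<in> borel_measurable M" "f \<in> borel_measurable M"
        using g Linf_measurable[OF f] by (simp_all add: vectors_L2)
      show ?thesis by measurable
    qed
    show "AE x in M. norm ((cmod (f x * g x))\<^sup>2) \<le> norm (B\<^sup>2 * (cmod (g x))\<^sup>2)"
      using le[of g] by eventually_elim simp
  qed
  have "mult_op f g \<in> vectors (L2 M)" if g: "g \<in> vectors (L2 M)" for g
  proof -
    have "f \<in> borel_measurable M" "g \<in> borel_measurable M"
      using g Linf_measurable[OF f] by (simp_all add: vectors_L2)
    then have "(\<lambda>x. f x * g x) \<in> borel_measurable M" by (rule borel_measurable_times)
    then show ?thesis using int[OF g] by (simp add: vectors_L2 mult_op_def)
  qed
  moreover have "ip_norm (L2 M) (mult_op f g) \<le> B * ip_norm (L2 M) g" if g: "g \<in> vectors (L2 M)" for g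
  proof -
    have "(\<integral>x. (cmod (f x * g x))\<^sup>2 \<partial>M) \<le> (\<integral>x. B\<^sup>2 * (cmod (g x))\<^sup>2 \<partial>M)"
      using int[OF g] g le[of g] by (intro integral_mono_AE) (simp_all add: vectors_L2)
    then have "sqrt (\<integral>x. (cmod (f x * g x))\<^sup>2 \<partial>M) \<le> sqrt (B\<^sup>2 * (\<integral>x. (cmod (g x))\<^sup>2 \<partial>M))" by simp
    then show ?thesis using B by (simp add: ip_norm_L2 mult_op_def real_sqrt_mult)
  qed
  ultimately show ?thesis
    using mult_op_clinear[of "vectors (L2 M)" f]
    unfolding bounded_operators_def dual_space.simps by blast
qed

text \<open>
  The primitive \<open>cis (c x) / (\<i> c)\<close> takes the same value at both ends of the interval.
\<close>

lemma integral_exp_unit_interval: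
  assumes "k \<noteq> 0"
  shows "(\<integral>x. cis (2 * pi * of_int k * x) \<partial>lebesgue_on {0..1}) = 0"
proof -
  define c where "c = 2 * pi * of_int k"
  have c: "c \<noteq> 0" using assms by (simp add: c_def)
  have deriv: "((\<lambda>x. cis (c * x) / (\<i> * c)) has_vector_derivative cis (c * x)) (at x within {0..1})" for x
  proof -
    have "((\<lambda>z. exp (\<i> * c * z) / (\<i> * c)) has_field_derivative exp (\<i> * c * of_real x)) (at (of_real x))"
      using c by (auto intro!: derivative_eq_intros)
    from has_vector_derivative_real_field[OF this]
    show ?thesis by (simp add: cis_conv_exp mult.assoc)
  qed
  have "((\<lambda>x. cis (c * x)) has_integral cis (c * 1) / (\<i> * c) - cis (c * 0) / (\<i> * c)) {0..1}"
    using deriv by (intro fundamental_theorem_of_calculus) auto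
  moreover have "cis (c * 1) = 1" unfolding c_def using cis_multiple_2pi[of "of_int k"] by simp
  ultimately have "((\<lambda>x. cis (c * x)) has_integral 0) {0..1}" by simp
  moreover have "integrable (lebesgue_on {0..1}) (\<lambda>x. cis (c * x))"
  proof (rule finite_measure.integrable_const_bound[where B = 1])
    show "finite_measure (lebesgue_on {0..1::real})"
      by (rule finite_measure_lebesgue_on_unit_interval)
    show "(\<lambda>x. cis (c * x)) \<in> borel_measurable (lebesgue_on {0..1})"
      by (intro continuous_imp_measurable_on_sets_lebesgue continuous_intros) auto
  qed auto
  ultimately show ?thesis
    by (simp add: lebesgue_integral_eq_integral integral_unique flip: c_def)
qed

text \<open>
  The exponentials have modulus one, so that \<open>\<langle>f e\<^sub>n, e\<^sub>n\<rangle>\<close> is the integral of \<open>f\<close> for every \<open>n\<close>.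
\<close>

lemma not_gleason_whitney_mult_ops_L2:
  "\<not> gleason_whitney (bounded_operators (L2 (lebesgue_on {0..1::real})))
        (mult_op ` elements (Linf (lebesgue_on {0..1})))
        (elements (bounded_operators (L2 (lebesgue_on {0..1}))))"
proof -
  let ?M = "lebesgue_on {0..1::real}"
  interpret semi_inner_product "L2 ?M" by (rule semi_inner_product_L2)
  interpret fin: finite_measure ?M by (rule finite_measure_lebesgue_on_unit_interval)
  define e where "e n x = cis (2 * pi * real n * x)" for n x
  have e: "e n \<in> vectors (L2 ?M)" for n
  proof -
    have "e n \<in> borel_measurable ?M"
      unfolding e_def by (intro continuous_imp_measurable_on_sets_lebesgue continuous_intros) auto
    then show ?thesis by (simp add: vectors_L2 e_def)
  qed
  show ?thesis
  proof (rule not_gleason_whitney_bounded_operators[where e = e and v = "e 0"])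
    show "mult_op ` elements (Linf ?M) \<subseteq> elements (bounded_operators (L2 ?M))"
      using mult_op_Linf_bounded_operator by blast
    show "(\<lambda>x. x) \<in> mult_op ` elements (Linf ?M)"
      using Linf_memI(1)[of "\<lambda>_. 1" ?M 1] mult_op_one by (subst mult_op_one[symmetric]) (intro imageI, auto)
    have "ip (L2 ?M) (e m) (e n) = (if m = n then 1 else 0)" for m n
    proof -
      have "e m x * cnj (e n x) = cis (2 * pi * of_int (int m - int n) * x)" for x
        by (simp add: e_def cis_cnj cis_mult algebra_simps)
      then show ?thesis
        using integral_exp_unit_interval[of "int m - int n"]
        by (auto simp: ip_L2 measure_restrict_space)
    qed
    then show "orthonormal_on UNIV e" using e by (auto simp: orthonormal_on_def)
    show "e 0 \<in> vectors (L2 ?M)" by (rule e)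
    fix T assume "T \<in> mult_op ` elements (Linf ?M)"
    then obtain f where "T = mult_op f" by blast
    then have "(\<lambda>n. ip (L2 ?M) (T (e n)) (e n)) = (\<lambda>n. ip (L2 ?M) (T (e 0)) (e 0))"
      by (simp add: ip_L2 mult_op_def e_def mult.assoc cis_cnj cis_mult)
    then show "(\<lambda>n. ip (L2 ?M) (T (e n)) (e n)) \<longlonglongrightarrow> ip (L2 ?M) (T (e 0)) (e 0)" by simp
  qed
qed

section \<open>Averages over roots of unity\<close>

text \<open>
  Averaging over roots of unity is a discrete substitute for integration over circles. It is
  exact on polynomials of degree less than \<open>n\<close>, so it serves both for mean value properties and
  for Parseval's identity.
\<close>

definition root_avg :: "nat \<Rightarrow> (complex \<Rightarrow> complex) \<Rightarrow> complex \<Rightarrow> complex" where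
  "root_avg n F z = (\<Sum>k<n. F (cis (2 * pi * real k / real n) * z)) / n"

text \<open>
  A geometric sum of powers of an \<open>n\<close>-th root of unity, which differs from one unless \<open>n\<close> divides
  \<open>j\<close>.
\<close>

lemma root_avg_power:
  assumes "0 < n"
  shows "root_avg n (\<lambda>z. z ^ j) z = (if n dvd j then z ^ j else 0)"
proof -
  let ?w = "cis (2 * pi * real j / real n)"
  have "(cis (2 * pi * real k / real n) * z) ^ j = z ^ j * ?w ^ k" for k
  proof -
    have "cis (2 * pi * real k / real n) ^ j = cis (real j * (2 * pi * real k / real n))" by (rule Complex.DeMoivre)
    also have "real j * (2 * pi * real k / real n) = real k * (2 * pi * real j / real n)" by simp
    also have "cis \<dots> = ?w ^ k" by (rule Complex.DeMoivre[symmetric])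
    finally show ?thesis by (simp only: power_mult_distrib mult.commute)
  qed
  then have "root_avg n (\<lambda>z. z ^ j) z = z ^ j * (\<Sum>k<n. ?w ^ k) / n"
    by (simp add: root_avg_def sum_distrib_left)
  moreover have "?w = 1 \<longleftrightarrow> n dvd j"
    using complex_root_unity_eq_1[of n j] assms by (simp add: cis_conv_exp mult_ac)
  moreover have "?w ^ n = 1"
    using assms cis_multiple_2pi[of "real j"] by (simp add: Complex.DeMoivre)
  ultimately show ?thesis
    using assms by (cases "n dvd j") (simp_all add: sum_gp_strict)
qed

lemma root_avg_poly:
  assumes "degree p < n"
  shows "root_avg n (poly p) z = poly p 0"
proof -
  have "root_avg n (poly p) z = (\<Sum>k<n. \<Sum>j\<le>degree p. coeff p j * (cis (2 * pi * real k / real n) * z) ^ j) / n"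
    by (simp add: root_avg_def poly_altdef)
  also have "\<dots> = (\<Sum>j\<le>degree p. coeff p j * root_avg n (\<lambda>z. z ^ j) z)"
    by (subst sum.swap) (simp add: root_avg_def sum_distrib_left sum_divide_distrib)
  also have "\<dots> = (\<Sum>j\<le>degree p. if j = 0 then coeff p j else 0)"
    using assms by (intro sum.cong) (auto simp: root_avg_power dest: dvd_imp_le)
  also have "\<dots> = poly p 0" by (simp add: poly_0_coeff_0)
  finally show ?thesis .
qed

lemma root_avg_bound:
  assumes "0 < n" "\<And>k. cmod (F (cis (2 * pi * real k / n) * z)) \<le> B"
  shows "cmod (root_avg n F z) \<le> B"
proof -
  have "cmod (\<Sum>k<n. F (cis (2 * pi * real k / real n) * z)) \<le> (\<Sum>k<n. B)"
    using assms(2) by (intro sum_norm_le) auto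
  then show ?thesis using assms(1) by (simp add: root_avg_def norm_divide divide_le_eq mult.commute)
qed

lemma root_avg_diff: "root_avg n (\<lambda>z. F z - G z) z = root_avg n F z - root_avg n G z"
  by (simp add: root_avg_def sum_subtractf diff_divide_distrib)

text \<open>
  Exactness on polynomials carries over to their uniform limits. The radii of the points may
  change with \<open>n\<close>, which matters for the disc algebra, where they tend to one.
\<close>

lemma root_avg_tendsto_value_at_0:
  assumes rot: "\<And>c w. cmod c = 1 \<Longrightarrow> w \<in> A \<Longrightarrow> c * w \<in> A" and "0 \<in> A" and z: "\<And>n. z n \<in> A"
    and approx: "\<And>e. e > 0 \<Longrightarrow> \<exists>p. \<forall>w\<in>A. cmod (F w - poly p w) < e"
  shows "(\<lambda>n. root_avg n F (z n)) \<longlonglongrightarrow> F 0"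
proof (rule LIMSEQ_I)
  fix r :: real assume "r > 0"
  then obtain p where p: "\<And>w. w \<in> A \<Longrightarrow> cmod (F w - poly p w) < r / 3" using approx[of "r / 3"] by auto
  have "cmod (root_avg n F (z n) - F 0) < r" if n: "n \<ge> Suc (degree p)" for n
  proof -
    have "cmod (root_avg n (\<lambda>w. F w - poly p w) (z n)) \<le> r / 3"
    proof (rule root_avg_bound)
      show "cmod (F (cis (2 * pi * real k / n) * z n) - poly p (cis (2 * pi * real k / n) * z n)) \<le> r / 3" for k
        using p[OF rot[OF _ z]] by (intro less_imp_le) auto
    qed (use n in simp)
    then have "cmod (root_avg n F (z n) - poly p 0) \<le> r / 3"
      using root_avg_poly[of p n "z n"] n by (simp add: root_avg_diff)
    moreover have "cmod (F 0 - poly p 0) < r / 3" using p \<open>0 \<in> A\<close> by blast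
    ultimately show ?thesis
      using norm_triangle_ineq4[of "root_avg n F (z n) - poly p 0" "F 0 - poly p 0"] \<open>r > 0\<close> by simp
  qed
  then show "\<exists>no. \<forall>n\<ge>no. cmod (root_avg n F (z n) - F 0) < r" by blast
qed

lemma taylor_sums:
  "f holomorphic_on ball 0 1 \<Longrightarrow> z \<in> ball 0 1 \<Longrightarrow> (\<lambda>n. taylor_coeff f n * z ^ n) sums f z"
  using holomorphic_power_series[of f 0 1 z] by (simp add: taylor_coeff_def)

text \<open>
  The series converges at some radius \<open>s\<close> with \<open>r < s < 1\<close>, hence absolutely at \<open>r\<close>.
\<close>

lemma taylor_abs_summable:
  assumes f: "f holomorphic_on ball 0 1" and r: "0 \<le> r" "r < 1"
  shows "summable (\<lambda>n. cmod (taylor_coeff f n) * r ^ n)"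
proof -
  obtain s where s: "r < s" "s < 1" using r dense by blast
  have "summable (\<lambda>n. taylor_coeff f n * of_real s ^ n)"
    using taylor_sums[OF f, of "of_real s"] s r by (auto simp: sums_iff)
  then have "summable (\<lambda>n. norm (taylor_coeff f n * of_real r ^ n))"
    by (rule powser_insidea) (use r s in auto)
  then show ?thesis using r by (simp add: norm_mult norm_power)
qed

lemma taylor_uniform_limit:
  assumes f: "f holomorphic_on ball 0 1" and r: "0 \<le> r" "r < 1"
  shows "uniform_limit (cball 0 r) (\<lambda>N z. \<Sum>n<N. taylor_coeff f n * z ^ n) f sequentially"
proof -
  have "uniform_limit (cball 0 r) (\<lambda>N z. \<Sum>n<N. taylor_coeff f n * z ^ n) (\<lambda>z. \<Sum>n. taylor_coeff f n * z ^ n) sequentially"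
  proof (rule Weierstrass_m_test[OF _ taylor_abs_summable[OF f r]])
    show "cmod (taylor_coeff f n * z ^ n) \<le> cmod (taylor_coeff f n) * r ^ n" if "z \<in> cball 0 r" for n z
      using that by (auto simp: norm_mult norm_power intro!: mult_left_mono power_mono)
  qed
  moreover have "(\<Sum>n. taylor_coeff f n * z ^ n) = f z" if "z \<in> cball 0 r" for z
    using taylor_sums[OF f, of z] that r by (auto simp: sums_iff)
  then have "uniform_limit (cball 0 r) (\<lambda>N z. \<Sum>n<N. taylor_coeff f n * z ^ n) (\<lambda>z. \<Sum>n. taylor_coeff f n * z ^ n) sequentially
      \<longleftrightarrow> uniform_limit (cball 0 r) (\<lambda>N z. \<Sum>n<N. taylor_coeff f n * z ^ n) f sequentially"
    by (intro uniform_limit_cong') simp_all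
  ultimately show ?thesis by simp
qed

lemma poly_approx_cball:
  assumes f: "f holomorphic_on ball 0 1" and r: "0 \<le> r" "r < 1" and "e > 0"
  shows "\<exists>p. \<forall>z\<in>cball 0 r. cmod (f z - poly p z) < e"
proof -
  have "eventually (\<lambda>N. \<forall>z\<in>cball 0 r. dist (\<Sum>n<N. taylor_coeff f n * z ^ n) (f z) < e) sequentially"
    using taylor_uniform_limit[OF f r] \<open>e > 0\<close> by (rule uniform_limitD)
  then obtain N where N: "\<And>z. z \<in> cball 0 r \<Longrightarrow> dist (\<Sum>n<N. taylor_coeff f n * z ^ n) (f z) < e"
    unfolding eventually_sequentially by blast
  have "cmod (f z - poly (\<Sum>n<N. monom (taylor_coeff f n) n) z) < e" if "z \<in> cball 0 r" for z
    using N[OF that] by (simp add: poly_sum poly_monom dist_norm norm_minus_commute)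
  then show ?thesis by blast
qed

lemma root_avg_holomorphic_tendsto:
  assumes "f holomorphic_on ball 0 1" "cmod z < 1"
  shows "(\<lambda>n. root_avg n f z) \<longlonglongrightarrow> f 0"
  using assms by (intro root_avg_tendsto_value_at_0[where A = "cball 0 (cmod z)"] poly_approx_cball) (auto simp: norm_mult)

section \<open>Multiplication operators on the Hardy space\<close>

lemma taylor_coeff_add:
  assumes "f holomorphic_on ball 0 1" "g holomorphic_on ball 0 1"
  shows "taylor_coeff (f + g) n = taylor_coeff f n + taylor_coeff g n"
  using higher_deriv_add[OF assms open_ball, of 0 n]
  by (simp add: taylor_coeff_def plus_fun_def add_divide_distrib)

lemma taylor_coeff_scale:
  assumes "f holomorphic_on ball 0 1"
  shows "taylor_coeff (c *\<^sub>C f) n = c * taylor_coeff f n"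
  using higher_deriv_cmult[OF assms _ open_ball, of 0 n c]
  by (simp add: taylor_coeff_def scaleC_fun_def scaleC_complex_def)

lemma taylor_coeff_mult:
  assumes "f holomorphic_on ball 0 1" "g holomorphic_on ball 0 1"
  shows "taylor_coeff (\<lambda>z. f z * g z) n = (\<Sum>i\<le>n. taylor_coeff f i * taylor_coeff g (n - i))"
proof -
  have "(deriv ^^ n) (\<lambda>z. f z * g z) 0 / fact n
      = (\<Sum>i = 0..n. of_nat (n choose i) * (deriv ^^ i) f 0 * (deriv ^^ (n - i)) g 0) / fact n"
    using higher_deriv_mult[OF assms open_ball, of 0 n] by simp
  also have "\<dots> = (\<Sum>i = 0..n. ((deriv ^^ i) f 0 / fact i) * ((deriv ^^ (n - i)) g 0 / fact (n - i)))"
    unfolding sum_divide_distrib by (intro sum.cong) (auto simp: binomial_fact field_simps)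
  finally show ?thesis by (simp add: taylor_coeff_def atMost_atLeast0)
qed

lemma taylor_coeff_power: "taylor_coeff (\<lambda>z. z ^ k) n = (if n = k then 1 else 0)"
proof -
  have "(deriv ^^ n) (\<lambda>z. z ^ k) 0 = pochhammer (of_nat (Suc k - n)) n * 0 ^ (k - n)"
    using higher_deriv_power[of n 0 k 0] by simp
  moreover have "pochhammer (0::complex) n = 0" if "n > k" using that by (simp add: pochhammer_0_left)
  ultimately show ?thesis
    by (cases n k rule: linorder_cases) (auto simp: taylor_coeff_def pochhammer_fact[symmetric])
qed

lemma vectors_hardy2:
  "vectors hardy2 = {f. f holomorphic_on ball 0 1 \<and> summable (\<lambda>n. (cmod (taylor_coeff f n))\<^sup>2)}"
  by (simp add: hardy2_def)

lemma ip_hardy2: "ip hardy2 f g = (\<Sum>n. taylor_coeff f n * cnj (taylor_coeff g n))"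
  by (simp add: hardy2_def)

lemma summable_mult_cnj:
  assumes "summable (\<lambda>n. (cmod (a n))\<^sup>2)" "summable (\<lambda>n. (cmod (b n))\<^sup>2)"
  shows "summable (\<lambda>n. a n * cnj (b n))"
proof (rule summable_comparison_test')
  show "summable (\<lambda>n. (cmod (a n))\<^sup>2 + (cmod (b n))\<^sup>2)" using assms by (rule summable_add)
  show "cmod (a n * cnj (b n)) \<le> (cmod (a n))\<^sup>2 + (cmod (b n))\<^sup>2" for n
  proof -
    have "cmod (a n) * cmod (b n) \<le> (cmod (a n))\<^sup>2 + (cmod (b n))\<^sup>2"
      using sum_squares_bound[of "cmod (a n)" "cmod (b n)"] mult_nonneg_nonneg[of "cmod (a n)" "cmod (b n)"]
        norm_ge_zero[of "a n"] norm_ge_zero[of "b n"] by linarith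
    then show ?thesis by (simp add: norm_mult)
  qed
qed

lemma ip_hardy2_self:
  assumes "f \<in> vectors hardy2"
  shows "ip hardy2 f f = of_real (\<Sum>n. (cmod (taylor_coeff f n))\<^sup>2)"
proof -
  have "(\<lambda>n. complex_of_real ((cmod (taylor_coeff f n))\<^sup>2)) sums of_real (\<Sum>n. (cmod (taylor_coeff f n))\<^sup>2)"
    using assms by (intro sums_of_real summable_sums) (simp add: vectors_hardy2)
  then show ?thesis by (simp add: ip_hardy2 mult_cnj_norm sums_iff)
qed

text \<open>
  The map from a function to its Taylor coefficients is linear on holomorphic functions, so
  the laws are those of square summable sequences.
\<close>

lemma semi_inner_product_hardy2: "semi_inner_product hardy2"
proof
  fix x y z :: "complex \<Rightarrow> complex" and c :: complex
  show "0 \<in> vectors hardy2"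
  proof -
    have "taylor_coeff (\<lambda>z. 0) n = 0" for n by (simp add: taylor_coeff_def)
    then show ?thesis by (simp add: vectors_hardy2 zero_fun_def)
  qed
  show "x + y \<in> vectors hardy2" if x: "x \<in> vectors hardy2" and y: "y \<in> vectors hardy2"
  proof -
    have hol: "x holomorphic_on ball 0 1" "y holomorphic_on ball 0 1" using x y by (simp_all add: vectors_hardy2)
    have "summable (\<lambda>n. (cmod (taylor_coeff (x + y) n))\<^sup>2)"
    proof (rule summable_comparison_test')
      show "summable (\<lambda>n. 2 * (cmod (taylor_coeff x n))\<^sup>2 + 2 * (cmod (taylor_coeff y n))\<^sup>2)"
        using x y by (intro summable_add summable_mult) (simp_all add: vectors_hardy2)
      fix n
      have "(cmod (taylor_coeff x n + taylor_coeff y n))\<^sup>2 \<le> (cmod (taylor_coeff x n) + cmod (taylor_coeff y n))\<^sup>2"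
        by (intro power_mono norm_triangle_ineq) auto
      then show "norm ((cmod (taylor_coeff (x + y) n))\<^sup>2) \<le> 2 * (cmod (taylor_coeff x n))\<^sup>2 + 2 * (cmod (taylor_coeff y n))\<^sup>2"
        using sum_squares_bound[of "cmod (taylor_coeff x n)" "cmod (taylor_coeff y n)"]
        by (simp add: power2_sum taylor_coeff_add[OF hol])
    qed
    moreover have "(\<lambda>t. x t + y t) holomorphic_on ball 0 1" using hol by (rule holomorphic_on_add)
    ultimately show ?thesis by (simp add: vectors_hardy2 plus_fun_def)
  qed
  show "c *\<^sub>C x \<in> vectors hardy2" if x: "x \<in> vectors hardy2"
  proof -
    have hol: "x holomorphic_on ball 0 1" using x by (simp add: vectors_hardy2)
    then have "c *\<^sub>C x holomorphic_on ball 0 1"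
      unfolding scaleC_fun_def scaleC_complex_def by (intro holomorphic_intros)
    then show ?thesis
      using x by (simp add: vectors_hardy2 taylor_coeff_scale[OF hol] norm_mult power_mult_distrib summable_mult)
  qed
  show "ip hardy2 (x + y) z = ip hardy2 x z + ip hardy2 y z"
    if "x \<in> vectors hardy2" "y \<in> vectors hardy2" "z \<in> vectors hardy2"
    using that by (simp add: ip_hardy2 vectors_hardy2 taylor_coeff_add distrib_right suminf_add summable_mult_cnj)
  show "ip hardy2 (c *\<^sub>C x) z = c * ip hardy2 x z"
    if "x \<in> vectors hardy2" "z \<in> vectors hardy2"
    using that by (simp add: ip_hardy2 vectors_hardy2 taylor_coeff_scale mult.assoc suminf_mult summable_mult_cnj)
  show "cnj (ip hardy2 x z) = ip hardy2 z x" if "x \<in> vectors hardy2" "z \<in> vectors hardy2"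
  proof -
    have "(\<lambda>n. taylor_coeff x n * cnj (taylor_coeff z n)) sums ip hardy2 x z"
      unfolding ip_hardy2 using that by (intro summable_sums summable_mult_cnj) (simp_all add: vectors_hardy2)
    then have "(\<lambda>n. cnj (taylor_coeff x n * cnj (taylor_coeff z n))) sums cnj (ip hardy2 x z)"
      by (simp only: sums_cnj)
    then show ?thesis by (simp add: ip_hardy2[of z x] sums_iff mult.commute)
  qed
  show "0 \<le> Re (ip hardy2 x x)" if "x \<in> vectors hardy2"
    using that by (simp add: ip_hardy2_self[OF that] suminf_nonneg vectors_hardy2)
qed

lemma ip_norm_hardy2:
  "f \<in> vectors hardy2 \<Longrightarrow> ip_norm hardy2 f = sqrt (\<Sum>n. (cmod (taylor_coeff f n))\<^sup>2)"
  by (simp add: ip_norm_def ip_hardy2_self)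

text \<open>
  The discrete characters \<open>k \<mapsto> \<omega>\<^bsup>ki\<^esup>\<close> for \<open>i < n\<close> are orthogonal. Since \<open>cnj \<omega> = \<omega>\<^bsup>-1\<^esup>\<close> only the
  difference \<open>i - j\<close> matters, and the case \<open>i < j\<close> follows by conjugation.
\<close>

lemma sum_roots_of_unity_orthogonal:
  assumes "i < n" "j < n"
  shows "(\<Sum>k<n. cis (2 * pi * real k / real n) ^ i * cnj (cis (2 * pi * real k / real n)) ^ j) = (if i = j then of_nat n else 0)"
proof -
  let ?w = "\<lambda>k. cis (2 * pi * real k / real n)"
  have main: "(\<Sum>k<n. ?w k ^ i * cnj (?w k) ^ j) = (if i = j then of_nat n else 0)" if "j \<le> i" "i < n" for i j
  proof -
    have "?w k * cnj (?w k) = 1" for k by (simp add: cis_cnj cis_mult)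
    then have "?w k ^ i * cnj (?w k) ^ j = ?w k ^ (i - j)" for k
      using \<open>j \<le> i\<close> power_add[of "?w k" "i - j" j] by (simp add: mult.assoc flip: power_mult_distrib)
    then have "(\<Sum>k<n. ?w k ^ i * cnj (?w k) ^ j) = of_nat n * root_avg n (\<lambda>z. z ^ (i - j)) 1"
      using that by (simp add: root_avg_def)
    moreover have "n dvd i - j \<longleftrightarrow> i = j" using that by (auto dest: dvd_imp_le)
    ultimately show ?thesis using that by (simp add: root_avg_power)
  qed
  show ?thesis
  proof (cases "j \<le> i")
    case False
    have "(\<Sum>k<n. ?w k ^ i * cnj (?w k) ^ j) = cnj (\<Sum>k<n. ?w k ^ j * cnj (?w k) ^ i)"
      by (simp add: mult.commute)
    also have "\<dots> = 0" using main[of i j] False assms by simp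
    finally show ?thesis using False by simp
  qed (use main assms in auto)
qed

definition circle_mean_sq :: "nat \<Rightarrow> (complex \<Rightarrow> complex) \<Rightarrow> real \<Rightarrow> real" where
  "circle_mean_sq n f r = (\<Sum>k<n. (cmod (f (cis (2 * pi * real k / real n) * of_real r)))\<^sup>2) / real n"

text \<open>
  Parseval's identity for polynomials of degree less than \<open>n\<close>: expand the square of the modulus
  and use that the discrete characters are orthogonal.
\<close>

lemma circle_mean_sq_polynomial:
  assumes "0 < n"
  shows "circle_mean_sq n (\<lambda>z. \<Sum>j<n. a j * z ^ j) r = (\<Sum>j<n. (cmod (a j))\<^sup>2 * r ^ (2 * j))"
proof -
  let ?w = "\<lambda>k. cis (2 * pi * real k / real n)"
  have "complex_of_real ((cmod (\<Sum>j<n. a j * (?w k * of_real r) ^ j))\<^sup>2)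
      = (\<Sum>i<n. \<Sum>j<n. a i * cnj (a j) * of_real (r ^ i * r ^ j) * (?w k ^ i * cnj (?w k) ^ j))" for k
    unfolding of_real_power mult_cnj_norm(1)[symmetric] cnj_sum sum_product
    by (intro sum.cong) (simp_all add: power_mult_distrib mult_ac)
  then have "complex_of_real (circle_mean_sq n (\<lambda>z. \<Sum>j<n. a j * z ^ j) r) * of_nat n
      = (\<Sum>k<n. \<Sum>i<n. \<Sum>j<n. a i * cnj (a j) * of_real (r ^ i * r ^ j) * (?w k ^ i * cnj (?w k) ^ j))"
    using assms by (simp add: circle_mean_sq_def)
  also have "\<dots> = (\<Sum>i<n. \<Sum>j<n. a i * cnj (a j) * of_real (r ^ i * r ^ j) * (\<Sum>k<n. ?w k ^ i * cnj (?w k) ^ j))"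
    unfolding sum_distrib_left by (subst sum.swap, rule sum.cong[OF refl], rule sum.swap)
  also have "\<dots> = (\<Sum>i<n. \<Sum>j<n. if i = j then of_nat n * (a i * cnj (a i) * of_real (r ^ i * r ^ i)) else 0)"
    by (intro sum.cong refl) (simp only: lessThan_iff sum_roots_of_unity_orthogonal, simp add: mult_ac)
  also have "\<dots> = of_nat n * (\<Sum>i<n. a i * cnj (a i) * of_real (r ^ i * r ^ i))"
    by (simp add: sum_distrib_left)
  also have "(\<Sum>i<n. a i * cnj (a i) * of_real (r ^ i * r ^ i)) = of_real (\<Sum>j<n. (cmod (a j))\<^sup>2 * r ^ (2 * j))"
    by (simp add: mult_cnj_norm mult_2 power_add)
  finally have "complex_of_real (circle_mean_sq n (\<lambda>z. \<Sum>j<n. a j * z ^ j) r) = of_real (\<Sum>j<n. (cmod (a j))\<^sup>2 * r ^ (2 * j))"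
    using assms by (simp add: mult.commute)
  then show ?thesis by (simp only: of_real_eq_iff)
qed

text \<open>
  On a circle of radius \<open>r < 1\<close> the Taylor polynomials converge uniformly, and so do the squares
  of their moduli. The degree of the polynomial and the number of nodes grow together, which
  keeps the identity for polynomials exact.
\<close>

lemma circle_mean_sq_taylor:
  assumes f: "f holomorphic_on ball 0 1" and r: "0 \<le> r" "r < 1"
  shows "(\<lambda>n. circle_mean_sq n f r - (\<Sum>j<n. (cmod (taylor_coeff f j))\<^sup>2 * r ^ (2 * j))) \<longlonglongrightarrow> 0"
proof (rule LIMSEQ_I)
  fix e :: real assume "e > 0"
  have "bounded (f ` cball 0 r)"
    using r by (intro compact_imp_bounded compact_continuous_image
        holomorphic_on_imp_continuous_on[OF holomorphic_on_subset[OF f]]) auto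
  then obtain K where K: "K > 0" "\<And>z. z \<in> cball 0 r \<Longrightarrow> cmod (f z) \<le> K"
    unfolding bounded_pos by blast
  \<comment> \<open>The difference of squares is at most \<open>d\<close> times the sum of the moduli, which is at most \<open>2 K + 1\<close>.\<close>
  define d where "d = min 1 (e / (2 * (2 * K + 1)))"
  have "2 * (2 * K + 1) > 0" using K by simp
  then have d: "d > 0" "d \<le> 1" "d \<le> e / (2 * (2 * K + 1))"
    using \<open>e > 0\<close> by (simp_all add: d_def)
  then have "d * (2 * (2 * K + 1)) \<le> e"
    using \<open>2 * (2 * K + 1) > 0\<close> by (simp only: pos_le_divide_eq)
  then have d_small: "d * (2 * K + 1) < e" using \<open>e > 0\<close> by linarith
  let ?p = "\<lambda>n z. \<Sum>j<n. taylor_coeff f j * z ^ j"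
  have "eventually (\<lambda>n. \<forall>z\<in>cball 0 r. dist (?p n z) (f z) < d) sequentially"
    using taylor_uniform_limit[OF f r] d(1) by (rule uniform_limitD)
  then obtain N where N: "\<And>n z. n \<ge> N \<Longrightarrow> z \<in> cball 0 r \<Longrightarrow> cmod (?p n z - f z) < d"
    unfolding eventually_sequentially dist_norm by blast
  show "\<exists>N. \<forall>n\<ge>N. norm (circle_mean_sq n f r - (\<Sum>j<n. (cmod (taylor_coeff f j))\<^sup>2 * r ^ (2 * j)) - 0) < e"
  proof (intro exI[of _ "Suc N"] allI impI)
    fix n assume n: "Suc N \<le> n"
    let ?z = "\<lambda>k. cis (2 * pi * real k / real n) * of_real r"
    have z: "?z k \<in> cball 0 r" for k using r by (simp add: norm_mult)
    have diff: "\<bar>(cmod (f (?z k)))\<^sup>2 - (cmod (?p n (?z k)))\<^sup>2\<bar> \<le> d * (2 * K + 1)" for k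
    proof -
      have pf: "cmod (?p n (?z k) - f (?z k)) < d" using N[OF _ z] n by simp
      have "\<bar>cmod (f (?z k)) - cmod (?p n (?z k))\<bar> \<le> d"
        using pf norm_triangle_ineq3[of "?p n (?z k)" "f (?z k)"] by linarith
      moreover have "cmod (f (?z k)) + cmod (?p n (?z k)) \<le> 2 * K + 1"
        using K(2)[OF z, of k] d(2) calculation by linarith
      ultimately have "\<bar>cmod (f (?z k)) - cmod (?p n (?z k))\<bar> * (cmod (f (?z k)) + cmod (?p n (?z k))) \<le> d * (2 * K + 1)"
        using d(1) by (intro mult_mono) auto
      moreover have "(cmod (f (?z k)))\<^sup>2 - (cmod (?p n (?z k)))\<^sup>2
          = (cmod (f (?z k)) - cmod (?p n (?z k))) * (cmod (f (?z k)) + cmod (?p n (?z k)))"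
        by (simp add: power2_eq_square algebra_simps)
      ultimately show ?thesis by (simp add: abs_mult)
    qed
    have "circle_mean_sq n f r - circle_mean_sq n (?p n) r
        = (\<Sum>k<n. (cmod (f (?z k)))\<^sup>2 - (cmod (?p n (?z k)))\<^sup>2) / real n"
      by (simp add: circle_mean_sq_def sum_subtractf diff_divide_distrib)
    moreover have "\<bar>\<Sum>k<n. (cmod (f (?z k)))\<^sup>2 - (cmod (?p n (?z k)))\<^sup>2\<bar> \<le> (\<Sum>k<n. d * (2 * K + 1))"
      by (rule order_trans[OF sum_abs sum_mono[OF diff]])
    ultimately have "\<bar>circle_mean_sq n f r - circle_mean_sq n (?p n) r\<bar> \<le> d * (2 * K + 1)"
      using n by (simp add: divide_le_eq mult.commute)
    then show "norm (circle_mean_sq n f r - (\<Sum>j<n. (cmod (taylor_coeff f j))\<^sup>2 * r ^ (2 * j)) - 0) < e"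
      using d_small circle_mean_sq_polynomial[of n "taylor_coeff f" r] n by simp
  qed
qed

text \<open>
  Multiplication by \<open>f\<close> is bounded by \<open>B\<close> for the discrete means of squares on each circle,
  trivially. In the limit of many nodes these means become the weighted sums of squared
  coefficients, and then the radius can be sent to one in every partial sum.
\<close>

lemma hardy2_mult:
  assumes f: "f holomorphic_on ball 0 1" and bound: "\<And>z. z \<in> ball 0 1 \<Longrightarrow> cmod (f z) \<le> B"
    and g: "g \<in> vectors hardy2"
  shows "mult_op f g \<in> vectors hardy2" and "ip_norm hardy2 (mult_op f g) \<le> B * ip_norm hardy2 g"
proof -
  have ghol: "g holomorphic_on ball 0 1" and gsum: "summable (\<lambda>n. (cmod (taylor_coeff g n))\<^sup>2)"
    using g by (simp_all add: vectors_hardy2)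
  define h where "h = mult_op f g"
  have hhol: "h holomorphic_on ball 0 1"
    unfolding h_def mult_op_def using f ghol by (rule holomorphic_on_mult)
  have B: "0 \<le> B" using bound[of 0] by (auto intro: order_trans[OF norm_ge_zero])
  define G where "G = (\<Sum>n. (cmod (taylor_coeff g n))\<^sup>2)"
  let ?S = "\<lambda>f n r. \<Sum>j<n. (cmod (taylor_coeff f j))\<^sup>2 * r ^ (2 * j)"
  have inside: "?S h m r \<le> B\<^sup>2 * G" if r: "0 \<le> r" "r < 1" for m and r :: real
  proof (rule LIMSEQ_le_const)
    \<comment> \<open>Both differences tend to zero by Parseval in the limit.\<close>
    show "(\<lambda>n. B\<^sup>2 * (circle_mean_sq n g r - ?S g n r) - (circle_mean_sq n h r - ?S h n r) + B\<^sup>2 * G) \<longlonglongrightarrow> B\<^sup>2 * G"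
      using tendsto_add[OF tendsto_diff[OF tendsto_mult_left[OF circle_mean_sq_taylor[OF ghol r], of "B\<^sup>2"]
            circle_mean_sq_taylor[OF hhol r]] tendsto_const, of "B\<^sup>2 * G"] by simp
    have "?S h m r \<le> B\<^sup>2 * (circle_mean_sq n g r - ?S g n r) - (circle_mean_sq n h r - ?S h n r) + B\<^sup>2 * G"
      if "m \<le> n" for n
    proof -
      have "?S h m r \<le> ?S h n r" using that r by (intro sum_mono2) auto
      moreover have "circle_mean_sq n h r \<le> B\<^sup>2 * circle_mean_sq n g r"
      proof -
        have "(cmod (h (cis t * of_real r)))\<^sup>2 \<le> B\<^sup>2 * (cmod (g (cis t * of_real r)))\<^sup>2" for t
          using bound[of "cis t * of_real r"] r B
          by (auto simp: h_def mult_op_def norm_mult power_mult_distrib intro!: mult_right_mono power_mono)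
        then show ?thesis
          unfolding circle_mean_sq_def by (simp add: sum_distrib_left sum_mono divide_right_mono)
      qed
      moreover have "?S g n r \<le> G"
      proof -
        have "?S g n r \<le> (\<Sum>j<n. (cmod (taylor_coeff g j))\<^sup>2)"
          using r by (intro sum_mono) (simp add: mult_left_le power_le_one)
        also have "\<dots> \<le> G" unfolding G_def using gsum by (intro sum_le_suminf) auto
        finally show ?thesis .
      qed
      then have "B\<^sup>2 * ?S g n r \<le> B\<^sup>2 * G" by (intro mult_left_mono) auto
      ultimately show ?thesis by (simp add: right_diff_distrib)
    qed
    then show "\<exists>N. \<forall>n\<ge>N. ?S h m r \<le> B\<^sup>2 * (circle_mean_sq n g r - ?S g n r) - (circle_mean_sq n h r - ?S h n r) + B\<^sup>2 * G"
      by blast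
  qed
  have partial: "(\<Sum>j<m. (cmod (taylor_coeff h j))\<^sup>2) \<le> B\<^sup>2 * G" for m
  proof (rule tendsto_upperbound)
    show "((\<lambda>r. ?S h m r) \<longlongrightarrow> (\<Sum>j<m. (cmod (taylor_coeff h j))\<^sup>2)) (at_left 1)"
      by (auto intro!: tendsto_eq_intros)
    have "eventually (\<lambda>r :: real. r \<in> {0<..<1}) (at_left 1)" by (rule eventually_at_leftI[of 0]) auto
    then show "eventually (\<lambda>r. ?S h m r \<le> B\<^sup>2 * G) (at_left 1)"
      by (rule eventually_mono) (auto intro: inside)
  qed simp
  have hsum: "summable (\<lambda>n. (cmod (taylor_coeff h n))\<^sup>2)"
    by (rule summableI_nonneg_bounded[of _ "B\<^sup>2 * G"]) (use partial in auto)
  then show V: "mult_op f g \<in> vectors hardy2" using hhol by (simp add: vectors_hardy2 h_def)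
  have "(\<Sum>n. (cmod (taylor_coeff h n))\<^sup>2) \<le> B\<^sup>2 * G"
    using hsum partial by (rule suminf_le_const)
  then have "sqrt (\<Sum>n. (cmod (taylor_coeff h n))\<^sup>2) \<le> sqrt (B\<^sup>2 * G)" by simp
  then show "ip_norm hardy2 (mult_op f g) \<le> B * ip_norm hardy2 g"
    using B V g by (simp add: ip_norm_hardy2 G_def h_def real_sqrt_mult)
qed

text \<open>
  The coefficient of \<open>z\<^sup>n\<close> in \<open>f z\<^sup>n\<close> is \<open>f 0\<close>, whatever \<open>n\<close> is, so the vector states of the monomials
  are constant on multiplication operators.
\<close>

lemma not_gleason_whitney_mult_ops_hardy2:
  "\<not> gleason_whitney (bounded_operators hardy2) (mult_op ` Hinf_disc) (elements (bounded_operators hardy2))"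
proof -
  interpret semi_inner_product hardy2 by (rule semi_inner_product_hardy2)
  define e where "e n = (\<lambda>z :: complex. z ^ n)" for n
  have coeff: "taylor_coeff (e n) m = (if m = n then 1 else 0)" for n m
    by (simp add: e_def taylor_coeff_power)
  have ehol: "e n holomorphic_on ball 0 1" for n unfolding e_def by (intro holomorphic_intros)
  have e: "e n \<in> vectors hardy2" for n
  proof -
    have "summable (\<lambda>m. (cmod (taylor_coeff (e n) m))\<^sup>2)"
      by (rule summable_finite[of "{n}"]) (auto simp: coeff)
    then show ?thesis using ehol by (simp add: vectors_hardy2)
  qed
  have ip_e: "ip hardy2 f (e n) = taylor_coeff f n" for f n
  proof -
    have "ip hardy2 f (e n) = (\<Sum>m\<in>{n}. taylor_coeff f m * cnj (taylor_coeff (e n) m))"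
      unfolding ip_hardy2 by (intro suminf_finite) (auto simp: coeff)
    then show ?thesis by (simp add: coeff)
  qed
  show ?thesis
  proof (rule not_gleason_whitney_bounded_operators[where e = e and v = "e 0"])
    show "mult_op ` Hinf_disc \<subseteq> elements (bounded_operators hardy2)"
    proof safe
      fix f assume "f \<in> Hinf_disc"
      then have f: "f holomorphic_on ball 0 1" and "\<exists>B. \<forall>z\<in>ball 0 1. cmod (f z) \<le> B"
        by (simp_all add: Hinf_disc_def bounded_iff)
      then obtain B where "\<And>z. z \<in> ball 0 1 \<Longrightarrow> cmod (f z) \<le> B" by blast
      from hardy2_mult[OF f this] show "mult_op f \<in> elements (bounded_operators hardy2)"
        using mult_op_clinear[of "vectors hardy2" f]
        unfolding bounded_operators_def dual_space.simps by blast
    qed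
    show "(\<lambda>x. x) \<in> mult_op ` Hinf_disc"
      by (subst mult_op_one[symmetric]) (intro imageI, auto simp: Hinf_disc_def bounded_iff)
    show "orthonormal_on UNIV e" using e by (auto simp: orthonormal_on_def ip_e coeff)
    show "e 0 \<in> vectors hardy2" by (rule e)
    fix T assume "T \<in> mult_op ` Hinf_disc"
    then obtain f where f: "f holomorphic_on ball 0 1" and T: "T = mult_op f" by (auto simp: Hinf_disc_def)
    have "ip hardy2 (T (e n)) (e n) = taylor_coeff f 0" for n
    proof -
      have "ip hardy2 (T (e n)) (e n) = (\<Sum>i\<le>n. taylor_coeff f i * taylor_coeff (e n) (n - i))"
        unfolding ip_e T mult_op_def using f ehol by (rule taylor_coeff_mult)
      also have "\<dots> = (\<Sum>i\<le>n. if i = 0 then taylor_coeff f i else 0)"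
        by (intro sum.cong) (auto simp: coeff)
      finally show ?thesis by simp
    qed
    then show "(\<lambda>n. ip hardy2 (T (e n)) (e n)) \<longlonglongrightarrow> ip hardy2 (T (e 0)) (e 0)" by simp
  qed
qed

section \<open>Rotation invariant means of holomorphic functions\<close>

text \<open>
  The mean value property over an invariant set \<open>W\<close>, for functions that are only known to be
  boundary values \<open>g\<close> of \<open>f\<close>. Inside the domain, invariance allows the integrand to be replaced by
  its average over the \<open>n\<close>-th roots of unity, which tends to \<open>f 0\<close> on every complex line through
  the origin; then the radius is sent to one. The set \<open>S\<close> carries the measure and is there
  because \<open>f\<close> may be arbitrary outside its domain.
\<close>

lemma integral_rotation_invariant_set:
  fixes M :: "'a::real_normed_vector measure" and rot :: "complex \<Rightarrow> 'a \<Rightarrow> 'a"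
    and f g :: "'a \<Rightarrow> complex"
  assumes fin: "finite_measure M" and borel: "(\<lambda>z. z) \<in> M \<rightarrow>\<^sub>M borel"
    and inv: "\<And>c F. cmod c = 1 \<Longrightarrow> F \<in> borel_measurable borel \<Longrightarrow> (\<integral>z. F (rot c z) \<partial>M) = (\<integral>z. F z \<partial>M :: complex)"
    and rot_meas: "\<And>c. cmod c = 1 \<Longrightarrow> rot c \<in> borel \<rightarrow>\<^sub>M borel"
    and rot: "\<And>c r z. rot c (r *\<^sub>R z) = rot (c * of_real r) z"
    and S: "S \<in> sets borel" "AE z in M. z \<in> S" "\<And>c z. cmod c = 1 \<Longrightarrow> rot c z \<in> S \<longleftrightarrow> z \<in> S"
    and W: "W \<in> sets borel" "\<And>c z. cmod c = 1 \<Longrightarrow> rot c z \<in> W \<longleftrightarrow> z \<in> W"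
    and cont: "\<And>r. 0 < r \<Longrightarrow> r < 1 \<Longrightarrow> continuous_on S (\<lambda>z. f (r *\<^sub>R z))"
    and slice: "\<And>z. z \<in> S \<Longrightarrow> (\<lambda>c. f (rot c z)) holomorphic_on ball 0 1"
    and rot_real: "\<And>r z. rot (of_real r) z = r *\<^sub>R z"
    and rot_rot: "\<And>c d z. rot c (rot d z) = rot (c * d) z"
    and bound: "\<And>r z. 0 < r \<Longrightarrow> r < 1 \<Longrightarrow> z \<in> S \<Longrightarrow> cmod (f (r *\<^sub>R z)) \<le> B"
    and g: "g \<in> borel_measurable M" "AE z in M. ((\<lambda>r. f (r *\<^sub>R z)) \<longlongrightarrow> g z) (at_left 1)"
  shows "(\<integral>z. indicator W z * g z \<partial>M) = f 0 * measure M (W \<inter> space M)"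
proof -
  interpret finite_measure M by fact
  have indW: "indicator W (rot c z) = (indicator W z :: complex)" if "cmod c = 1" for c z
    using W(2)[OF that] by (simp add: indicator_def)
  have setsM: "A \<inter> space M \<in> sets M" if "A \<in> sets borel" for A
    using measurable_sets[OF borel that] by (simp add: Int_def vimage_def)
  have indW_meas: "(\<lambda>z. indicator W z :: complex) \<in> borel_measurable M"
    using measurable_compose[OF borel borel_measurable_indicator[OF W(1)]] .
  have radius: "(\<integral>z. indicator W z * (if z \<in> S then f (r *\<^sub>R z) else 0) \<partial>M) = f 0 * measure M (W \<inter> space M)"
    if r: "0 < r" "r < 1" for r
  proof -
    define F where "F z = indicator W z * (if z \<in> S then f (r *\<^sub>R z) else 0)" for z
    have F: "F \<in> borel_measurable borel"
      unfolding F_def using W(1) S(1) cont[OF r] by (intro borel_measurable_times borel_measurable_continuous_on_if) auto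
    have FM: "F \<in> borel_measurable M" using measurable_compose[OF borel F] .
    have F_bound: "cmod (F z) \<le> \<bar>B\<bar>" for z
      using bound[OF r, of z] by (auto simp: F_def indicator_def)
    have Frot: "(\<lambda>z. F (rot c z)) \<in> borel_measurable M" if "cmod c = 1" for c
      using measurable_compose[OF borel measurable_compose[OF rot_meas[OF that] F]] .
    have Fint: "integrable M (\<lambda>z. F (rot c z))" if "cmod c = 1" for c
      using Frot[OF that] F_bound by (intro integrable_const_bound[where B = "\<bar>B\<bar>"]) auto
    have avg: "(\<integral>z. (\<Sum>k<n. F (rot (cis (2 * pi * real k / real n)) z)) / n \<partial>M) = (\<integral>z. F z \<partial>M)" if "n > 0" for n :: nat
    proof -
      have "(\<integral>z. (\<Sum>k<n. F (rot (cis (2 * pi * real k / real n)) z)) / n \<partial>M)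
          = (\<Sum>k<n. \<integral>z. F (rot (cis (2 * pi * real k / real n)) z) \<partial>M) / n"
        using Fint by (simp add: Bochner_Integration.integral_sum)
      also have "\<dots> = (\<Sum>k<n. \<integral>z. F z \<partial>M) / n"
        using inv[OF _ F] by simp
      finally show ?thesis using that by simp
    qed
    have "(\<lambda>n. \<integral>z. (\<Sum>k<n. F (rot (cis (2 * pi * real k / real n)) z)) / n \<partial>M) \<longlonglongrightarrow> (\<integral>z. indicator W z * f 0 \<partial>M)"
    proof (rule integral_dominated_convergence[where w = "\<lambda>_. \<bar>B\<bar>"])
      show "(\<lambda>z. indicator W z * f 0) \<in> borel_measurable M"
        by (intro borel_measurable_times indW_meas) simp
      show "(\<lambda>z. (\<Sum>k<n. F (rot (cis (2 * pi * real k / real n)) z)) / n) \<in> borel_measurable M" for n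
        using Frot by (intro borel_measurable_divide borel_measurable_sum) auto
      show "AE z in M. cmod ((\<Sum>k<n. F (rot (cis (2 * pi * real k / real n)) z)) / n) \<le> \<bar>B\<bar>" for n
      proof (rule AE_I2)
        fix z
        have "cmod (\<Sum>k<n. F (rot (cis (2 * pi * real k / real n)) z)) \<le> (\<Sum>k<n. \<bar>B\<bar>)"
          using F_bound by (intro sum_norm_le)
        then show "cmod ((\<Sum>k<n. F (rot (cis (2 * pi * real k / real n)) z)) / n) \<le> \<bar>B\<bar>"
          by (cases "n = 0") (simp_all add: norm_divide divide_le_eq mult.commute)
      qed
      show "AE z in M. (\<lambda>n. (\<Sum>k<n. F (rot (cis (2 * pi * real k / real n)) z)) / n) \<longlonglongrightarrow> indicator W z * f 0"
        using S(2)
      proof eventually_elim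
        case (elim z)
        have rotr: "r *\<^sub>R rot c z = rot (c * of_real r) z" for c
          by (metis mult.commute rot_real rot_rot)
        have "(\<Sum>k<n. F (rot (cis (2 * pi * real k / real n)) z)) / n = indicator W z * root_avg n (\<lambda>c. f (rot c z)) (of_real r)" for n
          using elim S(3) by (simp add: F_def indW rotr root_avg_def sum_distrib_left)
        moreover have "(\<lambda>n. root_avg n (\<lambda>c. f (rot c z)) (of_real r)) \<longlonglongrightarrow> f (rot 0 z)"
          using slice[OF elim] r by (intro root_avg_holomorphic_tendsto) auto
        moreover have "rot 0 z = 0" using rot_real[of 0 z] by simp
        ultimately show ?case by (auto intro: tendsto_mult_left)
      qed
    qed auto
    moreover have "(\<lambda>n. \<integral>z. (\<Sum>k<n. F (rot (cis (2 * pi * real k / real n)) z)) / n \<partial>M) \<longlonglongrightarrow> (\<integral>z. F z \<partial>M)"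
      by (rule tendsto_eventually, rule eventually_sequentiallyI[of 1]) (use avg in auto)
    ultimately have "(\<integral>z. F z \<partial>M) = (\<integral>z. indicator W z * f 0 \<partial>M)" by (rule LIMSEQ_unique[symmetric])
    also have "\<dots> = f 0 * (\<integral>z. complex_of_real (indicator W z) \<partial>M)" by (simp add: of_real_indicator mult.commute)
    also have "\<dots> = f 0 * measure M (W \<inter> space M)" by (simp only: integral_complex_of_real) simp
    finally show ?thesis by (simp add: F_def)
  qed
  have "(\<lambda>m. \<integral>z. indicator W z * (if z \<in> S then f ((1 - 1 / Suc (Suc m)) *\<^sub>R z) else 0) \<partial>M)
      \<longlonglongrightarrow> (\<integral>z. indicator W z * g z \<partial>M)"
  proof (rule integral_dominated_convergence[where w = "\<lambda>_. \<bar>B\<bar>"])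
    show "(\<lambda>z. indicator W z * g z) \<in> borel_measurable M"
      by (intro borel_measurable_times indW_meas g(1))
    show "(\<lambda>z. indicator W z * (if z \<in> S then f ((1 - 1 / Suc (Suc m)) *\<^sub>R z) else 0)) \<in> borel_measurable M" for m
      using W(1) S(1) cont[of "1 - 1 / Suc (Suc m)"]
      by (intro measurable_compose[OF borel] borel_measurable_times borel_measurable_continuous_on_if) auto
    show "AE z in M. cmod (indicator W z * (if z \<in> S then f ((1 - 1 / Suc (Suc m)) *\<^sub>R z) else 0)) \<le> \<bar>B\<bar>" for m
      using bound[of "1 - 1 / Suc (Suc m)"] by (auto simp: indicator_def intro!: AE_I2 order_trans[OF _ abs_ge_self])
    show "AE z in M. (\<lambda>m. indicator W z * (if z \<in> S then f ((1 - 1 / Suc (Suc m)) *\<^sub>R z) else 0))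
        \<longlonglongrightarrow> indicator W z * g z"
      using S(2) g(2)
    proof eventually_elim
      case (elim z)
      have "filterlim (\<lambda>m. 1 - 1 / real (Suc (Suc m))) (at_left 1) sequentially"
      proof (rule filterlim_at_withinI)
        show "(\<lambda>m. 1 - 1 / real (Suc (Suc m))) \<longlonglongrightarrow> 1"
          using tendsto_diff[OF tendsto_const LIMSEQ_Suc[OF lim_inverse_n'[THEN LIMSEQ_Suc]], of 1] by (simp add: divide_inverse)
      qed auto
      then have "(\<lambda>m. f ((1 - 1 / real (Suc (Suc m))) *\<^sub>R z)) \<longlonglongrightarrow> g z"
        using elim(2) by (rule filterlim_compose[rotated])
      then show ?case using elim(1) by (auto intro: tendsto_mult_left)
    qed
  qed auto
  moreover have "(\<integral>z. indicator W z * (if z \<in> S then f ((1 - 1 / Suc (Suc m)) *\<^sub>R z) else 0) \<partial>M)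
      = f 0 * measure M (W \<inter> space M)" for m
    by (rule radius) auto
  ultimately show ?thesis by (simp add: LIMSEQ_const_iff)
qed

section \<open>Isometry invariance of Lebesgue measure and the disc\<close>

text \<open>
  The uniqueness argument for Haar measure. With \<open>B\<close> the unit ball, the double integral of
  \<open>1\<^sub>A(R x) 1\<^sub>B(y - R x)\<close> is \<open>|B| |R\<^sup>-\<^sup>1 A|\<close> if the integral over \<open>y\<close> is taken first. If the
  integral over \<open>x\<close> is taken first, a translation by \<open>z\<close> with \<open>R z = y\<close> turns the integrand into
  \<open>1\<^sub>A(R x + y) 1\<^sub>B(x)\<close>, as \<open>B\<close> is symmetric and \<open>R\<close> preserves it, and the value is \<open>|B| |A|\<close>.
\<close>

lemma lborel_distr_isometry:
  fixes R :: "'a::euclidean_space \<Rightarrow> 'a"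
  assumes lin: "linear R" and norm: "\<And>x. norm (R x) = norm x" and surj: "surj R"
  shows "distr lborel borel R = lborel"
proof (rule measure_eqI)
  have cont: "continuous_on UNIV R" using lin by (intro linear_continuous_on) (simp add: linear_conv_bounded_linear)
  have R[measurable]: "R \<in> borel \<rightarrow>\<^sub>M borel" using cont by (rule borel_measurable_continuous_onI)
  have transl: "(\<integral>\<^sup>+x. f (c + x) \<partial>lborel) = (\<integral>\<^sup>+x. f x \<partial>lborel)"
    if [measurable]: "f \<in> borel_measurable borel" for f :: "'a \<Rightarrow> ennreal" and c
    by (subst (2) lborel_distr_plus[of c, symmetric]) (simp add: nn_integral_distr)
  fix A assume "A \<in> sets (distr lborel borel R)"
  then have A[measurable]: "A \<in> sets borel" by simp
  define B where "B = ball (0::'a) 1"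
  have B[measurable]: "B \<in> sets borel" by (simp add: B_def)
  have inner: "(\<integral>\<^sup>+y. indicator B (y - R x) \<partial>lborel) = emeasure lborel B" for x
    using transl[of "indicator B" "- R x"] by simp
  have swap: "(\<integral>\<^sup>+x. indicator A (R x) * indicator B (y - R x) \<partial>lborel)
      = (\<integral>\<^sup>+x. indicator A (R x + y) * indicator B x \<partial>lborel)" for y
  proof -
    obtain z where z: "R z = y" using surj by (metis surjD)
    have "(\<integral>\<^sup>+x. indicator A (R x) * indicator B (y - R x) \<partial>lborel)
      = (\<integral>\<^sup>+x. indicator A (R (z + x)) * indicator B (y - R (z + x)) \<partial>lborel)"
      by (rule transl[symmetric]) measurable
    also have "\<dots> = (\<integral>\<^sup>+x. indicator A (R x + y) * indicator B x \<partial>lborel)"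
      by (intro nn_integral_cong) (simp add: linear_add[OF lin] z B_def indicator_def norm add.commute)
    finally show ?thesis .
  qed
  have "emeasure lborel B * emeasure lborel (R -` A) = (\<integral>\<^sup>+x. indicator A (R x) * emeasure lborel B \<partial>lborel)"
  proof -
    have "(\<integral>\<^sup>+x. indicator A (R x) * emeasure lborel B \<partial>lborel) = (\<integral>\<^sup>+x. emeasure lborel B * indicator (R -` A) x \<partial>lborel)"
      by (intro nn_integral_cong) (simp add: indicator_def)
    also have "R -` A \<in> sets lborel" using measurable_sets[OF R A] by simp
    then have "(\<integral>\<^sup>+x. emeasure lborel B * indicator (R -` A) x \<partial>lborel) = emeasure lborel B * emeasure lborel (R -` A)"
      by (rule nn_integral_cmult_indicator)
    finally show ?thesis ..
  qed
  also have "\<dots> = (\<integral>\<^sup>+x. \<integral>\<^sup>+y. indicator A (R x) * indicator B (y - R x) \<partial>lborel \<partial>lborel)"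
    by (intro nn_integral_cong) (simp add: nn_integral_cmult inner)
  also have "\<dots> = (\<integral>\<^sup>+y. \<integral>\<^sup>+x. indicator A (R x) * indicator B (y - R x) \<partial>lborel \<partial>lborel)"
    by (rule lborel_pair.Fubini'[symmetric]) measurable
  also have "\<dots> = (\<integral>\<^sup>+y. \<integral>\<^sup>+x. indicator A (R x + y) * indicator B x \<partial>lborel \<partial>lborel)"
    by (simp add: swap)
  also have "\<dots> = (\<integral>\<^sup>+x. \<integral>\<^sup>+y. indicator A (R x + y) * indicator B x \<partial>lborel \<partial>lborel)"
    by (rule lborel_pair.Fubini') measurable
  also have "\<dots> = (\<integral>\<^sup>+x. emeasure lborel A * indicator B x \<partial>lborel)"
  proof (intro nn_integral_cong)
    fix x
    have "(\<integral>\<^sup>+y. indicator A (R x + y) \<partial>lborel) = emeasure lborel A"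
      using transl[of "indicator A" "R x"] by simp
    then show "(\<integral>\<^sup>+y. indicator A (R x + y) * indicator B x \<partial>lborel) = emeasure lborel A * indicator B x"
      by (simp add: nn_integral_multc)
  qed
  also have "\<dots> = emeasure lborel B * emeasure lborel A"
    by (subst nn_integral_cmult_indicator) (simp_all add: mult.commute)
  finally have "emeasure lborel B * emeasure lborel (R -` A) = emeasure lborel B * emeasure lborel A" .
  moreover have "emeasure lborel B \<noteq> \<infinity>" "emeasure lborel B \<noteq> 0"
    using emeasure_lborel_ball_finite[of "0::'a" 1] content_ball_pos[of 1 "0::'a"]
    by (auto simp: B_def measure_def)
  ultimately have "emeasure lborel (R -` A) = emeasure lborel A"
    by (simp add: ennreal_mult_cancel_left)
  then show "emeasure (distr lborel borel R) A = emeasure lborel A"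
    by (simp add: emeasure_distr)
qed simp

text \<open>
  Balls around the origin are invariant under rotations and shrink to a point.
\<close>

lemma not_gleason_whitney_Hinf_disc_Linf_disc:
  "\<not> gleason_whitney (Linf (lebesgue_on (ball 0 1))) Hinf_disc (elements (Linf (lebesgue_on (ball 0 1))))"
proof -
  let ?M = "lebesgue_on (ball (0::complex) 1)"
  have fin: "finite_measure ?M"
    using emeasure_lborel_ball_finite[of "0 :: complex" 1]
    by (intro finite_measureI) (simp add: emeasure_restrict_space less_top)
  have meas: "A \<in> sets ?M" "measure ?M A = measure lborel A" if "A \<in> sets borel" "A \<subseteq> ball 0 1" for A
    using that by (auto simp: sets_restrict_space_iff measure_restrict_space)
  have id: "(\<lambda>z. z) \<in> ?M \<rightarrow>\<^sub>M borel"
    by (intro measurable_restrict_space1 measurable_completion) simp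
  have inv: "(\<integral>z. F (c * z) \<partial>?M) = (\<integral>z. F z \<partial>?M)" if c: "cmod c = 1" and F[measurable]: "F \<in> borel_measurable borel"
    for c and F :: "complex \<Rightarrow> complex"
  proof -
    have conv: "(\<integral>z. G z \<partial>?M) = (\<integral>z. indicator (ball 0 1) z *\<^sub>R G z \<partial>lborel)"
      if G: "G \<in> borel_measurable borel" for G :: "complex \<Rightarrow> complex"
    proof -
      have "(\<lambda>z. indicat_real (ball 0 1) z *\<^sub>R G z) \<in> borel_measurable lborel"
        using G by (intro borel_measurable_scaleR borel_measurable_indicator) auto
      then have "(\<integral>z. indicator (ball 0 1) z *\<^sub>R G z \<partial>lebesgue) = (\<integral>z. indicator (ball 0 1) z *\<^sub>R G z \<partial>lborel)"
        by (rule integral_completion)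
      then show ?thesis by (subst integral_restrict_space) auto
    qed
    have "distr lborel borel ((*) c) = (lborel :: complex measure)"
    proof (rule lborel_distr_isometry)
      show "surj ((*) c)" using c by (intro surjI[of _ "\<lambda>z. z / c"]) auto
    qed (use c in \<open>auto simp: norm_mult intro: linearI algebra_simps\<close>)
    then have "(\<integral>z. indicator (ball 0 1) z *\<^sub>R F z \<partial>lborel) = (\<integral>z. indicator (ball 0 1) z *\<^sub>R F z \<partial>distr lborel borel ((*) c))"
      by simp
    also have "\<dots> = (\<integral>z. indicator (ball 0 1) (c * z) *\<^sub>R F (c * z) \<partial>lborel)"
      by (intro integral_distr borel_measurable_scaleR borel_measurable_indicator) auto
    also have "\<dots> = (\<integral>z. indicator (ball 0 1) z *\<^sub>R F (c * z) \<partial>lborel)"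
      using c by (intro Bochner_Integration.integral_cong) (auto simp: indicator_def norm_mult)
    finally show ?thesis by (simp add: conv)
  qed
  show ?thesis
  proof (rule not_gleason_whitney_shrinking_sets[where V = "\<lambda>n. ball 0 (1 / Suc n)", OF fin])
    show X: "Hinf_disc \<subseteq> elements (Linf ?M)"
    proof
      fix f assume f: "f \<in> Hinf_disc"
      then obtain B where B: "B > 0" "\<And>z. z \<in> ball 0 1 \<Longrightarrow> cmod (f z) \<le> B"
        by (auto simp: Hinf_disc_def bounded_pos)
      have "f \<in> borel_measurable ?M"
        using f by (intro continuous_imp_measurable_on_sets_lebesgue holomorphic_on_imp_continuous_on) (auto simp: Hinf_disc_def)
      then show "f \<in> elements (Linf ?M)" using B by (intro Linf_memI(1)[where B = B]) auto
    qed
    show "(\<lambda>_. 1) \<in> Hinf_disc" by (auto simp: Hinf_disc_def bounded_iff)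
    have sub: "ball 0 (1 / Suc n) \<subseteq> ball (0::complex) 1" for n by (rule subset_ball) (simp add: divide_le_eq)
    show "ball 0 (1 / Suc n) \<in> sets ?M" for n using sub by (intro meas) auto
    show "measure ?M (ball 0 (1 / Suc n)) > 0" for n
      using sub meas(2)[of "ball 0 (1 / Suc n)"] by (simp add: content_ball_pos)
    show "decseq (\<lambda>n. ball (0::complex) (1 / Suc n))"
      by (intro decseq_SucI subset_ball divide_left_mono) auto
    have "{0} \<in> null_sets ?M" by (simp add: null_sets_restrict_space)
    then have "AE z in ?M. z \<noteq> 0" using AE_not_in by fastforce
    then show "AE z in ?M. \<exists>n. z \<notin> ball 0 (1 / Suc n)"
    proof eventually_elim
      case (elim z)
      then obtain n where "1 / Suc n < cmod z" using nat_approx_posE[of "cmod z"] by auto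
      then show ?case by (intro exI[of _ n]) simp
    qed
    fix g assume g: "g \<in> Hinf_disc"
    then have "\<exists>B. \<forall>z\<in>ball 0 1. cmod (g z) \<le> B" by (simp add: Hinf_disc_def bounded_iff)
    then obtain B where B: "\<And>z. z \<in> ball 0 1 \<Longrightarrow> cmod (g z) \<le> B" by blast
    have hol: "g holomorphic_on ball 0 1" using g by (simp add: Hinf_disc_def)
    have scale: "r *\<^sub>R z \<in> ball 0 1" if "z \<in> ball 0 1" "0 < r" "r < 1" for r :: real and z :: complex
      using that mult_strict_mono[of r 1 "cmod z" 1] by auto
    have scale': "c * z \<in> ball 0 1" if "z \<in> ball 0 1" "cmod c \<le> 1" for z c :: complex
      using that mult_right_mono[of "cmod c" 1 "cmod z"] by (auto simp: norm_mult)
    have mean: "(\<integral>z. indicator (ball 0 \<rho>) z * g z \<partial>?M) = g 0 * measure ?M (ball 0 \<rho> \<inter> space ?M)" for \<rho>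
    proof (rule integral_rotation_invariant_set[where rot = "(*)" and S = "ball 0 1" and f = g and B = B, OF fin id])
      show "continuous_on (ball 0 1) (\<lambda>z. g (r *\<^sub>R z))" if "0 < r" "r < 1" for r
        using scale[OF _ that] by (intro continuous_on_compose2[OF holomorphic_on_imp_continuous_on[OF hol]] continuous_intros) auto
      show "(\<lambda>c. g (c * z)) holomorphic_on ball 0 1" if "z \<in> ball 0 1" for z
        using scale'[OF that] by (intro holomorphic_on_compose_gen[OF _ hol, unfolded o_def] holomorphic_intros) auto
      show "g \<in> borel_measurable ?M" using X g by (auto intro: Linf_measurable)
      show "AE z in ?M. ((\<lambda>r. g (r *\<^sub>R z)) \<longlongrightarrow> g z) (at_left 1)"
      proof (rule AE_I2)
        fix z assume z: "z \<in> space ?M"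
        then have "isCont g z"
          using hol by (intro continuous_on_interior[OF holomorphic_on_imp_continuous_on]) auto
        moreover have "((\<lambda>r. r *\<^sub>R z) \<longlongrightarrow> 1 *\<^sub>R z) (at_left 1)" by (intro tendsto_intros)
        ultimately show "((\<lambda>r. g (r *\<^sub>R z)) \<longlongrightarrow> g z) (at_left 1)"
          by (auto intro: isCont_tendsto_compose)
      qed
    qed (use inv B scale in \<open>auto simp: norm_mult scaleR_conv_of_real\<close>)
    have "(\<integral>z. g z \<partial>?M) = (\<integral>z. indicator (ball 0 1) z * g z \<partial>?M)"
      by (intro Bochner_Integration.integral_cong) auto
    then have whole: "(\<integral>z. g z \<partial>?M) = g 0 * measure ?M (space ?M)" by (simp add: mean)
    have part: "(\<integral>z. indicator (ball 0 (1 / Suc n)) z * g z \<partial>?M) = g 0 * measure ?M (ball 0 (1 / Suc n))" for n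
    proof -
      have "ball 0 (1 / Suc n) \<inter> space ?M = ball 0 (1 / Suc n)" using sub[of n] by auto
      then show ?thesis by (simp only: mean)
    qed
    show "\<exists>c::complex. (\<forall>n. (\<integral>z. indicator (ball 0 (1 / Suc n)) z * g z \<partial>?M) = c * measure ?M (ball 0 (1 / Suc n))) \<and>
        (\<integral>z. g z \<partial>?M) = c * measure ?M (space ?M)"
      by (intro exI[of _ "g 0"] conjI allI part whole)
  qed
qed

section \<open>Boundary functions on rotation invariant sets\<close>

text \<open>
  Infinitely many disjoint sets of the same positive measure do not fit into a finite measure.
\<close>

lemma measure_zero_of_disjoint_copies:
  assumes "finite_measure M" and "disjoint_family A" and "range A \<subseteq> sets M"
    and "\<And>n :: nat. measure M (A n) = a"
  shows "a = 0"
proof -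
  interpret finite_measure M by fact
  have "(\<lambda>n. measure M (A n)) sums measure M (\<Union>n. A n)"
    using assms by (intro finite_measure_UNION)
  then have "summable (\<lambda>_::nat. a)" using assms(4) by (simp add: sums_iff)
  then have "(\<lambda>_::nat. a) \<longlonglongrightarrow> 0" by (rule summable_LIMSEQ_zero)
  then show ?thesis by (simp add: LIMSEQ_const_iff)
qed

text \<open>
  Coordinatewise rotations preserve the measures on the sphere and on the torus. Equal angles
  give the circle action, and rotating a single coordinate changes its argument relative to
  the others.
\<close>

definition coord_rot :: "('d \<Rightarrow> complex) \<Rightarrow> complex ^ 'd \<Rightarrow> complex ^ 'd" where
  "coord_rot \<theta> z = (\<chi> i. \<theta> i * vec_nth z i)"

lemma coord_rot_linear: "linear (coord_rot \<theta> :: complex ^ 'd::finite \<Rightarrow> _)"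
  by (intro linearI) (simp_all add: coord_rot_def vec_eq_iff algebra_simps)

lemma continuous_on_coord_rot: "continuous_on A (coord_rot \<theta> :: complex ^ 'd::finite \<Rightarrow> _)"
  using coord_rot_linear[of \<theta>] by (intro linear_continuous_on) (simp add: linear_conv_bounded_linear)

lemma coord_rot_measurable: "coord_rot \<theta> \<in> borel \<rightarrow>\<^sub>M borel"
  by (intro borel_measurable_continuous_onI continuous_on_coord_rot)

lemma coord_rot_const: "coord_rot (\<lambda>_. c) z = c *s z"
  by (simp add: coord_rot_def vec_eq_iff)

text \<open>
  A complex linear derivative of \<open>f\<close> restricts to a complex derivative on the line through \<open>z\<close>.
\<close>

lemma Hinf_slice_holomorphic:
  assumes f: "f \<in> Hinf \<Omega>" and \<Omega>: "\<And>c. cmod c < 1 \<Longrightarrow> c *s z \<in> \<Omega>"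
  shows "(\<lambda>c. f (c *s z)) holomorphic_on ball 0 1"
  unfolding holomorphic_on_def
proof
  fix c :: complex assume "c \<in> ball 0 1"
  then have "c *s z \<in> \<Omega>" using \<Omega> by simp
  then obtain f' where f': "(f has_derivative f') (at (c *s z))" "\<And>c v. f' (c *s v) = c * f' v"
    using f unfolding Hinf_def by blast
  have "linear (\<lambda>c. c *s z)" by (intro linearI) (simp_all add: vec_eq_iff algebra_simps)
  then have "((\<lambda>c. c *s z) has_derivative (\<lambda>c. c *s z)) (at c)"
    by (intro bounded_linear_imp_has_derivative) (simp add: linear_conv_bounded_linear)
  then have "((\<lambda>c. f (c *s z)) has_derivative (\<lambda>h. f' (h *s z))) (at c)"
    using f'(1) by (rule has_derivative_compose)
  then have "((\<lambda>c. f (c *s z)) has_field_derivative f' z) (at c)"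
    unfolding has_field_derivative_def f'(2) by (simp add: mult.commute[of _ "f' z"])
  then show "(\<lambda>c. f (c *s z)) field_differentiable at c within ball 0 1"
    using field_differentiable_at_within field_differentiable_def by blast
qed

lemma Hinf_continuous_on: "f \<in> Hinf \<Omega> \<Longrightarrow> continuous_on \<Omega> f"
  unfolding Hinf_def by (auto intro!: continuous_at_imp_continuous_on dest: has_derivative_continuous)

lemma one_in_Hinf: "(\<lambda>_. 1) \<in> Hinf \<Omega>"
  unfolding Hinf_def by (auto simp: bounded_iff intro!: exI[of _ "\<lambda>_. 0"])

lemma one_in_boundary_functions:
  "(\<lambda>_. 1) \<in> F \<Longrightarrow> (\<lambda>_. 1) \<in> boundary_functions M F"
  unfolding boundary_functions_def by (auto intro!: Linf_memI(1)[where B = 1] bexI[of _ "\<lambda>_. 1"])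

lemma unit_circle_finite_net:
  assumes "e > 0"
  shows "\<exists>C. finite C \<and> C \<subseteq> sphere (0::complex) 1 \<and> (\<forall>u\<in>sphere 0 1. \<exists>c\<in>C. cmod (u - c) < e)"
proof -
  obtain C where "C \<subseteq> sphere (0::complex) 1" "finite C" "sphere 0 1 \<subseteq> (\<Union>c\<in>C. ball c e)"
    using compactE_image[of "sphere (0::complex) 1" "sphere 0 1" "\<lambda>c. ball c e"] assms compact_sphere
    by (metis (no_types, lifting) UN_I centre_in_ball open_ball subsetI)
  then show ?thesis by (intro exI[of _ C]) (fastforce simp: dist_norm norm_minus_commute)
qed

text \<open>
  Let \<open>w z\<close> be the sign of \<open>z\<^sub>i cnj z\<^sub>j\<close>, the unit whose argument is the difference of the
  arguments of two coordinates. It is constant under the circle action, and rotating the \<open>i\<close>-th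
  coordinate multiplies it by any chosen unit. Hence the sets \<open>|w - 1| < 1/(n+1)\<close> are invariant;
  finitely many rotated copies of each cover the set where \<open>w \<noteq> 0\<close>, so it has positive measure;
  and their intersection \<open>w = 1\<close> has infinitely many disjoint copies of the same measure, so it
  is null.
\<close>

theorem not_gleason_whitney_boundary_functions:
  fixes M :: "(complex ^ 'd::finite) measure"
  assumes fin: "finite_measure M" and sets_M: "sets M = sets borel"
    and inv: "\<And>\<theta>. (\<And>k. cmod (\<theta> k) = 1) \<Longrightarrow> distr M borel (coord_rot \<theta>) = M"
    and S: "S \<in> sets borel" "AE z in M. z \<in> S" "\<And>c z. cmod c = 1 \<Longrightarrow> z \<in> S \<Longrightarrow> c *s z \<in> S"
    and \<Omega>: "\<And>c z. cmod c < 1 \<Longrightarrow> z \<in> S \<Longrightarrow> c *s z \<in> \<Omega>"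
    and ij: "i \<noteq> j" and pos: "measure M {z. vec_nth z i \<noteq> 0 \<and> vec_nth z j \<noteq> 0} > 0"
  shows "\<not> gleason_whitney (Linf M) (boundary_functions M (Hinf \<Omega>)) (elements (Linf M))"
proof -
  interpret finite_measure M by fact
  have space_M: "space M = UNIV" using sets_M sets_eq_imp_space_eq by fastforce
  define w where "w z = sgn (vec_nth z i * cnj (vec_nth z j))" for z :: "complex ^ 'd"
  have "continuous_on UNIV (\<lambda>z :: complex ^ 'd. vec_nth z i * cnj (vec_nth z j))"
    by (intro continuous_intros)
  then have [measurable]: "(\<lambda>z :: complex ^ 'd. vec_nth z i * cnj (vec_nth z j)) \<in> borel_measurable borel"
    by (rule borel_measurable_continuous_onI)
  have [measurable]: "w \<in> borel_measurable borel"
    unfolding w_def sgn_div_norm by measurable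
  have w_zero: "w z = 0 \<longleftrightarrow> vec_nth z i = 0 \<or> vec_nth z j = 0" for z by (simp add: w_def sgn_zero_iff)
  have w_norm: "cmod (w z) = 1" if "w z \<noteq> 0" for z
    using that by (auto simp: w_def norm_sgn split: if_splits)
  have w_rot: "w (coord_rot (\<lambda>k. if k = i then u else 1) z) = u * w z" if "cmod u = 1" for u z
    using that ij by (simp add: w_def coord_rot_def sgn_mult mult.assoc) (simp add: sgn_div_norm)
  have w_act: "w (c *s z) = w z" if "cmod c = 1" for c z
  proof -
    have "c * cnj c = 1" using that complex_norm_square[of c] by simp
    moreover have "(c *s z) $ i * cnj ((c *s z) $ j) = (c * cnj c) * (z $ i * cnj (z $ j))"
      by (simp add: mult_ac)
    ultimately have "(c *s z) $ i * cnj ((c *s z) $ j) = z $ i * cnj (z $ j)" by (simp only: mult_1_left)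
    then show ?thesis unfolding w_def by (rule arg_cong)
  qed
  have rotated: "measure M {z. P (u * w z)} = measure M {z. P (w z)}"
    if u: "cmod u = 1" and [measurable]: "Measurable.pred borel P" for u P
  proof -
    let ?R = "coord_rot (\<lambda>k. if k = i then u else 1)"
    have "measure M {z. P (w z)} = measure (distr M borel ?R) {z. P (w z)}"
      using u by (subst inv) auto
    also have "\<dots> = measure M (?R -` {z. P (w z)} \<inter> space M)"
      by (rule measure_distr) (use sets_M coord_rot_measurable in \<open>auto cong: measurable_cong_sets\<close>)
    also have "?R -` {z. P (w z)} \<inter> space M = {z. P (u * w z)}"
      using u by (auto simp: w_rot space_M)
    finally show ?thesis ..
  qed
  define V where "V n = {z. cmod (w z - 1) < 1 / real (Suc n)}" for n
  have V_sets[measurable]: "V n \<in> sets borel" for n unfolding V_def by measurable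
  have V_pos: "measure M (V n) > 0" for n
  proof (rule ccontr)
    assume "\<not> measure M (V n) > 0"
    then have "measure M (V n) = 0" using measure_nonneg[of M "V n"] by linarith
    obtain C where C: "finite C" "C \<subseteq> sphere (0::complex) 1"
      "\<And>u. u \<in> sphere 0 1 \<Longrightarrow> \<exists>c\<in>C. cmod (u - c) < 1 / real (Suc n)"
      using unit_circle_finite_net[of "1 / real (Suc n)"] by auto
    \<comment> \<open>Rotating by \<open>c\<close> carries \<open>V n\<close> to this set.\<close>
    have null: "measure M {z. cmod (w z - c) < 1 / real (Suc n)} = 0" if "c \<in> C" for c
    proof -
      have c: "cmod c = 1" using that C(2) by auto
      have "cmod (inverse c * w z - 1) = cmod (w z - c)" for z
      proof -
        have "w z - c = c * (inverse c * w z - 1)" using c by (cases "c = 0") (simp_all add: right_diff_distrib)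
        then show ?thesis using c by (simp add: norm_mult)
      qed
      then have "{z. cmod (w z - c) < 1 / real (Suc n)} = {z. cmod (inverse c * w z - 1) < 1 / real (Suc n)}"
        by simp
      also have "measure M \<dots> = measure M (V n)"
        unfolding V_def using c by (intro rotated) (auto simp: norm_inverse)
      finally show ?thesis using \<open>measure M (V n) = 0\<close> by simp
    qed
    have "measure M {z. vec_nth z i \<noteq> 0 \<and> vec_nth z j \<noteq> 0} \<le> measure M (\<Union>c\<in>C. {z. cmod (w z - c) < 1 / real (Suc n)})"
    proof (rule finite_measure_mono)
      show "{z. vec_nth z i \<noteq> 0 \<and> vec_nth z j \<noteq> 0} \<subseteq> (\<Union>c\<in>C. {z. cmod (w z - c) < 1 / real (Suc n)})"
        using C(3) w_norm w_zero by (auto simp: dist_norm)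
      show "(\<Union>c\<in>C. {z. cmod (w z - c) < 1 / real (Suc n)}) \<in> sets M"
        unfolding sets_M using C(1) by (intro sets.finite_UN) measurable
    qed
    also have "\<dots> \<le> (\<Sum>c\<in>C. measure M {z. cmod (w z - c) < 1 / real (Suc n)})"
      using C(1) by (intro finite_measure_subadditive_finite) (auto simp: sets_M)
    also have "\<dots> = 0" using null by simp
    finally show False using pos by simp
  qed
  have "measure M {z. w z = 1} = 0"
  proof (rule measure_zero_of_disjoint_copies[OF fin])
    \<comment> \<open>Any sequence of distinct units will do; these have distinct cosines.\<close>
    define u where "u n = cis (1 / real (Suc n))" for n
    have inj: "m = n" if "u m = u n" for m n
    proof -
      have "1 / real (Suc k) \<le> 1" for k by (simp add: divide_le_eq)
      then have le_pi: "1 / real (Suc k) \<le> pi" for k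
        by (rule order_trans) (use pi_ge_two in linarith)
      have "cos (1 / real (Suc m)) = cos (1 / real (Suc n))"
        using arg_cong[OF that, of Re] by (simp add: u_def)
      then have "1 / real (Suc m) = 1 / real (Suc n)" by (rule cos_inj_pi[rotated -1]) (rule le_pi | simp)+
      then show ?thesis by simp
    qed
    show "disjoint_family (\<lambda>n. {z. w z = u n})"
      unfolding disjoint_family_on_def using inj by auto
    show "range (\<lambda>n. {z. w z = u n}) \<subseteq> sets M" unfolding sets_M by auto
    show "measure M {z. w z = u n} = measure M {z. w z = 1}" for n
    proof -
      have u: "cmod (u n) = 1" by (simp add: u_def)
      then have "{z. w z = u n} = {z. inverse (u n) * w z = 1}"
        by (auto simp: field_simps)
      also have "measure M \<dots> = measure M {z. w z = 1}"
        using u by (intro rotated) (auto simp: norm_inverse)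
      finally show ?thesis .
    qed
  qed
  then have "AE z in M. w z \<noteq> 1"
    by (intro AE_I[of _ _ "{z. w z = 1}"]) (auto simp: sets_M emeasure_eq_measure)
  then have V_null: "AE z in M. \<exists>n. z \<notin> V n"
  proof eventually_elim
    case (elim z)
    then obtain n where "1 / real (Suc n) < cmod (w z - 1)" using nat_approx_posE[of "cmod (w z - 1)"] by auto
    then show ?case by (intro exI[of _ n]) (simp add: V_def)
  qed
  show ?thesis
  proof (rule not_gleason_whitney_shrinking_sets[where V = V, OF fin])
    show X: "boundary_functions M (Hinf \<Omega>) \<subseteq> elements (Linf M)" by (auto simp: boundary_functions_def)
    show "(\<lambda>_. 1) \<in> boundary_functions M (Hinf \<Omega>)" by (intro one_in_boundary_functions one_in_Hinf)
    show "V n \<in> sets M" for n by (simp add: sets_M)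
    show "decseq V"
    proof (rule decseq_SucI)
      show "V (Suc n) \<subseteq> V n" for n
        unfolding V_def by (auto elim!: less_le_trans intro!: divide_left_mono)
    qed
    fix g assume g: "g \<in> boundary_functions M (Hinf \<Omega>)"
    then obtain f where f: "f \<in> Hinf \<Omega>" and lim: "AE z in M. ((\<lambda>r. f (r *\<^sub>R z)) \<longlongrightarrow> g z) (at_left 1)"
      by (auto simp: boundary_functions_def)
    have "\<exists>B. \<forall>z\<in>\<Omega>. cmod (f z) \<le> B" using f by (simp add: Hinf_def bounded_iff)
    then obtain B where B: "\<And>z. z \<in> \<Omega> \<Longrightarrow> cmod (f z) \<le> B" by blast
    have real_act: "of_real r *s z = r *\<^sub>R z" for r and z :: "complex ^ 'd"
      unfolding vec_eq_iff vector_scaleR_component vector_smult_component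
      by (simp add: scaleR_conv_of_real)
    have scale: "r *\<^sub>R z \<in> \<Omega>" if "0 < r" "r < 1" "z \<in> S" for r z
      using \<Omega>[of "of_real r" z] that by (simp add: real_act)
    have S_iff: "c *s z \<in> S \<longleftrightarrow> z \<in> S" if "cmod c = 1" for c z
    proof
      assume "c *s z \<in> S"
      then have "inverse c *s (c *s z) \<in> S" by (rule S(3)[rotated]) (simp add: norm_inverse that)
      moreover have "inverse c *s (c *s z) = z" using that by (cases "c = 0") (simp_all add: vector_smult_assoc)
      ultimately show "z \<in> S" by (simp only:)
    qed (use S(3) that in auto)
    have act_meas: "(\<lambda>z. c *s z) \<in> borel \<rightarrow>\<^sub>M (borel :: (complex ^ 'd) measure)" for c
      using coord_rot_measurable[of "\<lambda>_. c"] by (simp add: coord_rot_const[abs_def])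
    have mean: "(\<integral>z. indicator W z * g z \<partial>M) = f 0 * measure M (W \<inter> space M)"
      if W: "W \<in> sets borel" "\<And>c z. cmod c = 1 \<Longrightarrow> c *s z \<in> W \<longleftrightarrow> z \<in> W" for W
    proof (rule integral_rotation_invariant_set[where rot = "(*s)" and S = S and f = f and B = B, OF fin])
      show "(\<lambda>z. z) \<in> M \<rightarrow>\<^sub>M borel" using sets_M by (intro measurable_ident_sets)
      show "(\<integral>z. F (c *s z) \<partial>M) = (\<integral>z. F z \<partial>M)" if c: "cmod c = 1" and F: "F \<in> borel_measurable borel"
        for c and F :: "complex ^ 'd \<Rightarrow> complex"
      proof -
        have "(\<integral>z. F z \<partial>M) = (\<integral>z. F z \<partial>distr M borel (coord_rot (\<lambda>_. c)))"
          using c by (subst inv) auto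
        also have "\<dots> = (\<integral>z. F (c *s z) \<partial>M)"
          using act_meas[of c] F sets_M
          by (subst integral_distr) (auto simp: coord_rot_const[abs_def] coord_rot_const cong: measurable_cong_sets)
        finally show ?thesis ..
      qed
      show "continuous_on S (\<lambda>z. f (r *\<^sub>R z))" if "0 < r" "r < 1" for r
        using scale[OF that] by (intro continuous_on_compose2[OF Hinf_continuous_on[OF f]] continuous_intros) auto
      show "(\<lambda>c. f (c *s z)) holomorphic_on ball 0 1" if "z \<in> S" for z
        using \<Omega> that by (intro Hinf_slice_holomorphic[OF f]) auto
      show "g \<in> borel_measurable M" using X g by (auto intro: Linf_measurable)
      show "c *s (r *\<^sub>R z) = (c * of_real r) *s z" for c r and z :: "complex ^ 'd"
        by (simp only: real_act[symmetric] vector_smult_assoc)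
      show "cmod (f (r *\<^sub>R z)) \<le> B" if "0 < r" "r < 1" "z \<in> S" for r z
        using B scale[OF that] by blast
    qed (use S S_iff W act_meas lim in \<open>simp_all add: real_act vector_smult_assoc\<close>)
    have V_inv: "c *s z \<in> V n \<longleftrightarrow> z \<in> V n" if "cmod c = 1" for c z n
      using that by (simp add: V_def w_act)
    have part: "(\<integral>z. indicator (V n) z * g z \<partial>M) = f 0 * measure M (V n)" for n
      using mean[OF V_sets V_inv, of n] by (simp add: space_M)
    have whole: "(\<integral>z. g z \<partial>M) = f 0 * measure M (space M)"
      using mean[of UNIV] by simp
    show "\<exists>c::complex. (\<forall>n. (\<integral>z. indicator (V n) z * g z \<partial>M) = c * measure M (V n)) \<and>
        (\<integral>z. g z \<partial>M) = c * measure M (space M)"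
      by (intro exI[of _ "f 0"] conjI allI part whole)
  qed (use V_pos V_null in auto)
qed

section \<open>The sphere and the torus\<close>

lemma norm_coord_rot:
  assumes "\<And>k. cmod (\<theta> k) = 1"
  shows "norm (coord_rot \<theta> z) = norm z"
  using assms by (simp add: norm_vec_def coord_rot_def norm_mult)

lemma surj_coord_rot:
  assumes "\<And>k. cmod (\<theta> k) = 1"
  shows "surj (coord_rot \<theta>)"
proof (rule surjI)
  have "\<theta> k \<noteq> 0" for k using assms[of k] by auto
  then show "coord_rot \<theta> (coord_rot (\<lambda>k. inverse (\<theta> k)) z) = z" for z
    by (simp add: coord_rot_def vec_eq_iff)
qed

lemma norm_smult_vec: "norm (c *s z) = cmod c * norm (z :: complex ^ 'd::finite)"
  by (simp add: norm_vec_def norm_mult L2_set_right_distrib)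

lemma sgn_measurable: "sgn \<in> borel \<rightarrow>\<^sub>M (borel :: 'a::{real_normed_vector, second_countable_topology} measure)"
proof -
  have "(\<lambda>z :: 'a. inverse (norm z) *\<^sub>R z) \<in> borel_measurable borel" by measurable
  then show ?thesis by (simp add: sgn_div_norm[abs_def])
qed

text \<open>
  Coordinatewise rotations are linear isometries, so they preserve the uniform distribution on
  the ball and commute with the radial projection. The set where neither coordinate vanishes
  has positive measure because its part in the ball is open and not empty.
\<close>

lemma not_gleason_whitney_sphere:
  assumes "CARD('d::finite) \<ge> 2"
  shows "\<not> gleason_whitney (Linf (sphere_measure :: (complex ^ 'd) measure))
          (boundary_functions sphere_measure (Hinf (ball 0 1))) (elements (Linf sphere_measure))"
proof -
  define B where "B = ball (0 :: complex ^ 'd) 1"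
  define U where "U = uniform_measure lborel B"
  have M: "sphere_measure = distr U borel sgn" by (simp add: sphere_measure_def U_def B_def)
  have B_sets: "B \<in> sets borel" by (simp add: B_def)
  have B_fin: "emeasure lborel B \<noteq> \<infinity>" and B_pos: "emeasure lborel B \<noteq> 0"
    using emeasure_lborel_ball_finite[of "0 :: complex ^ 'd" 1] content_ball_pos[of 1 "0 :: complex ^ 'd"]
    by (auto simp: B_def measure_def)
  interpret U: prob_space U unfolding U_def using B_fin B_pos by (intro prob_space_uniform_measure)
  have sets_U[measurable_cong]: "sets U = sets borel" by (simp add: U_def)
  have sgn_U: "sgn \<in> U \<rightarrow>\<^sub>M borel"
    using sgn_measurable by (simp cong: measurable_cong_sets add: sets_U)
  have "prob_space (sphere_measure :: (complex ^ 'd) measure)"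
    unfolding M using sgn_U by (rule U.prob_space_distr)
  then have fin: "finite_measure (sphere_measure :: (complex ^ 'd) measure)"
    by (simp add: prob_space_def)
  have inv_U: "distr U borel (coord_rot \<theta>) = U" if \<theta>: "\<And>k. cmod (\<theta> k) = 1" for \<theta>
  proof (rule measure_eqI)
    fix A assume "A \<in> sets (distr U borel (coord_rot \<theta>))"
    then have A: "A \<in> sets borel" by simp
    have pre: "coord_rot \<theta> -` A \<in> sets borel" if "A \<in> sets borel" for A :: "(complex ^ 'd) set"
      using measurable_sets[OF coord_rot_measurable that, of \<theta>] by simp
    have "emeasure (distr U borel (coord_rot \<theta>)) A = emeasure U (coord_rot \<theta> -` A)"
      using A coord_rot_measurable[of \<theta>]
      by (subst emeasure_distr) (auto cong: measurable_cong_sets simp: sets_U sets_eq_imp_space_eq[OF sets_U])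
    also have "\<dots> = emeasure lborel (B \<inter> coord_rot \<theta> -` A) / emeasure lborel B"
      using B_sets pre[OF A] by (simp add: U_def)
    also have "B \<inter> coord_rot \<theta> -` A = coord_rot \<theta> -` (B \<inter> A)"
      using \<theta> by (auto simp: B_def norm_coord_rot)
    also have "emeasure lborel (coord_rot \<theta> -` (B \<inter> A)) = emeasure (distr lborel borel (coord_rot \<theta>)) (B \<inter> A)"
      using A B_sets coord_rot_measurable[of \<theta>] by (subst emeasure_distr) auto
    also have "distr lborel borel (coord_rot \<theta>) = lborel"
      using \<theta> by (intro lborel_distr_isometry coord_rot_linear norm_coord_rot surj_coord_rot)
    also have "emeasure lborel (B \<inter> A) / emeasure lborel B = emeasure U A"
      using B_sets A by (simp add: U_def)
    finally show "emeasure (distr U borel (coord_rot \<theta>)) A = emeasure U A" .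
  qed (simp add: sets_U)
  obtain i j :: 'd where ij: "i \<noteq> j"
    using assms card_le_Suc0_iff_eq[of "UNIV :: 'd set"] by fastforce
  show ?thesis
  proof (rule not_gleason_whitney_boundary_functions[OF fin _ _ _ _ _ _ ij, where S = "cball 0 1"])
    show "distr sphere_measure borel (coord_rot \<theta>) = sphere_measure" if \<theta>: "\<And>k. cmod (\<theta> k) = 1"
      for \<theta> :: "'d \<Rightarrow> complex"
    proof -
      have commute: "coord_rot \<theta> \<circ> sgn = sgn \<circ> coord_rot \<theta>"
        using linear_scale[OF coord_rot_linear[of \<theta>]] by (auto simp: sgn_div_norm norm_coord_rot[OF \<theta>])
      have "distr sphere_measure borel (coord_rot \<theta>) = distr U borel (coord_rot \<theta> \<circ> sgn)"
        unfolding M using coord_rot_measurable sgn_U by (rule distr_distr)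
      also have "\<dots> = distr (distr U borel (coord_rot \<theta>)) borel sgn"
        unfolding commute using coord_rot_measurable[of \<theta>]
        by (intro distr_distr[symmetric] sgn_measurable) (simp cong: measurable_cong_sets add: sets_U)
      finally show ?thesis by (simp add: inv_U[OF \<theta>] M)
    qed
    show "AE z in sphere_measure. z \<in> cball (0 :: complex ^ 'd) 1"
      unfolding M using sgn_U by (subst AE_distr_iff) (auto simp: norm_sgn)
    show "c *s z \<in> cball 0 1" if "cmod c = 1" "z \<in> cball 0 1" for c and z :: "complex ^ 'd"
      using that by (simp add: norm_smult_vec)
    show "c *s z \<in> ball 0 1" if "cmod c < 1" "z \<in> cball 0 1" for c and z :: "complex ^ 'd"
      using that mult_mono[of "cmod c" "cmod c" "norm z" 1] by (auto simp: norm_smult_vec)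
    have cont: "continuous_on UNIV (\<lambda>z :: complex ^ 'd. vec_nth z k)" for k by (intro continuous_intros)
    have op: "open {z :: complex ^ 'd. vec_nth z i \<noteq> 0 \<and> vec_nth z j \<noteq> 0}"
      using cont by (intro open_Collect_conj open_Collect_neq) auto
    \<comment> \<open>A small multiple of the vector with all coordinates equal to one lies in the ball.\<close>
    define s where "s = 1 / (1 + norm (1 :: complex ^ 'd))"
    have s: "s > 0" "s * norm (1 :: complex ^ 'd) < 1"
      using norm_ge_zero[of "1 :: complex ^ 'd"] by (simp_all add: s_def add_pos_nonneg)
    define v :: "complex ^ 'd" where "v = s *\<^sub>R 1"
    have "norm v < 1" using s by (simp add: v_def)
    moreover have "vec_nth v k \<noteq> 0" for k using s(1) by (simp add: v_def)
    ultimately have "v \<in> B \<inter> {z. vec_nth z i \<noteq> 0 \<and> vec_nth z j \<noteq> 0}" by (simp add: B_def)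
    then obtain e where e: "e > 0" "ball v e \<subseteq> B \<inter> {z. vec_nth z i \<noteq> 0 \<and> vec_nth z j \<noteq> 0}"
      using openE[OF open_Int[OF open_ball op], of v 0 1] unfolding B_def by blast
    have "0 < measure lborel (ball v e)" using e(1) by (rule content_ball_pos)
    also have "\<dots> \<le> measure lborel (B \<inter> {z. vec_nth z i \<noteq> 0 \<and> vec_nth z j \<noteq> 0})"
    proof (rule measure_mono_fmeasurable[OF e(2)])
      have sets: "B \<inter> {z. vec_nth z i \<noteq> 0 \<and> vec_nth z j \<noteq> 0} \<in> sets lborel"
        using op B_sets by (simp add: sets.Int)
      moreover have "emeasure lborel (B \<inter> {z. vec_nth z i \<noteq> 0 \<and> vec_nth z j \<noteq> 0}) \<le> emeasure lborel B"
        using B_sets by (intro emeasure_mono) auto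
      ultimately show "B \<inter> {z. vec_nth z i \<noteq> 0 \<and> vec_nth z j \<noteq> 0} \<in> fmeasurable lborel"
        using B_fin by (intro fmeasurableI) (auto simp: less_top[symmetric] top_unique)
    qed simp
    finally have Bij: "0 < measure lborel (B \<inter> {z. vec_nth z i \<noteq> 0 \<and> vec_nth z j \<noteq> 0})" .
    have "0 < measure U {z. vec_nth z i \<noteq> 0 \<and> vec_nth z j \<noteq> 0}"
    proof -
      have "measure lborel B > 0" unfolding B_def by (rule content_ball_pos) simp
      then have "0 < measure lborel (B \<inter> {z. vec_nth z i \<noteq> 0 \<and> vec_nth z j \<noteq> 0}) / measure lborel B"
        using Bij by (intro divide_pos_pos)
      then show ?thesis
        unfolding U_def using B_fin B_pos op by (subst measure_uniform_measure) simp_all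
    qed
    also have "{z :: complex ^ 'd. vec_nth z i \<noteq> 0 \<and> vec_nth z j \<noteq> 0}
        = sgn -` {z. vec_nth z i \<noteq> 0 \<and> vec_nth z j \<noteq> 0} \<inter> space U"
      by (auto simp: sgn_div_norm sets_eq_imp_space_eq[OF sets_U])
    also have "measure U \<dots> = measure sphere_measure {z. vec_nth z i \<noteq> 0 \<and> vec_nth z j \<noteq> 0}"
      unfolding M using sgn_U op by (intro measure_distr[symmetric]) auto
    finally show "0 < measure sphere_measure {z :: complex ^ 'd. vec_nth z i \<noteq> 0 \<and> vec_nth z j \<noteq> 0}" .
  qed (auto simp: sphere_measure_def)
qed

text \<open>
  Expressing the measure by Lebesgue integrals over the real line makes translation invariance
  available.
\<close>

lemma emeasure_arclength:
  assumes "A \<in> sets borel"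
  shows "emeasure arclength A = (\<integral>\<^sup>+t. indicator {0..2 * pi} t * indicator A (cis t) \<partial>lborel)"
proof -
  have cis: "cis \<in> borel \<rightarrow>\<^sub>M borel" by (intro borel_measurable_continuous_onI continuous_intros)
  have cis': "cis \<in> lebesgue_on {0..2 * pi} \<rightarrow>\<^sub>M borel"
    by (intro measurable_restrict_space1 measurable_completion) (use cis in simp)
  have pre: "cis -` A \<in> sets borel" using measurable_sets[OF cis assms] by simp
  have "emeasure arclength A = emeasure (lebesgue_on {0..2 * pi}) ({0..2 * pi} \<inter> cis -` A)"
    unfolding arclength_def using cis' assms by (subst emeasure_distr) (auto simp: Int_commute)
  also have "\<dots> = emeasure lborel ({0..2 * pi} \<inter> cis -` A)"
    using pre by (subst emeasure_restrict_space) auto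
  also have "\<dots> = (\<integral>\<^sup>+t. indicator ({0..2 * pi} \<inter> cis -` A) t \<partial>lborel)"
    using pre by (intro nn_integral_indicator[symmetric]) auto
  also have "\<dots> = (\<integral>\<^sup>+t. indicator {0..2 * pi} t * indicator A (cis t) \<partial>lborel)"
    by (intro nn_integral_cong) (auto simp: indicator_def)
  finally show ?thesis .
qed

lemma sets_arclength[simp]: "sets arclength = sets borel" and space_arclength[simp]: "space arclength = UNIV"
  by (simp_all add: arclength_def)

lemma measurable_arclength_iff: "f \<in> arclength \<rightarrow>\<^sub>M N \<longleftrightarrow> f \<in> borel \<rightarrow>\<^sub>M N"
  by (rule arg_cong[where f = "\<lambda>A. f \<in> A"]) (rule measurable_cong_sets, simp_all)

lemma nn_integral_lborel_translate:
  fixes f :: "real \<Rightarrow> ennreal"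
  assumes "f \<in> borel_measurable borel"
  shows "(\<integral>\<^sup>+t. f (t + c) \<partial>lborel) = (\<integral>\<^sup>+t. f t \<partial>lborel)"
  using assms by (subst (2) lborel_distr_plus[of c, symmetric]) (simp add: nn_integral_distr add.commute)

text \<open>
  A rotation by the angle \<open>a\<close> shifts the parameter interval to \<open>[a, a + 2\<pi>)\<close>, and by periodicity
  its part beyond \<open>2\<pi>\<close> can be moved back to \<open>[0, a)\<close>.
\<close>

lemma arclength_rotation_invariant:
  assumes "cmod u = 1"
  shows "distr arclength borel ((*) u) = arclength"
proof (rule measure_eqI)
  fix A assume "A \<in> sets (distr arclength borel ((*) u))"
  then have A[measurable]: "A \<in> sets borel" by simp
  have [measurable]: "cis \<in> borel \<rightarrow>\<^sub>M borel" by (intro borel_measurable_continuous_onI continuous_intros)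
  define a where "a = Arg2pi u"
  have a: "0 \<le> a" "a < 2 * pi" using Arg2pi[of u] by (simp_all add: a_def)
  have u: "u = cis a" using Arg2pi_eq[of u] assms by (simp add: a_def cis_conv_exp)
  define g where "g t = (indicator A (cis t) :: ennreal)" for t
  have [measurable]: "g \<in> borel_measurable borel" unfolding g_def by measurable
  have g_period: "g (t + 2 * pi) = g t" for t by (simp add: g_def flip: cis_mult)
  \<comment> \<open>Half-open intervals make the two shifted pieces fit together without overlap.\<close>
  have closed: "(\<integral>\<^sup>+t. indicator {0..2 * pi} t * f t \<partial>lborel) = (\<integral>\<^sup>+t. indicator {0..<2 * pi} t * f t \<partial>lborel)"
    for f :: "real \<Rightarrow> ennreal"
  proof (rule nn_integral_cong_AE)
    have "AE t in lborel. t \<noteq> 2 * pi" by (rule AE_lborel_singleton)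
    then show "AE t in lborel. indicator {0..2 * pi} t * f t = indicator {0..<2 * pi} t * f t"
      by eventually_elim (auto simp: indicator_def)
  qed
  have pre: "(*) u -` A \<in> sets borel" using measurable_sets[of "(*) u" borel borel A] A by simp
  have "emeasure (distr arclength borel ((*) u)) A = emeasure arclength ((*) u -` A)"
    by (subst emeasure_distr) (auto simp: measurable_arclength_iff)
  also have "\<dots> = (\<integral>\<^sup>+t. indicator {0..<2 * pi} t * g (t + a) \<partial>lborel)"
    unfolding emeasure_arclength[OF pre] closed
    by (intro nn_integral_cong) (simp add: g_def u cis_mult indicator_def add.commute)
  also have "\<dots> = (\<integral>\<^sup>+t. indicator {a..<a + 2 * pi} (t + a) * g (t + a) \<partial>lborel)"
    by (intro nn_integral_cong) (auto simp: indicator_def)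
  also have "\<dots> = (\<integral>\<^sup>+t. indicator {a..<a + 2 * pi} t * g t \<partial>lborel)"
    by (rule nn_integral_lborel_translate) measurable
  also have "\<dots> = (\<integral>\<^sup>+t. indicator {a..<2 * pi} t * g t + indicator {2 * pi..<a + 2 * pi} t * g t \<partial>lborel)"
    using a by (intro nn_integral_cong) (auto simp: indicator_def)
  also have "\<dots> = (\<integral>\<^sup>+t. indicator {a..<2 * pi} t * g t \<partial>lborel) + (\<integral>\<^sup>+t. indicator {2 * pi..<a + 2 * pi} t * g t \<partial>lborel)"
    by (rule nn_integral_add) auto
  also have "(\<integral>\<^sup>+t. indicator {2 * pi..<a + 2 * pi} t * g t \<partial>lborel) = (\<integral>\<^sup>+t. indicator {2 * pi..<a + 2 * pi} (t + 2 * pi) * g (t + 2 * pi) \<partial>lborel)"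
    by (rule nn_integral_lborel_translate[symmetric]) measurable
  also have "\<dots> = (\<integral>\<^sup>+t. indicator {0..<a} t * g t \<partial>lborel)"
    by (intro nn_integral_cong) (auto simp: indicator_def g_period)
  also have "(\<integral>\<^sup>+t. indicator {a..<2 * pi} t * g t \<partial>lborel) + (\<integral>\<^sup>+t. indicator {0..<a} t * g t \<partial>lborel)
      = (\<integral>\<^sup>+t. indicator {a..<2 * pi} t * g t + indicator {0..<a} t * g t \<partial>lborel)"
    by (rule nn_integral_add[symmetric]) auto
  also have "\<dots> = (\<integral>\<^sup>+t. indicator {0..<2 * pi} t * g t \<partial>lborel)"
    using a by (intro nn_integral_cong) (auto simp: indicator_def)
  also have "\<dots> = emeasure arclength A"
    unfolding emeasure_arclength[OF A] closed by (simp add: g_def)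
  finally show "emeasure (distr arclength borel ((*) u)) A = emeasure arclength A" .
qed simp

lemma emeasure_arclength_UNIV: "emeasure arclength UNIV = ennreal (2 * pi)"
  by (subst emeasure_arclength) simp_all

lemma emeasure_arclength_off_circle: "emeasure arclength {z. cmod z \<noteq> 1} = 0"
  by (subst emeasure_arclength) (simp_all add: indicator_def)

text \<open>
  The product measure is determined by its values on boxes, so it inherits the rotation
  invariance of its factors. The coordinates have modulus one almost everywhere.
\<close>

lemma not_gleason_whitney_torus:
  assumes "CARD('d::finite) \<ge> 2"
  shows "\<not> gleason_whitney (Linf (torus_measure :: (complex ^ 'd) measure))
          (boundary_functions torus_measure (Hinf polydisc)) (elements (Linf torus_measure))"
proof -
  define P where "P = scale_measure (ennreal (1 / (2 * pi))) arclength"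
  define Q where "Q = (\<Pi>\<^sub>M i\<in>(UNIV :: 'd set). P)"
  have M: "torus_measure = distr Q borel vec_lambda" by (simp add: torus_measure_def P_def Q_def)
  have sets_P[simp]: "sets P = sets borel" and space_P[simp]: "space P = UNIV"
    by (simp_all add: P_def space_scale_measure)
  have P: "prob_space P"
    by (rule prob_spaceI) (simp add: P_def emeasure_arclength_UNIV space_scale_measure flip: ennreal_mult)
  interpret P: prob_space P by (rule P)
  interpret PQ: product_sigma_finite "\<lambda>_ :: 'd. P" ..
  interpret Q: prob_space Q unfolding Q_def by (intro prob_space_PiM P)
  have vec_meas: "vec_lambda \<in> Q \<rightarrow>\<^sub>M borel"
  proof (subst borel_measurable_euclidean_space, rule ballI)
    fix b :: "complex ^ 'd" assume "b \<in> Basis"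
    then obtain k c where b: "b = axis k c" by (auto simp: Basis_vec_def)
    have "(\<lambda>x. x k) \<in> Q \<rightarrow>\<^sub>M P" unfolding Q_def by (rule measurable_component_singleton) simp
    then have "(\<lambda>x. x k) \<in> Q \<rightarrow>\<^sub>M borel" by (simp cong: measurable_cong_sets)
    then show "(\<lambda>x. vec_lambda x \<bullet> b) \<in> borel_measurable Q" by (simp add: b inner_axis)
  qed
  have "prob_space (torus_measure :: (complex ^ 'd) measure)"
    unfolding M using vec_meas by (rule Q.prob_space_distr)
  then interpret T: prob_space "torus_measure :: (complex ^ 'd) measure" .
  have P_rot: "emeasure P ((*) u -` A) = emeasure P A" if "cmod u = 1" "A \<in> sets borel" for u A
  proof -
    have "emeasure arclength A = emeasure (distr arclength borel ((*) u)) A"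
      using that by (simp add: arclength_rotation_invariant)
    also have "\<dots> = emeasure arclength ((*) u -` A)"
      using that by (subst emeasure_distr) (auto simp: measurable_arclength_iff)
    finally show ?thesis by (simp add: P_def)
  qed
  define S :: "(complex ^ 'd) set" where "S = {z. \<forall>k. cmod (vec_nth z k) = 1}"
  have AE_P: "AE z in P. cmod z = 1"
    by (rule AE_I[of _ _ "{z. cmod z \<noteq> 1}"]) (auto simp: P_def emeasure_arclength_off_circle)
  have "AE x in Q. cmod (x k) = 1" for k
    unfolding Q_def using P AE_P by (intro AE_PiM_component) auto
  then have "AE x in Q. \<forall>k. cmod (x k) = 1" by (intro AE_all_countable[THEN iffD2]) auto
  moreover have S_sets: "S \<in> sets borel"
  proof -
    have "closed S" unfolding S_def by (intro closed_Collect_all closed_Collect_eq continuous_intros)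
    then show ?thesis by simp
  qed
  ultimately have AE_S: "AE z in torus_measure. z \<in> S"
    unfolding M using vec_meas by (subst AE_distr_iff) (auto simp: S_def)
  obtain i j :: 'd where ij: "i \<noteq> j"
    using assms card_le_Suc0_iff_eq[of "UNIV :: 'd set"] by fastforce
  show ?thesis
  proof (rule not_gleason_whitney_boundary_functions[OF _ _ _ S_sets AE_S _ _ ij])
    show "finite_measure (torus_measure :: (complex ^ 'd) measure)" by (rule T.finite_measure_axioms)
    show "distr torus_measure borel (coord_rot \<theta>) = torus_measure" if \<theta>: "\<And>k. cmod (\<theta> k) = 1"
      for \<theta> :: "'d \<Rightarrow> complex"
    proof -
      define R where "R x = (\<lambda>k. \<theta> k * x k)" for x :: "'d \<Rightarrow> complex"
      have R: "R \<in> Q \<rightarrow>\<^sub>M Q"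
      proof -
        have "(\<lambda>x. \<theta> k * x k) \<in> Q \<rightarrow>\<^sub>M P" for k
        proof -
          have "(\<lambda>x. x k) \<in> Q \<rightarrow>\<^sub>M P" unfolding Q_def by (rule measurable_component_singleton) simp
          then have "(\<lambda>x. x k) \<in> Q \<rightarrow>\<^sub>M borel" by (simp cong: measurable_cong_sets)
          then have "(\<lambda>x. \<theta> k * x k) \<in> Q \<rightarrow>\<^sub>M borel" by measurable
          then show ?thesis by (simp cong: measurable_cong_sets)
        qed
        then show ?thesis unfolding R_def by (subst (2) Q_def) (intro measurable_PiM_single', auto)
      qed
      have "distr Q Q R = Q"
        unfolding Q_def
      proof (rule PQ.PiM_eqI)
        fix A :: "'d \<Rightarrow> complex set" assume "\<And>k. k \<in> UNIV \<Longrightarrow> A k \<in> sets P"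
        then have A: "A k \<in> sets borel" for k by simp
        have "Pi\<^sub>E UNIV A \<in> sets Q" unfolding Q_def using A by (intro sets_PiM_I_finite) auto
        then have "emeasure (distr Q Q R) (Pi\<^sub>E UNIV A) = emeasure Q (R -` Pi\<^sub>E UNIV A \<inter> space Q)"
          using R by (intro emeasure_distr)
        also have "R -` Pi\<^sub>E UNIV A \<inter> space Q = Pi\<^sub>E UNIV (\<lambda>k. (*) (\<theta> k) -` A k)"
          by (auto simp: R_def PiE_def Pi_def Q_def space_PiM)
        also have "emeasure Q \<dots> = (\<Prod>k\<in>UNIV. emeasure P ((*) (\<theta> k) -` A k))"
        proof -
          have "(*) (\<theta> k) -` A k \<in> sets P" for k
            using measurable_sets[of "(*) (\<theta> k)" borel borel "A k"] A[of k] by simp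
          then show ?thesis unfolding Q_def by (intro PQ.emeasure_PiM) auto
        qed
        also have "\<dots> = (\<Prod>k\<in>UNIV. emeasure P (A k))" using P_rot[OF \<theta> A] by simp
        finally show "emeasure (distr (Pi\<^sub>M UNIV (\<lambda>_. P)) (Pi\<^sub>M UNIV (\<lambda>_. P)) R) (Pi\<^sub>E UNIV A) = (\<Prod>k\<in>UNIV. emeasure P (A k))"
          by (simp add: Q_def)
      qed auto
      moreover have "coord_rot \<theta> \<circ> vec_lambda = vec_lambda \<circ> R"
        by (auto simp: coord_rot_def R_def)
      ultimately show ?thesis
        unfolding M distr_distr[OF coord_rot_measurable vec_meas]
        using distr_distr[OF vec_meas R] by simp
    qed
    show "c *s z \<in> S" if "cmod c = 1" "z \<in> S" for c z
      using that by (simp add: S_def norm_mult)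
    show "c *s z \<in> polydisc" if "cmod c < 1" "z \<in> S" for c z
      using that by (simp add: S_def polydisc_def norm_mult)
    have "AE z in torus_measure. vec_nth z i \<noteq> 0 \<and> vec_nth z j \<noteq> 0"
      using AE_S by eventually_elim (auto simp: S_def dest: spec[of _ i] spec[of _ j])
    moreover have "{z :: complex ^ 'd. vec_nth z i \<noteq> 0 \<and> vec_nth z j \<noteq> 0} \<in> sets torus_measure"
    proof -
      have "open {z :: complex ^ 'd. vec_nth z i \<noteq> 0 \<and> vec_nth z j \<noteq> 0}"
        by (intro open_Collect_conj open_Collect_neq continuous_intros)
      then show ?thesis by (simp add: torus_measure_def)
    qed
    ultimately have "measure torus_measure {z :: complex ^ 'd. vec_nth z i \<noteq> 0 \<and> vec_nth z j \<noteq> 0} = 1"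
      by (subst T.prob_eq_1) auto
    then show "0 < measure torus_measure {z :: complex ^ 'd. vec_nth z i \<noteq> 0 \<and> vec_nth z j \<noteq> 0}" by simp
  qed (simp add: torus_measure_def)
qed

section \<open>Boundary values on the circle\<close>

lemma finite_measure_arclength: "finite_measure arclength"
  by (rule finite_measureI) (simp add: emeasure_arclength_UNIV)

lemma AE_arclength_unit: "AE \<zeta> in arclength. cmod \<zeta> = 1"
  by (rule AE_I[of _ _ "{z. cmod z \<noteq> 1}"]) (auto simp: emeasure_arclength_off_circle)

text \<open>
  The Cauchy integral of boundary values, which recovers a bounded holomorphic function. It is
  linear in \<open>g\<close> by its form, so functionals on a space of boundary functions can be defined
  through point evaluations without choosing extensions into the disc.
\<close>

definition cauchy_transform :: "(complex \<Rightarrow> complex) \<Rightarrow> complex \<Rightarrow> complex" where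
  "cauchy_transform g z = (\<integral>\<zeta>. g \<zeta> * (\<zeta> / (\<zeta> - z) / of_real (2 * pi)) \<partial>arclength)"

lemma cauchy_kernel_bound:
  assumes "cmod z < 1" "cmod \<zeta> = 1"
  shows "cmod (\<zeta> / (\<zeta> - z) / of_real (2 * pi)) \<le> 1 / (1 - cmod z)"
proof -
  have "1 - cmod z \<le> cmod (\<zeta> - z)" using norm_triangle_ineq2[of \<zeta> z] assms by simp
  moreover have "0 < 1 - cmod z" using assms by simp
  ultimately have "1 / cmod (\<zeta> - z) \<le> 1 / (1 - cmod z)" by (intro divide_left_mono mult_pos_pos) linarith+
  moreover have "1 / cmod (\<zeta> - z) / (2 * pi) \<le> 1 / cmod (\<zeta> - z) / 1"
    using pi_gt3 by (intro divide_left_mono) auto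
  moreover have "cmod (\<zeta> / (\<zeta> - z) / of_real (2 * pi)) = 1 / cmod (\<zeta> - z) / (2 * pi)"
    unfolding norm_divide norm_of_real using assms by simp
  ultimately show ?thesis by linarith
qed

lemma cauchy_kernel_measurable:
  "(\<lambda>\<zeta>. \<zeta> / (\<zeta> - z) / of_real (2 * pi)) \<in> borel_measurable arclength"
  unfolding measurable_arclength_iff by measurable

lemma cauchy_kernel_integrable:
  assumes "cmod z < 1"
  shows "integrable arclength (\<lambda>\<zeta>. \<zeta> / (\<zeta> - z) / complex_of_real (2 * pi))"
proof (rule finite_measure.integrable_const_bound[OF finite_measure_arclength])
  show "AE \<zeta> in arclength. cmod (\<zeta> / (\<zeta> - z) / complex_of_real (2 * pi)) \<le> 1 / (1 - cmod z)"
    using AE_arclength_unit by eventually_elim (rule cauchy_kernel_bound[OF assms])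
qed (rule cauchy_kernel_measurable)

lemma cauchy_transform_bound:
  assumes z: "cmod z < 1" and g: "g \<in> elements (Linf arclength)"
  shows "cmod (cauchy_transform g z) \<le> dnorm (Linf arclength) g * (2 * pi / (1 - cmod z))"
proof -
  have fin: "finite_measure arclength" by (rule finite_measure_arclength)
  have "cmod (cauchy_transform g z)
      \<le> dnorm (Linf arclength) g * (\<integral>\<zeta>. cmod (\<zeta> / (\<zeta> - z) / complex_of_real (2 * pi)) \<partial>arclength)"
    unfolding cauchy_transform_def using g cauchy_kernel_integrable[OF z] by (rule Linf_integral_mult_bound)
  also have "(\<integral>\<zeta>. cmod (\<zeta> / (\<zeta> - z) / complex_of_real (2 * pi)) \<partial>arclength) \<le> (\<integral>\<zeta>. 1 / (1 - cmod z) \<partial>(arclength :: complex measure))"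
  proof (rule integral_mono_AE)
    show "AE \<zeta> in arclength. cmod (\<zeta> / (\<zeta> - z) / complex_of_real (2 * pi)) \<le> 1 / (1 - cmod z)"
      using AE_arclength_unit by eventually_elim (rule cauchy_kernel_bound[OF z])
    show "integrable arclength (\<lambda>\<zeta>. cmod (\<zeta> / (\<zeta> - z) / complex_of_real (2 * pi)))"
      by (intro integrable_norm cauchy_kernel_integrable z)
    show "integrable arclength (\<lambda>\<zeta> :: complex. 1 / (1 - cmod z))" by (rule finite_measure.integrable_const[OF fin])
  qed
  also have "(\<integral>\<zeta>. 1 / (1 - cmod z) \<partial>(arclength :: complex measure)) = 2 * pi / (1 - cmod z)"
    using pi_ge_zero by (simp add: measure_def emeasure_arclength_UNIV)
  finally show ?thesis using dnorm_Linf_nonneg[of arclength g] by (simp add: mult_left_mono)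
qed

lemma cauchy_transform_holomorphic:
  assumes F: "F holomorphic_on cball 0 1" and F_meas: "F \<in> borel_measurable borel" and z: "cmod z < 1"
  shows "cauchy_transform F z = F z"
proof -
  let ?h = "\<lambda>t. F (cis t) * (cis t / (cis t - z) / of_real (2 * pi))"
  have ne: "cis t \<noteq> z" for t using z by (metis norm_cis less_irrefl)
  have contF: "continuous_on {0..2 * pi} (\<lambda>t. F (cis t))"
    by (intro continuous_on_compose2[OF holomorphic_on_imp_continuous_on[OF F]] continuous_intros) auto
  have cont: "continuous_on {0..2 * pi} ?h"
    by (intro continuous_intros contF) (use ne in auto)
  have "((\<lambda>u. F u / (u - z)) has_contour_integral (2 * of_real pi * \<i> * F z)) (part_circlepath 0 1 0 (2 * pi))"
    using Cauchy_integral_circlepath_simple[OF F, of z] z by (simp add: circlepath_def)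
  then have "((\<lambda>t. F (cis t) / (cis t - z) * \<i> * cis t) has_integral (2 * of_real pi * \<i> * F z)) {0..2 * pi}"
    by (simp add: has_contour_integral_part_circlepath_iff)
  from has_integral_mult_right[OF this, of "1 / (2 * of_real pi * \<i>)"]
  have hk: "(?h has_integral F z) {0..2 * pi}"
    by (simp add: mult_ac)
  have "integrable (lebesgue_on {0..2 * pi}) ?h"
    using cont by (intro continuous_imp_integrable_real) auto
  then have "(\<integral>t. ?h t \<partial>lebesgue_on {0..2 * pi}) = F z"
    using hk by (simp add: lebesgue_integral_eq_integral integral_unique)
  moreover have "cauchy_transform F z = (\<integral>t. ?h t \<partial>lebesgue_on {0..2 * pi})"
  proof -
    have "cis \<in> lebesgue_on {0..2 * pi} \<rightarrow>\<^sub>M borel"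
      by (intro continuous_imp_measurable_on_sets_lebesgue continuous_intros) auto
    then show ?thesis
      unfolding cauchy_transform_def arclength_def
      by (rule integral_distr) (intro borel_measurable_times F_meas, measurable)
  qed
  ultimately show ?thesis by simp
qed

text \<open>
  Apply Cauchy's formula to the dilates \<open>f (r z)\<close>, which are holomorphic across the circle, and
  let \<open>r\<close> tend to one.
\<close>

lemma cauchy_transform_radial_limit:
  assumes f: "f \<in> Hinf_disc" and g: "g \<in> borel_measurable arclength"
    and lim: "AE \<zeta> in arclength. ((\<lambda>r. f (r *\<^sub>R \<zeta>)) \<longlongrightarrow> g \<zeta>) (at_left 1)"
    and z: "cmod z < 1"
  shows "cauchy_transform g z = f z"
proof -
  have hol: "f holomorphic_on ball 0 1" and "\<exists>B. \<forall>z\<in>ball 0 1. cmod (f z) \<le> B"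
    using f by (simp_all add: Hinf_disc_def bounded_iff)
  then obtain B where B: "\<And>z. z \<in> ball 0 1 \<Longrightarrow> cmod (f z) \<le> B" by blast
  define r where "r m = 1 - 1 / real (Suc (Suc m))" for m
  have r: "0 < r m" "r m < 1" for m by (simp_all add: r_def)
  have r_lim: "r \<longlonglongrightarrow> 1"
    using tendsto_diff[OF tendsto_const LIMSEQ_Suc[OF lim_inverse_n'[THEN LIMSEQ_Suc]], of 1]
    by (simp add: divide_inverse r_def[abs_def])
  then have r_left: "filterlim r (at_left 1) sequentially"
    using r by (intro filterlim_at_withinI) auto
  \<comment> \<open>Set to zero off the closed disc, where \<open>f\<close> need not be measurable.\<close>
  define F where "F m \<zeta> = (if \<zeta> \<in> cball 0 1 then f (r m *\<^sub>R \<zeta>) else 0)" for m \<zeta>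
  have in_ball: "r m *\<^sub>R \<zeta> \<in> ball 0 1" if "\<zeta> \<in> cball 0 1" for m and \<zeta> :: complex
  proof -
    have "r m * cmod \<zeta> \<le> r m * 1" using that r[of m] by (intro mult_left_mono) auto
    then have "r m * cmod \<zeta> < 1" using r[of m] by linarith
    then show ?thesis using r[of m] by (simp add: abs_of_pos)
  qed
  have hol_r: "(\<lambda>\<zeta>. f (r m *\<^sub>R \<zeta>)) holomorphic_on cball 0 1" for m
  proof -
    have "f \<circ> (\<lambda>\<zeta>. of_real (r m) * \<zeta>) holomorphic_on cball 0 1"
      using in_ball by (intro holomorphic_on_compose_gen[OF _ hol] holomorphic_intros) (auto simp: scaleR_conv_of_real)
    then show ?thesis by (simp add: o_def scaleR_conv_of_real)
  qed
  have F_hol: "F m holomorphic_on cball 0 1" for m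
    using hol_r[of m] by (rule holomorphic_transform) (simp add: F_def)
  have F_meas: "F m \<in> borel_measurable borel" for m
    unfolding F_def using holomorphic_on_imp_continuous_on[OF hol_r]
    by (intro borel_measurable_continuous_on_if) auto
  have "(\<lambda>m. cauchy_transform (F m) z) \<longlonglongrightarrow> cauchy_transform g z"
    unfolding cauchy_transform_def
  proof (rule integral_dominated_convergence[where w = "\<lambda>_. \<bar>B\<bar> * (1 / (1 - cmod z))"])
    show "(\<lambda>\<zeta>. g \<zeta> * (\<zeta> / (\<zeta> - z) / of_real (2 * pi))) \<in> borel_measurable arclength"
      using g cauchy_kernel_measurable by (rule borel_measurable_times)
    show "(\<lambda>\<zeta>. F m \<zeta> * (\<zeta> / (\<zeta> - z) / of_real (2 * pi))) \<in> borel_measurable arclength" for m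
      using F_meas cauchy_kernel_measurable by (intro borel_measurable_times) (simp_all add: measurable_arclength_iff)
    show "integrable arclength (\<lambda>_ :: complex. \<bar>B\<bar> * (1 / (1 - cmod z)))"
      by (rule finite_measure.integrable_const[OF finite_measure_arclength])
    show "AE \<zeta> in arclength. cmod (F m \<zeta> * (\<zeta> / (\<zeta> - z) / of_real (2 * pi))) \<le> \<bar>B\<bar> * (1 / (1 - cmod z))" for m
      using AE_arclength_unit
    proof eventually_elim
      case (elim \<zeta>)
      then have "cmod (F m \<zeta>) \<le> \<bar>B\<bar>" using B[OF in_ball, of \<zeta> m] by (simp add: F_def)
      then show ?case
        unfolding norm_mult[of "F m \<zeta>"] using cauchy_kernel_bound[OF z elim] by (intro mult_mono) auto
    qed
    show "AE \<zeta> in arclength. (\<lambda>m. F m \<zeta> * (\<zeta> / (\<zeta> - z) / of_real (2 * pi))) \<longlonglongrightarrow> g \<zeta> * (\<zeta> / (\<zeta> - z) / of_real (2 * pi))"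
      using AE_arclength_unit lim
    proof eventually_elim
      case (elim \<zeta>)
      have "(\<lambda>m. f (r m *\<^sub>R \<zeta>)) \<longlonglongrightarrow> g \<zeta>" by (rule filterlim_compose[OF elim(2) r_left])
      then have "(\<lambda>m. F m \<zeta>) \<longlonglongrightarrow> g \<zeta>" using elim(1) by (simp add: F_def)
      then show ?case by (intro tendsto_mult tendsto_const)
    qed
  qed
  moreover have "cauchy_transform (F m) z = f (r m *\<^sub>R z)" for m
    using cauchy_transform_holomorphic[OF F_hol F_meas z, of m] z by (simp add: F_def)
  moreover have "(\<lambda>m. f (r m *\<^sub>R z)) \<longlonglongrightarrow> f z"
  proof (rule isCont_tendsto_compose[where g = f])
    show "isCont f z"
      using hol z by (intro continuous_on_interior[OF holomorphic_on_imp_continuous_on]) auto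
    show "(\<lambda>m. r m *\<^sub>R z) \<longlonglongrightarrow> z" using tendsto_scaleR[OF r_lim tendsto_const, of z] by simp
  qed
  ultimately show ?thesis by (simp add: LIMSEQ_unique)
qed

lemma le_if_powers_le:
  fixes a b K :: real
  assumes "0 \<le> a" "0 \<le> b" and le: "\<And>m. a ^ m \<le> b ^ m * K"
  shows "a \<le> b"
proof (rule ccontr)
  assume "\<not> a \<le> b"
  show False
  proof (cases "b = 0")
    case True
    then show False using le[of 1] \<open>\<not> a \<le> b\<close> by simp
  next
    case False
    then have "1 < a / b" using assms \<open>\<not> a \<le> b\<close> by simp
    then obtain m where "K < (a / b) ^ m" using real_arch_pow by blast
    then show False using le[of m] False assms by (simp add: power_divide field_simps)
  qed
qed

text \<open>
  The Cauchy integral alone gives this estimate with a constant that depends on \<open>z\<close>. Applied to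
  all powers of \<open>f\<close>, it gives the estimate with constant one, since the roots of the constant
  tend to one.
\<close>

lemma Hinf_disc_le_boundary_norm:
  assumes f: "f \<in> Hinf_disc" and g: "g \<in> elements (Linf arclength)"
    and lim: "AE \<zeta> in arclength. ((\<lambda>r. f (r *\<^sub>R \<zeta>)) \<longlongrightarrow> g \<zeta>) (at_left 1)"
    and z: "cmod z < 1"
  shows "cmod (f z) \<le> dnorm (Linf arclength) g"
proof (rule le_if_powers_le)
  let ?D = "dnorm (Linf arclength) g"
  fix m
  have gm: "(\<lambda>\<zeta>. g \<zeta> ^ m) \<in> borel_measurable arclength"
    using Linf_measurable[OF g] by (rule borel_measurable_power)
  have "AE \<zeta> in arclength. cmod (g \<zeta> ^ m) \<le> ?D ^ m"
    using Linf_AE_le_dnorm[OF g] by eventually_elim (simp add: norm_power power_mono)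
  with gm have mem: "(\<lambda>\<zeta>. g \<zeta> ^ m) \<in> elements (Linf arclength)"
    and le: "dnorm (Linf arclength) (\<lambda>\<zeta>. g \<zeta> ^ m) \<le> ?D ^ m"
    using dnorm_Linf_nonneg[of arclength g] by (auto intro: Linf_memI)
  have "(\<lambda>z. f z ^ m) \<in> Hinf_disc"
  proof -
    have "\<exists>B. \<forall>z\<in>ball 0 1. cmod (f z) \<le> B" using f by (simp add: Hinf_disc_def bounded_iff)
    then obtain B where "\<And>z. z \<in> ball 0 1 \<Longrightarrow> cmod (f z) \<le> B" by blast
    then have "\<forall>z\<in>ball 0 1. cmod (f z ^ m) \<le> B ^ m" by (simp add: norm_power power_mono)
    then have "bounded ((\<lambda>z. f z ^ m) ` ball 0 1)" unfolding bounded_iff by blast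
    moreover have "(\<lambda>z. f z ^ m) holomorphic_on ball 0 1" using f by (auto simp: Hinf_disc_def intro: holomorphic_intros)
    ultimately show ?thesis by (simp add: Hinf_disc_def)
  qed
  moreover have "AE \<zeta> in arclength. ((\<lambda>r. f (r *\<^sub>R \<zeta>) ^ m) \<longlongrightarrow> g \<zeta> ^ m) (at_left 1)"
    using lim by eventually_elim (rule tendsto_power)
  ultimately have "cauchy_transform (\<lambda>\<zeta>. g \<zeta> ^ m) z = f z ^ m"
    using gm z by (intro cauchy_transform_radial_limit)
  then have "cmod (f z) ^ m \<le> dnorm (Linf arclength) (\<lambda>\<zeta>. g \<zeta> ^ m) * (2 * pi / (1 - cmod z))"
    using cauchy_transform_bound[OF z mem] by (simp add: norm_power)
  also have "\<dots> \<le> ?D ^ m * (2 * pi / (1 - cmod z))"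
    using le z by (intro mult_right_mono) auto
  finally show "cmod (f z) ^ m \<le> ?D ^ m * (2 * pi / (1 - cmod z))" .
qed (simp_all add: dnorm_Linf_nonneg)

section \<open>Singular inner functions with dense singularities\<close>

text \<open>
  A multiple of the sum of the Herglotz kernels with poles at the \<open>(n + 1)\<close>-st roots of unity.
  For nonnegative weights its real part is nonnegative in the disc, and on the circle it
  vanishes.
\<close>

definition herglotz_term :: "(nat \<Rightarrow> real) \<Rightarrow> nat \<Rightarrow> complex \<Rightarrow> complex" where
  "herglotz_term \<epsilon> n z = of_real (\<epsilon> n) * ((1 + z ^ Suc n) / (1 - z ^ Suc n))"

definition herglotz_tail :: "(nat \<Rightarrow> real) \<Rightarrow> nat \<Rightarrow> complex \<Rightarrow> complex" where
  "herglotz_tail \<epsilon> i z = (\<Sum>n. herglotz_term \<epsilon> (n + i) z)"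

lemma Re_cayley:
  fixes w :: complex
  assumes "cmod w < 1"
  shows "0 \<le> Re ((1 + w) / (1 - w))"
proof -
  have "(1 + w) / (1 - w) = (1 + w) * cnj (1 - w) / of_real ((cmod (1 - w))\<^sup>2)"
    by (rule complex_div_cnj)
  moreover have "Re ((1 + w) * cnj (1 - w)) = 1 - (cmod w)\<^sup>2"
    by (simp add: cmod_def power2_eq_square algebra_simps)
  moreover have "(cmod w)\<^sup>2 \<le> 1" using assms by (simp add: power_le_one)
  ultimately show ?thesis by (simp add: Re_divide_of_real)
qed

text \<open>
  Moving a point of the circle radially inwards cannot bring it much closer to one: \<open>1 - s\<close> is
  the distance from \<open>s w\<close> to \<open>w\<close> and at most the distance from \<open>s w\<close> to one.
\<close>

lemma norm_one_minus_le:
  assumes "cmod w = 1" "0 \<le> s" "s \<le> 1"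
  shows "cmod (1 - w) \<le> 2 * cmod (1 - of_real s * w)"
proof -
  have "cmod (1 - w) \<le> cmod (1 - of_real s * w) + cmod (of_real s * w - w)"
    using norm_triangle_ineq[of "1 - of_real s * w" "of_real s * w - w"] by simp
  also have "cmod (of_real s * w - w) = cmod (of_real (s - 1) * w)" by (simp add: left_diff_distrib)
  also have "\<dots> = 1 - s" using assms by (simp add: norm_mult del: of_real_diff)
  also have "1 - s \<le> cmod (1 - of_real s * w)"
    using norm_triangle_ineq2[of 1 "of_real s * w"] assms by (simp add: norm_mult)
  finally show ?thesis by simp
qed

lemma herglotz_term_bound:
  assumes "\<epsilon> n \<ge> 0" "cmod z \<le> R" "R < 1"
  shows "cmod (herglotz_term \<epsilon> n z) \<le> \<epsilon> n * (2 / (1 - R))"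
proof -
  have "cmod z ^ Suc n \<le> cmod z" using assms by (simp add: mult_left_le power_le_one)
  then have zn: "cmod (z ^ Suc n) \<le> R" using assms by (simp only: norm_power)
  have "cmod (1 + z ^ Suc n) \<le> 2" using norm_triangle_ineq[of 1 "z ^ Suc n"] zn assms by simp
  moreover have "1 - R \<le> cmod (1 - z ^ Suc n)" using norm_triangle_ineq2[of 1 "z ^ Suc n"] zn by simp
  ultimately have "cmod ((1 + z ^ Suc n) / (1 - z ^ Suc n)) \<le> 2 / (1 - R)"
    unfolding norm_divide using assms by (intro frac_le) auto
  then show ?thesis
    unfolding herglotz_term_def using assms(1) by (simp only: norm_mult norm_of_real abs_of_nonneg mult_left_mono)
qed

text \<open>
  A bound that is uniform along a radius. It makes the radial limit of the sum of the terms
  exist wherever the series of the bounds converges.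
\<close>

lemma herglotz_term_radial_bound:
  assumes "\<epsilon> n \<ge> 0" "cmod \<zeta> = 1" "\<zeta> ^ Suc n \<noteq> 1" "0 \<le> r" "r \<le> 1"
  shows "cmod (herglotz_term \<epsilon> n (of_real r * \<zeta>)) \<le> \<epsilon> n * (4 / cmod (1 - \<zeta> ^ Suc n))"
    and "(of_real r * \<zeta>) ^ Suc n \<noteq> 1"
proof -
  let ?w = "(of_real r * \<zeta>) ^ Suc n"
  have w: "?w = of_real (r ^ Suc n) * \<zeta> ^ Suc n" by (simp only: power_mult_distrib of_real_power)
  have unit: "cmod (\<zeta> ^ Suc n) = 1" using assms(2) by (simp only: norm_power power_one)
  have rn: "0 \<le> r ^ Suc n" "r ^ Suc n \<le> 1" using assms(4,5) by (simp_all only: zero_le_power power_le_one)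
  have le: "cmod (1 - \<zeta> ^ Suc n) \<le> 2 * cmod (1 - ?w)"
    unfolding w by (rule norm_one_minus_le[OF unit rn])
  have pos: "0 < cmod (1 - \<zeta> ^ Suc n)" using assms(3) by (simp only: zero_less_norm_iff) simp
  then show "?w \<noteq> 1" using le by auto
  have "cmod ?w \<le> 1" unfolding w norm_mult unit using rn by (simp only: norm_of_real abs_of_nonneg mult_1_right)
  then have "cmod (1 + ?w) \<le> 2" using norm_triangle_ineq[of 1 ?w] by simp
  then have "cmod ((1 + ?w) / (1 - ?w)) \<le> 2 / (cmod (1 - \<zeta> ^ Suc n) / 2)"
    unfolding norm_divide using le pos by (intro frac_le) (auto simp del: power_Suc)
  then have "cmod ((1 + ?w) / (1 - ?w)) \<le> 4 / cmod (1 - \<zeta> ^ Suc n)" by simp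
  then show "cmod (herglotz_term \<epsilon> n (of_real r * \<zeta>)) \<le> \<epsilon> n * (4 / cmod (1 - \<zeta> ^ Suc n))"
    unfolding herglotz_term_def using assms(1) by (simp only: norm_mult norm_of_real abs_of_nonneg mult_left_mono)
qed

text \<open>
  All terms have nonnegative real part in the disc, so each one is a lower bound for the sum.
\<close>

lemma herglotz_tail_in_disc:
  assumes \<epsilon>: "\<And>n. \<epsilon> n \<ge> 0" "summable \<epsilon>" and z: "cmod z < 1"
  shows "summable (\<lambda>n. herglotz_term \<epsilon> (n + i) z)"
    and "0 \<le> Re (herglotz_tail \<epsilon> i z)"
    and "i \<le> n \<Longrightarrow> Re (herglotz_term \<epsilon> n z) \<le> Re (herglotz_tail \<epsilon> i z)"
proof -
  have "summable (\<lambda>n. herglotz_term \<epsilon> n z)"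
  proof (rule summable_comparison_test')
    show "summable (\<lambda>n. \<epsilon> n * (2 / (1 - cmod z)))" using \<epsilon>(2) by (rule summable_mult2)
    show "norm (herglotz_term \<epsilon> n z) \<le> \<epsilon> n * (2 / (1 - cmod z))" for n
      using \<epsilon>(1) z by (intro herglotz_term_bound) auto
  qed
  then show s: "summable (\<lambda>n. herglotz_term \<epsilon> (n + i) z)" by (rule summable_ignore_initial_segment)
  have pos: "0 \<le> Re (herglotz_term \<epsilon> n z)" for n
  proof -
    have "cmod (z ^ Suc n) < 1" using z by (simp only: norm_power) (simp only: power_less_one_iff norm_ge_zero, simp)
    then have "0 \<le> Re ((1 + z ^ Suc n) / (1 - z ^ Suc n))" by (rule Re_cayley)
    moreover have "0 \<le> Re (of_real (\<epsilon> n) * w)" if "0 \<le> Re w" for w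
      using that \<epsilon>(1)[of n] by simp
    ultimately show ?thesis unfolding herglotz_term_def by blast
  qed
  have Re: "Re (herglotz_tail \<epsilon> i z) = (\<Sum>n. Re (herglotz_term \<epsilon> (n + i) z))"
    unfolding herglotz_tail_def by (rule Re_suminf[OF s])
  have sRe: "summable (\<lambda>n. Re (herglotz_term \<epsilon> (n + i) z))" using s by (rule summable_Re)
  show "0 \<le> Re (herglotz_tail \<epsilon> i z)" unfolding Re using sRe pos by (intro suminf_nonneg) auto
  show "Re (herglotz_term \<epsilon> n z) \<le> Re (herglotz_tail \<epsilon> i z)" if "i \<le> n"
  proof -
    have "(\<Sum>k\<in>{n - i}. Re (herglotz_term \<epsilon> (k + i) z)) \<le> Re (herglotz_tail \<epsilon> i z)"
      unfolding Re using sRe pos by (intro sum_le_suminf) auto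
    then show ?thesis using that by simp
  qed
qed

lemma herglotz_tail_holomorphic:
  assumes \<epsilon>: "\<And>n. \<epsilon> n \<ge> 0" "summable \<epsilon>"
  shows "herglotz_tail \<epsilon> i holomorphic_on ball 0 1"
proof (rule holomorphic_uniform_sequence[OF open_ball])
  have ne: "z ^ Suc n \<noteq> 1" if "cmod z < 1" for z :: complex and n
  proof
    assume "z ^ Suc n = 1"
    then have "cmod z ^ Suc n = 1" by (metis norm_one norm_power)
    moreover have "cmod z ^ Suc n < 1" using that by (simp only: power_less_one_iff norm_ge_zero) simp
    ultimately show False by simp
  qed
  show "(\<lambda>z. \<Sum>n<N. herglotz_term \<epsilon> (n + i) z) holomorphic_on ball 0 1" for N
    unfolding herglotz_term_def using ne by (intro holomorphic_intros) (auto simp del: power_Suc)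
  fix x :: complex assume x: "x \<in> ball 0 1"
  define R where "R = (1 + cmod x) / 2"
  have R: "R < 1" using x by (simp add: R_def)
  have "cmod z \<le> R" if "z \<in> cball x ((1 - cmod x) / 2)" for z
    using that norm_triangle_ineq2[of z x] by (simp add: R_def dist_norm norm_minus_commute field_simps)
  moreover from this have "cball x ((1 - cmod x) / 2) \<subseteq> ball 0 1" using R by force
  moreover have "uniform_limit (cball x ((1 - cmod x) / 2)) (\<lambda>N z. \<Sum>n<N. herglotz_term \<epsilon> (n + i) z) (herglotz_tail \<epsilon> i) sequentially"
    unfolding herglotz_tail_def[abs_def]
  proof (rule Weierstrass_m_test)
    show "summable (\<lambda>n. \<epsilon> (n + i) * (2 / (1 - R)))"
      using \<epsilon>(2) by (intro summable_mult2 summable_ignore_initial_segment)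
    show "norm (herglotz_term \<epsilon> (n + i) z) \<le> \<epsilon> (n + i) * (2 / (1 - R))" if "z \<in> cball x ((1 - cmod x) / 2)" for n z
      using \<epsilon>(1) calculation(1)[OF that] R by (intro herglotz_term_bound)
  qed
  ultimately show "\<exists>d>0. cball x d \<subseteq> ball 0 1 \<and>
      uniform_limit (cball x d) (\<lambda>N z. \<Sum>n<N. herglotz_term \<epsilon> (n + i) z) (herglotz_tail \<epsilon> i) sequentially"
    using x by (intro exI[of _ "(1 - cmod x) / 2"]) auto
qed

text \<open>
  Uniform convergence on the closed radius makes the sum continuous up to the circle; the
  tails of the convergent series on the circle tend to zero.
\<close>

lemma herglotz_tail_radial_limit:
  assumes \<epsilon>: "\<And>n. \<epsilon> n \<ge> 0" and \<zeta>: "cmod \<zeta> = 1" "\<And>n. \<zeta> ^ Suc n \<noteq> 1"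
    and s: "summable (\<lambda>n. \<epsilon> n * (4 / cmod (1 - \<zeta> ^ Suc n)))"
  shows "((\<lambda>r. herglotz_tail \<epsilon> i (r *\<^sub>R \<zeta>)) \<longlongrightarrow> herglotz_tail \<epsilon> i \<zeta>) (at_left 1)"
    and "(\<lambda>i. herglotz_tail \<epsilon> i \<zeta>) \<longlonglongrightarrow> 0"
proof -
  have ul: "uniform_limit {0..1} (\<lambda>N r. \<Sum>n<N. herglotz_term \<epsilon> (n + i) (of_real r * \<zeta>))
      (\<lambda>r. herglotz_tail \<epsilon> i (of_real r * \<zeta>)) sequentially"
    unfolding herglotz_tail_def
  proof (rule Weierstrass_m_test)
    show "summable (\<lambda>n. \<epsilon> (n + i) * (4 / cmod (1 - \<zeta> ^ Suc (n + i))))"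
      using s by (rule summable_ignore_initial_segment)
    show "norm (herglotz_term \<epsilon> (n + i) (of_real r * \<zeta>)) \<le> \<epsilon> (n + i) * (4 / cmod (1 - \<zeta> ^ Suc (n + i)))"
      if "r \<in> {0..1}" for n r using \<epsilon> \<zeta> that by (intro herglotz_term_radial_bound) auto
  qed
  have "continuous_on {0..1} (\<lambda>r. \<Sum>n<N. herglotz_term \<epsilon> (n + i) (of_real r * \<zeta>))" for N
    unfolding herglotz_term_def using herglotz_term_radial_bound(2)[of \<epsilon>, OF \<epsilon> \<zeta>(1) \<zeta>(2)]
    by (intro continuous_intros) (auto simp del: power_Suc)
  then have "continuous_on {0..1} (\<lambda>r. herglotz_tail \<epsilon> i (of_real r * \<zeta>))"
    by (intro uniform_limit_theorem[OF always_eventually ul]) auto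
  then have "((\<lambda>r. herglotz_tail \<epsilon> i (of_real r * \<zeta>)) \<longlongrightarrow> herglotz_tail \<epsilon> i (of_real 1 * \<zeta>)) (at 1 within {0..1})"
    unfolding continuous_on_def by (rule bspec[where x = "1 :: real"]) simp
  then show "((\<lambda>r. herglotz_tail \<epsilon> i (r *\<^sub>R \<zeta>)) \<longlongrightarrow> herglotz_tail \<epsilon> i \<zeta>) (at_left 1)"
    by (simp add: scaleR_conv_of_real at_within_Icc_at_left)
  have "summable (\<lambda>n. herglotz_term \<epsilon> n \<zeta>)"
    using herglotz_term_radial_bound(1)[of \<epsilon>, OF \<epsilon> \<zeta>(1) \<zeta>(2), of 1]
    by (intro summable_comparison_test'[OF s]) auto
  note sm = this
  have "herglotz_tail \<epsilon> i \<zeta> = (\<Sum>n. herglotz_term \<epsilon> n \<zeta>) - (\<Sum>n<i. herglotz_term \<epsilon> n \<zeta>)" for i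
    unfolding herglotz_tail_def using suminf_split_initial_segment[OF sm, of i] by simp
  moreover have "(\<lambda>i. (\<Sum>n. herglotz_term \<epsilon> n \<zeta>) - (\<Sum>n<i. herglotz_term \<epsilon> n \<zeta>)) \<longlonglongrightarrow> 0"
    using tendsto_diff[OF tendsto_const summable_LIMSEQ[OF sm], of "\<Sum>n. herglotz_term \<epsilon> n \<zeta>"] by simp
  ultimately show "(\<lambda>i. herglotz_tail \<epsilon> i \<zeta>) \<longlonglongrightarrow> 0" by simp
qed

lemma herglotz_tail_measurable: "herglotz_tail \<epsilon> i \<in> borel_measurable borel"
  unfolding herglotz_tail_def[abs_def] herglotz_term_def[abs_def] by measurable

text \<open>
  Only countably many angles are mapped to roots of unity.
\<close>

lemma emeasure_arclength_roots_of_unity: "emeasure arclength {\<zeta>. \<zeta> ^ Suc n = 1} = 0"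
proof -
  define A where "A = range (\<lambda>k :: int. 2 * of_int k * pi / real (Suc n))"
  have A: "t \<in> A" if "cis t ^ Suc n = 1" for t
  proof -
    have "exp (\<i> * of_real (real (Suc n) * t)) = 1"
      using that Complex.DeMoivre[of t "Suc n"] by (simp only: cis_conv_exp)
    then obtain k :: int where "real (Suc n) * t = of_int (2 * k) * pi"
      unfolding exp_eq_1 by auto
    then have "t = 2 * of_int k * pi / real (Suc n)" by (simp add: eq_divide_eq mult.commute del: of_nat_Suc)
    then show ?thesis by (simp add: A_def)
  qed
  have "countable A" unfolding A_def by simp
  then have "emeasure lborel A = 0" "A \<in> sets lborel"
    using emeasure_lborel_countable by (auto intro: sets.countable)
  then have AE: "AE t in lborel. t \<notin> A" by (intro AE_not_in null_setsI)
  have "closed {\<zeta> :: complex. \<zeta> ^ Suc n = 1}" by (intro closed_Collect_eq continuous_intros)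
  then have "emeasure arclength {\<zeta>. \<zeta> ^ Suc n = 1}
      = (\<integral>\<^sup>+t. indicator {0..2 * pi} t * indicator {\<zeta>. \<zeta> ^ Suc n = 1} (cis t) \<partial>lborel)"
    by (intro emeasure_arclength) simp
  also have "\<dots> = (\<integral>\<^sup>+t. 0 \<partial>(lborel :: real measure))"
    by (rule nn_integral_cong_AE) (use AE A in \<open>auto elim!: eventually_mono simp: indicator_def simp del: power_Suc\<close>)
  finally show ?thesis by simp
qed

text \<open>
  For each \<open>n\<close> the set where \<open>|1 - \<zeta>\<^bsup>n+1\<^esup>| \<le> d\<close> shrinks to a null set as \<open>d\<close> tends to zero, so it
  has measure less than \<open>2\<^bsup>-n\<^esup>\<close> for some \<open>d = d\<^sub>n\<close>. By Borel--Cantelli almost every \<open>\<zeta>\<close> avoids these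
  sets from some \<open>n\<close> on, and for weights \<open>\<epsilon>\<^sub>n = d\<^sub>n 2\<^bsup>-n-1\<^esup>\<close> the series is then dominated by a
  geometric one.
\<close>

lemma summable_weights_exist:
  "\<exists>\<epsilon> :: nat \<Rightarrow> real. (\<forall>n. 0 < \<epsilon> n \<and> \<epsilon> n < 1) \<and> summable \<epsilon> \<and>
     (AE \<zeta> in arclength. (\<forall>n. \<zeta> ^ Suc n \<noteq> 1) \<and> summable (\<lambda>n. \<epsilon> n * (4 / cmod (1 - \<zeta> ^ Suc n))))"
proof -
  interpret finite_measure arclength by (rule finite_measure_arclength)
  define A where "A n d = {\<zeta> :: complex. cmod (1 - \<zeta> ^ Suc n) \<le> d}" for n and d :: real
  have A_sets: "A n d \<in> sets arclength" for n d
  proof -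
    have "closed (A n d)" unfolding A_def by (intro closed_Collect_le continuous_intros)
    then show ?thesis by simp
  qed
  have "\<exists>d. 0 < d \<and> d \<le> 1 \<and> measure arclength (A n d) < (1/2) ^ n" for n
  proof -
    have "(\<lambda>k. measure arclength (A n (1 / real (Suc k)))) \<longlonglongrightarrow> measure arclength (\<Inter>k. A n (1 / real (Suc k)))"
    proof (rule finite_Lim_measure_decseq)
      show "decseq (\<lambda>k. A n (1 / real (Suc k)))"
        by (rule decseq_SucI) (auto simp: A_def elim!: order_trans intro!: divide_left_mono)
    qed (use A_sets in auto)
    also have "(\<Inter>k. A n (1 / real (Suc k))) = {\<zeta>. \<zeta> ^ Suc n = 1}"
    proof -
      have "w = 1" if "\<And>k. cmod (1 - w) \<le> 1 / real (Suc k)" for w :: complex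
      proof (rule ccontr)
        assume "w \<noteq> 1"
        then obtain k where "1 / real (Suc k) < cmod (1 - w)" using nat_approx_posE[of "cmod (1 - w)"] by auto
        then show False using that[of k] by simp
      qed
      then show ?thesis unfolding A_def by (auto simp del: power_Suc of_nat_Suc)
    qed
    also have "measure arclength {\<zeta>. \<zeta> ^ Suc n = 1} = 0"
      by (simp only: measure_def emeasure_arclength_roots_of_unity) simp
    finally have "eventually (\<lambda>k. measure arclength (A n (1 / real (Suc k))) < (1/2) ^ n) sequentially"
      by (rule order_tendstoD) simp
    then obtain k where "measure arclength (A n (1 / real (Suc k))) < (1/2) ^ n"
      by (auto simp: eventually_sequentially)
    then show ?thesis by (intro exI[of _ "1 / real (Suc k)"]) simp
  qed
  then obtain d where d: "\<And>n. 0 < d n" "\<And>n. d n \<le> 1" "\<And>n. measure arclength (A n (d n)) < (1/2) ^ n"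
    by metis
  define \<epsilon> where "\<epsilon> n = d n * (1/2) ^ Suc n" for n
  have geo: "summable (\<lambda>n. (1/2 :: real) ^ n)" by (rule summable_geometric) simp
  have \<epsilon>: "0 < \<epsilon> n" "\<epsilon> n \<le> (1/2) ^ Suc n" for n
    using d(1,2)[of n] by (simp_all add: \<epsilon>_def)
  have "summable (\<lambda>n. measure arclength (A n (d n)))"
    by (rule summable_comparison_test'[OF geo]) (use d(3) in \<open>auto intro: less_imp_le\<close>)
  then have "AE \<zeta> in arclength. eventually (\<lambda>n. \<zeta> \<in> space arclength - A n (d n)) sequentially"
    using A_sets by (intro borel_cantelli_AE1) (auto simp: emeasure_eq_measure)
  moreover have "AE \<zeta> in arclength. \<forall>n. \<zeta> ^ Suc n \<noteq> 1"
  proof (subst AE_all_countable, intro allI)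
    fix n
    have "closed {\<zeta> :: complex. \<zeta> ^ Suc n = 1}" by (intro closed_Collect_eq continuous_intros)
    then show "AE \<zeta> in arclength. \<zeta> ^ Suc n \<noteq> 1"
      using emeasure_arclength_roots_of_unity[of n]
      by (intro AE_I[of _ _ "{\<zeta>. \<zeta> ^ Suc n = 1}"]) (auto simp del: power_Suc)
  qed
  ultimately have "AE \<zeta> in arclength. (\<forall>n. \<zeta> ^ Suc n \<noteq> 1) \<and> summable (\<lambda>n. \<epsilon> n * (4 / cmod (1 - \<zeta> ^ Suc n)))"
  proof eventually_elim
    case (elim \<zeta>)
    have "eventually (\<lambda>n. norm (\<epsilon> n * (4 / cmod (1 - \<zeta> ^ Suc n))) \<le> 4 * (1/2) ^ n) sequentially"
      using elim(1)
    proof eventually_elim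
      case (elim n)
      then have "d n < cmod (1 - \<zeta> ^ Suc n)" by (simp add: A_def del: power_Suc)
      then have "\<epsilon> n * (4 / cmod (1 - \<zeta> ^ Suc n)) \<le> \<epsilon> n * (4 / d n)"
        using \<epsilon>(1)[of n] d(1)[of n] by (intro mult_left_mono divide_left_mono mult_pos_pos) linarith+
      also have "\<dots> = 4 * (1/2) ^ Suc n" using d(1)[of n] by (simp add: \<epsilon>_def)
      also have "\<dots> \<le> 4 * (1/2) ^ n" by simp
      finally show ?case using \<epsilon>(1)[of n] by (simp del: power_Suc)
    qed
    then have "summable (\<lambda>n. \<epsilon> n * (4 / cmod (1 - \<zeta> ^ Suc n)))"
      by (rule summable_comparison_test_ev) (rule summable_mult[OF geo])
    then show ?case using elim(2) by blast
  qed
  moreover have "summable \<epsilon>"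
  proof (rule summable_comparison_test')
    show "summable (\<lambda>n. (1/2 :: real) ^ Suc n)" using geo by (rule summable_Suc_iff[THEN iffD2])
    show "norm (\<epsilon> n) \<le> (1/2) ^ Suc n" for n using \<epsilon>[of n] by (simp only: real_norm_def abs_of_pos)
  qed
  moreover have "\<epsilon> n < 1" for n
  proof -
    have "(1/2 :: real) ^ Suc n < 1" by (simp only: power_less_one_iff) simp
    then show ?thesis using \<epsilon>(2)[of n] by linarith
  qed
  ultimately show ?thesis using \<epsilon>(1) by blast
qed

section \<open>The disc algebra\<close>

lemma cauchy_transform_le_dnorm:
  assumes "g \<in> boundary_functions arclength Hinf_disc" "cmod z < 1"
  shows "cmod (cauchy_transform g z) \<le> dnorm (Linf arclength) g"
proof -
  obtain f where f: "f \<in> Hinf_disc" "AE \<zeta> in arclength. ((\<lambda>r. f (r *\<^sub>R \<zeta>)) \<longlongrightarrow> g \<zeta>) (at_left 1)"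
    and g: "g \<in> elements (Linf arclength)"
    using assms(1) by (auto simp: boundary_functions_def)
  then show ?thesis
    using cauchy_transform_radial_limit[OF f(1) Linf_measurable[OF g] f(2) assms(2)]
      Hinf_disc_le_boundary_norm[OF f(1) g f(2) assms(2)] by simp
qed

text \<open>
  The functions \<open>S i\<close> are singular inner functions. The radius \<open>r n\<close> is chosen with \<open>r n\<^bsup>n+1\<^esup> = \<rho> n\<close>
  and \<open>1 - \<rho> n = \<epsilon> n / (n + 1)\<close>, so that at the nodes of \<open>\<omega> n\<close> the \<open>n\<close>-th term of the exponent is at
  least \<open>n + 1\<close>. Hence \<open>|S i| \<le> e\<^bsup>-(n+1)\<^esup>\<close> at all nodes as soon as \<open>n \<ge> i\<close>, although \<open>S i\<close> tends to
  one almost everywhere on the circle.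
\<close>

lemma not_gleason_whitney_disc_algebra:
  "\<not> gleason_whitney (Linf arclength) (boundary_functions arclength disc_algebra)
      (boundary_functions arclength Hinf_disc)"
proof -
  let ?Y = "boundary_functions arclength Hinf_disc"
  obtain \<epsilon> :: "nat \<Rightarrow> real" where \<epsilon>: "\<And>n. 0 < \<epsilon> n" "\<And>n. \<epsilon> n < 1" "summable \<epsilon>"
    and good: "AE \<zeta> in arclength. (\<forall>n. \<zeta> ^ Suc n \<noteq> 1) \<and> summable (\<lambda>n. \<epsilon> n * (4 / cmod (1 - \<zeta> ^ Suc n)))"
    using summable_weights_exist by blast
  have \<epsilon>0: "0 \<le> \<epsilon> n" for n using \<epsilon>(1)[of n] by simp
  define S where "S i z = exp (- herglotz_tail \<epsilon> i z)" for i z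
  define \<rho> where "\<rho> n = 1 - \<epsilon> n / real (Suc n)" for n
  have \<rho>: "0 < \<rho> n" "\<rho> n < 1" for n
  proof -
    have "\<epsilon> n < real (Suc n)" using \<epsilon>(2)[of n] by (rule less_le_trans) simp
    then show "0 < \<rho> n" "\<rho> n < 1" using \<epsilon>(1)[of n] by (simp_all add: \<rho>_def del: of_nat_Suc)
  qed
  define r where "r n = root (Suc n) (\<rho> n)" for n
  have r: "0 < r n" "r n < 1" "r n ^ Suc n = \<rho> n" for n
    using \<rho>[of n] real_root_lt_1_iff[of "Suc n" "\<rho> n"] by (simp_all add: r_def del: power_Suc)
  have S_le: "cmod (S i z) \<le> 1" if "cmod z < 1" for i z
    using herglotz_tail_in_disc(2)[OF \<epsilon>0 \<epsilon>(3) that] by (simp add: S_def norm_exp_eq_Re)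
  have S_small: "cmod (S i z) \<le> exp (- real (Suc n))" if z: "cmod z < 1" "z ^ Suc n = of_real (\<rho> n)" and "i \<le> n" for i n z
  proof -
    have "real (Suc n) \<le> real (Suc n) * (1 + \<rho> n)" using \<rho>[of n] by (simp del: of_nat_Suc)
    also have "\<dots> = \<epsilon> n * ((1 + \<rho> n) / (1 - \<rho> n))" 
    proof -
      have "1 - \<rho> n = \<epsilon> n / real (Suc n)" by (simp add: \<rho>_def)
      then show ?thesis using \<epsilon>(1)[of n] by (simp only:) simp
    qed
    also have "\<dots> = Re (herglotz_term \<epsilon> n z)"
    proof -
      have "herglotz_term \<epsilon> n z = of_real (\<epsilon> n * ((1 + \<rho> n) / (1 - \<rho> n)))"
        unfolding herglotz_term_def z(2) by simp
      then show ?thesis by (simp only: Re_complex_of_real)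
    qed
    also have "\<dots> \<le> Re (herglotz_tail \<epsilon> i z)"
      by (rule herglotz_tail_in_disc(3)[OF \<epsilon>0 \<epsilon>(3) z(1) \<open>i \<le> n\<close>])
    finally show ?thesis by (simp add: S_def norm_exp_eq_Re)
  qed
  have S_Hinf: "S i \<in> Hinf_disc" for i
  proof -
    have "S i holomorphic_on ball 0 1"
      unfolding S_def[abs_def] by (intro holomorphic_intros herglotz_tail_holomorphic \<epsilon>0 \<epsilon>(3))
    then show ?thesis using S_le by (auto simp: Hinf_disc_def bounded_iff intro!: exI[of _ 1])
  qed
  have S_meas: "S i \<in> borel_measurable arclength" for i
  proof -
    have "(\<lambda>z :: complex. exp (- z)) \<in> borel_measurable borel"
      by (intro borel_measurable_continuous_onI continuous_intros)
    then show ?thesis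
      unfolding S_def[abs_def] measurable_arclength_iff
      by (rule measurable_compose[OF herglotz_tail_measurable])
  qed
  have S_lim: "AE \<zeta> in arclength. ((\<lambda>r. S i (r *\<^sub>R \<zeta>)) \<longlongrightarrow> S i \<zeta>) (at_left 1)" for i
    using AE_arclength_unit good
  proof eventually_elim
    case (elim \<zeta>)
    then show ?case
      unfolding S_def by (intro tendsto_exp tendsto_minus herglotz_tail_radial_limit(1)) (auto simp: \<epsilon>0 simp del: power_Suc)
  qed
  have S_one: "AE \<zeta> in arclength. (\<lambda>i. S i \<zeta>) \<longlonglongrightarrow> 1"
    using AE_arclength_unit good
  proof eventually_elim
    case (elim \<zeta>)
    then have "(\<lambda>i. herglotz_tail \<epsilon> i \<zeta>) \<longlonglongrightarrow> 0"
      by (intro herglotz_tail_radial_limit(2)) (auto simp: \<epsilon>0 simp del: power_Suc)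
    from tendsto_exp[OF tendsto_minus[OF this]] show ?case by (simp add: S_def)
  qed
  \<comment> \<open>The bound in the disc passes to the radial limits.\<close>
  have S_bound: "AE \<zeta> in arclength. cmod (S i \<zeta>) \<le> 1" for i
    using AE_arclength_unit S_lim[of i]
  proof eventually_elim
    case (elim \<zeta>)
    have "eventually (\<lambda>r :: real. r \<in> {0<..<1}) (at_left 1)" by (rule eventually_at_leftI[of 0]) auto
    then have "eventually (\<lambda>r. cmod (S i (r *\<^sub>R \<zeta>)) \<le> 1) (at_left 1)"
      by (rule eventually_mono) (use elim(1) in \<open>auto intro!: S_le\<close>)
    then show ?case using tendsto_upperbound[OF tendsto_norm[OF elim(2)]] by simp
  qed
  have S_Y: "S i \<in> ?Y" for i
    using S_Hinf S_lim Linf_memI(1)[OF S_meas S_bound] by (auto simp: boundary_functions_def)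
  have one_disc: "(\<lambda>_. 1) \<in> disc_algebra"
    unfolding disc_algebra_def by (auto simp: Hinf_disc_def bounded_iff intro!: exI[of _ 1])
  have one_X: "(\<lambda>_. 1) \<in> boundary_functions arclength disc_algebra"
    by (rule one_in_boundary_functions[OF one_disc])
  have XY: "boundary_functions arclength disc_algebra \<subseteq> ?Y"
    by (auto simp: boundary_functions_def disc_algebra_def)
  \<comment> \<open>The Cauchy transform makes these functionals linear on boundary functions by construction.\<close>
  define \<omega> where "\<omega> n g = root_avg (Suc n) (cauchy_transform g) (of_real (r n))" for n g
  have node: "cmod (cis t * of_real (r n)) < 1" for t n using r[of n] by (simp add: norm_mult)
  have ct_of: "cauchy_transform g z = f z"
    if "f \<in> Hinf_disc" "g \<in> elements (Linf arclength)" "AE \<zeta> in arclength. ((\<lambda>r. f (r *\<^sub>R \<zeta>)) \<longlongrightarrow> g \<zeta>) (at_left 1)" "cmod z < 1"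
    for f g z using that by (intro cauchy_transform_radial_limit Linf_measurable)
  have \<omega>_of: "\<omega> n g = root_avg (Suc n) f (of_real (r n))"
    if "f \<in> Hinf_disc" "g \<in> elements (Linf arclength)" "AE \<zeta> in arclength. ((\<lambda>r. f (r *\<^sub>R \<zeta>)) \<longlongrightarrow> g \<zeta>) (at_left 1)"
    for f g n
    unfolding \<omega>_def root_avg_def using ct_of[OF that node] by (simp del: sum.lessThan_Suc of_nat_Suc)
  have one_Y: "(\<lambda>_. 1) \<in> ?Y" using one_X XY by blast
  have one_Linf: "(\<lambda>_. 1) \<in> elements (Linf arclength)" using one_Y by (simp add: boundary_functions_def)
  have \<omega>_one: "\<omega> n (\<lambda>_. 1) = 1" for n
  proof -
    have "\<omega> n (\<lambda>_. 1) = root_avg (Suc n) (\<lambda>_. 1) (of_real (r n))"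
      using one_disc one_Linf by (intro \<omega>_of) (auto simp: disc_algebra_def)
    then show ?thesis by (simp add: root_avg_def del: of_nat_Suc)
  qed
  show ?thesis
  proof (rule not_gleason_whitney_if_limits_differ[where \<omega> = \<omega> and T = S and ?T0.0 = "\<lambda>_. 1" and e = "\<lambda>_. 1"
        and G = sequentially and a = 0 and b = 1 and \<phi> = "\<lambda>g. \<integral>\<zeta>. g \<zeta> * (1 / of_real (2 * pi)) \<partial>arclength"])
    show "?Y \<subseteq> elements (Linf arclength)" by (auto simp: boundary_functions_def)
    show "clinear_on ?Y (\<omega> n)" for n
    proof -
      have lin: "clinear_on (elements (Linf arclength)) (\<lambda>g. cauchy_transform g z)" if "cmod z < 1" for z
        unfolding cauchy_transform_def by (rule Linf_functional_clinear[OF cauchy_kernel_integrable[OF that]])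
      have sub: "g \<in> elements (Linf arclength)" if "g \<in> ?Y" for g using that by (simp add: boundary_functions_def)
      have add: "cauchy_transform (g + h) z = cauchy_transform g z + cauchy_transform h z"
        and scale: "cauchy_transform (c *\<^sub>C g) z = c * cauchy_transform g z"
        if "g \<in> ?Y" "h \<in> ?Y" "cmod z < 1" for g h z c
        using lin[OF that(3)] sub that unfolding clinear_on_def by (simp_all add: scaleC_complex_def)
      show ?thesis
        unfolding clinear_on_def
      proof (intro conjI ballI allI)
        show "\<omega> n (g + h) = \<omega> n g + \<omega> n h" if "g \<in> ?Y" "h \<in> ?Y" for g h
          unfolding \<omega>_def root_avg_def using add[OF that node]
          by (simp add: sum.distrib add_divide_distrib del: sum.lessThan_Suc of_nat_Suc)
        show "\<omega> n (c *\<^sub>C g) = c *\<^sub>C \<omega> n g" if "g \<in> ?Y" for g c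
          unfolding \<omega>_def root_avg_def scaleC_complex_def using scale[OF that that node]
          by (simp add: sum_distrib_left del: sum.lessThan_Suc of_nat_Suc)
      qed
    qed
    show "cmod (\<omega> n g) \<le> dnorm (Linf arclength) g" if "g \<in> ?Y" for n g
      unfolding \<omega>_def using cauchy_transform_le_dnorm[OF that node] by (intro root_avg_bound) auto
    show "dnorm (Linf arclength) (\<lambda>_. 1) \<le> 1" by (intro Linf_memI(2)) auto
    have const_int: "integrable arclength (\<lambda>_ :: complex. 1 / complex_of_real (2 * pi))"
      by (rule finite_measure.integrable_const[OF finite_measure_arclength])
    then show "(\<lambda>g. \<integral>\<zeta>. g \<zeta> * (1 / of_real (2 * pi)) \<partial>arclength) \<in> predual (Linf arclength)"
      by (rule Linf_predualI)
    show "clinear_on (elements (Linf arclength)) (\<lambda>g. \<integral>\<zeta>. g \<zeta> * (1 / of_real (2 * pi)) \<partial>arclength)"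
      by (rule Linf_functional_clinear[OF const_int])
    show "(\<lambda>n. \<omega> n g) \<longlonglongrightarrow> (\<integral>\<zeta>. g \<zeta> * (1 / of_real (2 * pi)) \<partial>arclength)"
      if g: "g \<in> boundary_functions arclength disc_algebra" for g
    proof -
      obtain f where f: "f \<in> disc_algebra" "AE \<zeta> in arclength. ((\<lambda>r. f (r *\<^sub>R \<zeta>)) \<longlongrightarrow> g \<zeta>) (at_left 1)"
        and g': "g \<in> elements (Linf arclength)" using g by (auto simp: boundary_functions_def)
      have fH: "f \<in> Hinf_disc" using f(1) by (simp add: disc_algebra_def)
      have "(\<lambda>n. root_avg n f (of_real (r (n - 1)))) \<longlonglongrightarrow> f 0"
      proof (rule root_avg_tendsto_value_at_0[where A = "ball 0 1"])
        show "\<exists>p. \<forall>w\<in>ball 0 1. cmod (f w - poly p w) < e" if "e > 0" for e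
          using f(1) that by (simp add: disc_algebra_def)
      qed (use r(1,2) in \<open>auto simp: norm_mult less_imp_le\<close>)
      from LIMSEQ_Suc[OF this] have "(\<lambda>n. \<omega> n g) \<longlonglongrightarrow> f 0"
        using \<omega>_of[OF fH g' f(2)] by simp
      also have "f 0 = cauchy_transform g 0" using ct_of[OF fH g' f(2), of 0] by simp
      also have "\<dots> = (\<integral>\<zeta>. g \<zeta> * (1 / of_real (2 * pi)) \<partial>arclength)"
        unfolding cauchy_transform_def
      proof (rule integral_cong_AE)
        show "(\<lambda>\<zeta>. g \<zeta> * (\<zeta> / (\<zeta> - 0) / of_real (2 * pi))) \<in> borel_measurable arclength"
          by (intro borel_measurable_times Linf_measurable[OF g'] cauchy_kernel_measurable)
        show "(\<lambda>\<zeta>. g \<zeta> * (1 / of_real (2 * pi))) \<in> borel_measurable arclength"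
          by (intro borel_measurable_times Linf_measurable[OF g']) simp
        show "AE \<zeta> in arclength. g \<zeta> * (\<zeta> / (\<zeta> - 0) / of_real (2 * pi)) = g \<zeta> * (1 / of_real (2 * pi))"
          using AE_arclength_unit by eventually_elim auto
      qed
      finally show ?thesis .
    qed
    show "(\<lambda>i. p (S i)) \<longlonglongrightarrow> p (\<lambda>_. 1)" if p: "p \<in> predual (Linf arclength)" for p
    proof -
      obtain q where q: "p = (\<lambda>g. \<integral>\<zeta>. g \<zeta> * q \<zeta> \<partial>arclength)" "integrable arclength q"
        using p by (auto simp: Linf_def)
      have "(\<lambda>i. \<integral>\<zeta>. S i \<zeta> * q \<zeta> \<partial>arclength) \<longlonglongrightarrow> (\<integral>\<zeta>. 1 * q \<zeta> \<partial>arclength)"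
      proof (rule integral_dominated_convergence[where w = "\<lambda>\<zeta>. cmod (q \<zeta>)"])
        show "AE \<zeta> in arclength. (\<lambda>i. S i \<zeta> * q \<zeta>) \<longlonglongrightarrow> 1 * q \<zeta>"
          using S_one by eventually_elim (intro tendsto_mult tendsto_const)
        show "AE \<zeta> in arclength. cmod (S i \<zeta> * q \<zeta>) \<le> cmod (q \<zeta>)" for i
          using S_bound[of i] by eventually_elim (simp add: norm_mult mult_left_le_one_le)
        show "(\<lambda>\<zeta>. S i \<zeta> * q \<zeta>) \<in> borel_measurable arclength" for i
          using q(2) by (intro borel_measurable_times S_meas) auto
      qed (use q(2) in auto)
      then show ?thesis by (simp add: q(1))
    qed
    show "(\<lambda>n. \<omega> n (S i)) \<longlonglongrightarrow> 0" for i
    proof (rule Lim_null_comparison)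
      have Si: "S i \<in> elements (Linf arclength)" by (rule Linf_memI(1)[OF S_meas S_bound]) simp
      have "cmod (\<omega> n (S i)) \<le> exp (- real (Suc n))" if "i \<le> n" for n
        unfolding \<omega>_of[OF S_Hinf Si S_lim]
      proof (rule root_avg_bound)
        fix k
        let ?z = "cis (2 * pi * real k / real (Suc n)) * of_real (r n)"
        have "cis (2 * pi * real k / real (Suc n)) ^ Suc n = cis (real (Suc n) * (2 * pi * real k / real (Suc n)))"
          by (rule Complex.DeMoivre)
        also have "real (Suc n) * (2 * pi * real k / real (Suc n)) = 2 * pi * real k" by (simp del: of_nat_Suc)
        also have "cis (2 * pi * real k) = 1" using cis_multiple_2pi[of "real k"] by simp
        finally have "?z ^ Suc n = of_real (r n ^ Suc n)"
          by (simp only: power_mult_distrib mult_1_left of_real_power)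
        then show "cmod (S i ?z) \<le> exp (- real (Suc n))"
          using node that unfolding r(3) by (intro S_small)
      qed simp
      then show "eventually (\<lambda>n. norm (\<omega> n (S i)) \<le> exp (- real (Suc n))) sequentially"
        by (rule eventually_sequentiallyI)
      have "(\<lambda>n. exp (- 1) ^ Suc n) \<longlonglongrightarrow> (0 :: real)"
        by (intro LIMSEQ_Suc LIMSEQ_realpow_zero) auto
      then show "(\<lambda>n. exp (- real (Suc n))) \<longlonglongrightarrow> 0"
        by (simp add: exp_of_nat_mult[symmetric] del: power_Suc of_nat_Suc)
    qed
  qed (use XY one_X one_Y S_Y \<omega>_one in auto)
qed

section \<open>The seven inclusions\<close>

theorem theorem3:
  shows
    "\<not> gleason_whitney (Linf (lebesgue_on {0..1::real}))
        {f. continuous_on {0..1} f}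
        (elements (Linf (lebesgue_on {0..1}))) \<and>
     \<not> gleason_whitney (bounded_operators (L2 (lebesgue_on {0..1::real})))
        (mult_op ` elements (Linf (lebesgue_on {0..1})))
        (elements (bounded_operators (L2 (lebesgue_on {0..1})))) \<and>
     \<not> gleason_whitney (Linf arclength)
        (boundary_functions arclength disc_algebra)
        (boundary_functions arclength Hinf_disc) \<and>
     \<not> gleason_whitney (bounded_operators hardy2)
        (mult_op ` Hinf_disc)
        (elements (bounded_operators hardy2)) \<and>
     \<not> gleason_whitney (Linf (lebesgue_on (ball 0 1)))
        Hinf_disc
        (elements (Linf (lebesgue_on (ball 0 1)))) \<and>
     (CARD('d::finite) \<ge> 2 \<longrightarrow>
       \<not> gleason_whitney (Linf (sphere_measure :: (complex ^ 'd) measure))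
          (boundary_functions sphere_measure (Hinf (ball 0 1)))
          (elements (Linf sphere_measure))) \<and>
     (CARD('d) \<ge> 2 \<longrightarrow>
       \<not> gleason_whitney (Linf (torus_measure :: (complex ^ 'd) measure))
          (boundary_functions torus_measure (Hinf polydisc))
          (elements (Linf torus_measure)))"
  using not_gleason_whitney_continuous not_gleason_whitney_mult_ops_L2 not_gleason_whitney_disc_algebra
    not_gleason_whitney_mult_ops_hardy2 not_gleason_whitney_Hinf_disc_Linf_disc
    not_gleason_whitney_sphere not_gleason_whitney_torus
  by (intro conjI impI)

end
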